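(* Let $f\in\mathcal{O}=\mathbb{C}\{x_1,\ldots,x_n\}$ be free and suppose that $\operatorname{Der}_f\subset\mathfrak{m}\operatorname{Der}$ (that is, every logarithmic derivation for $f$ is singular). Then there exists an $\widehat{\mathcal{O}}$-basis of $\widehat{\operatorname{Der}}_f$ each of whose elements is either semisimple or topologically nilpotent. Moreover, $f$ is equal to a unit of $\widehat{\mathcal{O}}$ multiplied by the determinant of the Saito matrix with respect to that basis.
   Context: $\mathcal{O}=\mathbb{C}\{x_1,\ldots,x_n\}$ is the ring of convergent power series with maximal ideal $\mathfrak{m}=\langle x_1,\ldots,x_n\rangle$, and $\widehat{\mathcal{O}}=\mathbb{C}[[x_1,\ldots,x_n]]$ with maximal ideal $\widehat{\mathfrak m}$. $\operatorname{Der}$ (resp. $\widehat{\operatorname{Der}}$) is the free module of $\mathbb{C}$-derivations of $\mathcal{O}$ (resp. $\widehat{\mathcal O}$), with basis $\partial_1,\ldots,\partial_n$. $\operatorname{Der}_f=\{\delta\in\operatorname{Der}:\delta(f)\in\mathcal{O}f\}$ and $\widehat{\operatorname{Der}}_f=\{\delta\in\widehat{\operatorname{Der}}:\delta(f)\in\widehat{\mathcal{O}}f\}$ (the $\mathfrak{m}$-adic completion of $\operatorname{Der}_f$) are the modules of logarithmic derivations. A germ $f\in\mathcal{O}$ is called free if it is a reduced (no repeated factors) local equation of a divisor and $\operatorname{Der}_f$ is a free $\mathcal{O}$-module; equivalently (Saito's criterion) there are $\delta_1,\ldots,\delta_n\in\operatorname{Der}_f$ and a unit $u\in\mathcal O$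 with $f=u\det(\delta_i(x_j))_{i,j}$, in which case $\{\delta_1,\ldots,\delta_n\}$ is a basis of $\operatorname{Der}_f$. The Saito matrix with respect to derivations $\delta_1,\ldots,\delta_n$ is $(\delta_i(x_j))_{i,j}$. A derivation $\sum_i a_i\partial_i$ is singular if all $a_i$ lie in the maximal ideal. A singular derivation $\delta$ of $\widehat{\mathcal{O}}$ is semisimple if every subspace $H\subseteq\widehat{\mathcal{O}}$ that is closed for the $\widehat{\mathfrak m}$-adic topology and stable under $\delta$ has a supplementary subspace stable under $\delta$; it is topologically nilpotent if $\delta^m(h)\to0$ in the $\widehat{\mathfrak m}$-adic topology for every $h\in\widehat{\mathcal{O}}$. *)

theory Defs
  imports
    "HOL-Analysis.Analysis"
    "HOL-Library.Function_Algebras"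
    "HOL-Computational_Algebra.Squarefree"
begin

section \<open>Formal power series in finitely many variables\<close>

text \<open>
  The variables are indexed by a finite type \<open>'n\<close>, a multi-index is a function \<open>'n \<Rightarrow> nat\<close>, and a
  formal power series is its family of coefficients. Sums of multi-indices are pointwise
  (\<^theory>\<open>HOL-Library.Function_Algebras\<close>).
\<close>

typedef 'n mps = "UNIV :: (('n \<Rightarrow> nat) \<Rightarrow> complex) set"
  morphisms mps_coeff Abs_mps
  by simp

setup_lifting type_definition_mps

lemma mps_eqI: "(\<And>c. mps_coeff f c = mps_coeff g c) \<Longrightarrow> f = g"
  by (simp add: mps_coeff_inject[symmetric] fun_eq_iff)

definition splittings :: "('n \<Rightarrow> nat) \<Rightarrow> (('n \<Rightarrow> nat) \<times> ('n \<Rightarrow> nat)) set" where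
  "splittings c = {(a, b). a + b = c}"

lemma finite_below: "finite {a :: 'n::finite \<Rightarrow> nat. a \<le> c}"
proof (rule finite_subset)
  show "{a. a \<le> c} \<subseteq> (\<Pi>\<^sub>E i\<in>UNIV. {..c i})"
    by (auto simp: le_fun_def)
  show "finite (\<Pi>\<^sub>E i\<in>(UNIV :: 'n set). {..c i})"
    by (intro finite_PiE) auto
qed

lemma finite_splittings [simp]: "finite (splittings (c :: 'n::finite \<Rightarrow> nat))"
proof (rule finite_subset)
  show "splittings c \<subseteq> {a. a \<le> c} \<times> {a. a \<le> c}"
    by (auto simp: splittings_def le_fun_def)
  show "finite ({a. a \<le> c} \<times> {a. a \<le> c})"
    by (intro finite_cartesian_product finite_below)
qed

instantiation mps :: (finite) comm_ring_1
begin

lift_definition zero_mps :: "'a mps" is "\<lambda>_. 0" .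
lift_definition one_mps :: "'a mps" is "\<lambda>c. if c = 0 then 1 else 0" .
lift_definition plus_mps :: "'a mps \<Rightarrow> 'a mps \<Rightarrow> 'a mps" is "\<lambda>f g c. f c + g c" .
lift_definition minus_mps :: "'a mps \<Rightarrow> 'a mps \<Rightarrow> 'a mps" is "\<lambda>f g c. f c - g c" .
lift_definition uminus_mps :: "'a mps \<Rightarrow> 'a mps" is "\<lambda>f c. - f c" .
lift_definition times_mps :: "'a mps \<Rightarrow> 'a mps \<Rightarrow> 'a mps" is
  "\<lambda>f g c. \<Sum>(a, b)\<in>splittings c. f a * g b" .

instance
proof
  fix f g h :: "'a mps"
  show "f + g + h = f + (g + h)" "f + g = g + f" "0 + f = f" "- f + f = 0" "f - g = f + - g"
    by (transfer; simp add: fun_eq_iff)+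
  show "(0 :: 'a mps) \<noteq> 1"
    by transfer (auto simp: fun_eq_iff)
  show "f * g = g * f"
  proof (rule mps_eqI)
    fix c
    show "mps_coeff (f * g) c = mps_coeff (g * f) c"
      unfolding times_mps.rep_eq
      by (rule sum.reindex_bij_witness[where i = prod.swap and j = prod.swap])
        (auto simp: splittings_def add.commute mult.commute)
  qed
  show "(f + g) * h = f * h + g * h"
    by transfer (simp add: fun_eq_iff algebra_simps sum.distrib split_def)
  show "1 * f = f"
  proof (rule mps_eqI)
    fix c
    have "mps_coeff (1 * f) c = (\<Sum>(a, b)\<in>splittings c. (if a = 0 then 1 else 0) * mps_coeff f b)"
      by (simp add: times_mps.rep_eq one_mps.rep_eq)
    also have "\<dots> = (\<Sum>(a, b)\<in>{(0 :: 'a \<Rightarrow> nat, c)}. (if a = 0 then 1 else 0) * mps_coeff f b)"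
      by (rule sum.mono_neutral_right) (simp, auto simp: splittings_def split: if_splits)
    finally show "mps_coeff (1 * f) c = mps_coeff f c" by simp
  qed
  show "f * g * h = f * (g * h)"
  proof (rule mps_eqI)
    fix c
    have "mps_coeff (f * g * h) c =
        (\<Sum>(p, d)\<in>splittings c. \<Sum>(a, b)\<in>splittings p. mps_coeff f a * mps_coeff g b * mps_coeff h d)"
      by (simp add: times_mps.rep_eq sum_distrib_right split_def)
    also have "\<dots> = (\<Sum>(q, r)\<in>(SIGMA q:splittings c. splittings (fst q)).
        mps_coeff f (fst r) * mps_coeff g (snd r) * mps_coeff h (snd q))"
      by (subst sum.Sigma[symmetric]) (auto simp: split_def)
    also have "\<dots> = (\<Sum>(q, r)\<in>(SIGMA q:splittings c. splittings (snd q)).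
        mps_coeff f (fst q) * (mps_coeff g (fst r) * mps_coeff h (snd r)))"
      by (rule sum.reindex_bij_witness
          [where j = "\<lambda>(q, r). ((fst r, snd r + snd q), (snd r, snd q))"
             and i = "\<lambda>(q, r). ((fst q + fst r, snd r), (fst q, fst r))"])
        (auto simp: splittings_def add.assoc mult.assoc)
    also have "\<dots> = (\<Sum>(a, p)\<in>splittings c. \<Sum>(b, d)\<in>splittings p. mps_coeff f a * (mps_coeff g b * mps_coeff h d))"
      by (subst sum.Sigma[symmetric]) (auto simp: split_def)
    also have "\<dots> = mps_coeff (f * (g * h)) c"
      by (simp add: times_mps.rep_eq sum_distrib_left split_def)
    finally show "mps_coeff (f * g * h) c = mps_coeff (f * (g * h)) c" .
  qed
qed

end

lift_definition mps_var :: "'n \<Rightarrow> 'n mps" is "\<lambda>i c. if c = (\<lambda>j. if j = i then 1 else 0) then 1 else 0" .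

lift_definition mps_scale :: "complex \<Rightarrow> 'n mps \<Rightarrow> 'n mps" is "\<lambda>z f c. z * f c" .

lemma module_mps: "module (mps_scale :: complex \<Rightarrow> 'n::finite mps \<Rightarrow> 'n mps)"
  by unfold_locales (transfer; simp add: fun_eq_iff algebra_simps)+

lemma mps_scale_mult: "mps_scale z f * g = mps_scale z (f * g)"
  by transfer (simp add: fun_eq_iff sum_distrib_left split_def mult.assoc)


section \<open>Convergent power series\<close>

text \<open>
  Summability over the (unordered) set of all multi-indices is absolute convergence of the
  multiple series.
\<close>

definition monom_eval :: "('n::finite \<Rightarrow> complex) \<Rightarrow> ('n \<Rightarrow> nat) \<Rightarrow> complex" where
  "monom_eval z c = (\<Prod>i\<in>UNIV. z i ^ c i)"

definition convergent_mps :: "'n::finite mps \<Rightarrow> bool" where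
  "convergent_mps f \<longleftrightarrow>
     (\<exists>r>0. \<forall>z. (\<forall>i. norm (z i) < r) \<longrightarrow> (\<lambda>c. mps_coeff f c * monom_eval z c) summable_on UNIV)"

lemma monom_eval_add: "monom_eval z (a + b) = monom_eval z a * monom_eval z b"
  by (simp add: monom_eval_def power_add prod.distrib)

lemma convergent_finite:
  assumes "finite {c. mps_coeff f c \<noteq> 0}"
  shows "convergent_mps f"
proof -
  have "(\<lambda>c. mps_coeff f c * monom_eval z c) summable_on UNIV" for z
    by (rule finite_nonzero_values_imp_summable_on)
      (use assms in \<open>auto intro: finite_subset[rotated]\<close>)
  then show ?thesis
    unfolding convergent_mps_def by (intro exI[of _ 1]) auto
qed

lemma convergent_mps_common:
  assumes "convergent_mps f" "convergent_mps g"
  obtains r where "r > 0"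
    "\<And>z. (\<And>i. norm (z i) < r) \<Longrightarrow> (\<lambda>c. mps_coeff f c * monom_eval z c) summable_on UNIV"
    "\<And>z. (\<And>i. norm (z i) < r) \<Longrightarrow> (\<lambda>c. mps_coeff g c * monom_eval z c) summable_on UNIV"
proof -
  obtain r s where "r > 0" "s > 0"
    "\<And>z. (\<And>i. norm (z i) < r) \<Longrightarrow> (\<lambda>c. mps_coeff f c * monom_eval z c) summable_on UNIV"
    "\<And>z. (\<And>i. norm (z i) < s) \<Longrightarrow> (\<lambda>c. mps_coeff g c * monom_eval z c) summable_on UNIV"
    using assms unfolding convergent_mps_def by blast
  then show ?thesis
    by (intro that[of "min r s"]) auto
qed

lemma convergent_mps_add:
  assumes "convergent_mps f" "convergent_mps g"
  shows "convergent_mps (f + g)"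
proof -
  obtain r where "r > 0"
    and r: "\<And>z. (\<And>i. norm (z i) < r) \<Longrightarrow> (\<lambda>c. mps_coeff f c * monom_eval z c) summable_on UNIV"
    "\<And>z. (\<And>i. norm (z i) < r) \<Longrightarrow> (\<lambda>c. mps_coeff g c * monom_eval z c) summable_on UNIV"
    using convergent_mps_common[OF assms] by blast
  show ?thesis
    unfolding convergent_mps_def
    by (intro exI[of _ r]) (auto simp: \<open>r > 0\<close> plus_mps.rep_eq distrib_right intro!: summable_on_add r)
qed

lemma convergent_mps_scale:
  assumes "convergent_mps f"
  shows "convergent_mps (mps_scale a f)"
  using assms unfolding convergent_mps_def
  by (auto simp: mps_scale.rep_eq mult.assoc intro!: summable_on_cmult_right)

lemma convergent_mps_uminus:
  assumes "convergent_mps f"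
  shows "convergent_mps (- f)"
  using assms unfolding convergent_mps_def
  by (simp add: uminus_mps.rep_eq summable_on_uminus)

lemma convergent_mps_mult:
  assumes "convergent_mps f" "convergent_mps g"
  shows "convergent_mps (f * g)"
proof -
  obtain r where "r > 0"
    and r: "\<And>z. (\<And>i. norm (z i) < r) \<Longrightarrow> (\<lambda>c. mps_coeff f c * monom_eval z c) summable_on UNIV"
    "\<And>z. (\<And>i. norm (z i) < r) \<Longrightarrow> (\<lambda>c. mps_coeff g c * monom_eval z c) summable_on UNIV"
    using convergent_mps_common[OF assms] by blast
  have "(\<lambda>c. mps_coeff (f * g) c * monom_eval z c) summable_on UNIV" if z: "\<And>i. norm (z i) < r" for z
  proof -
    define F where "F = (\<lambda>c. mps_coeff f c * monom_eval z c)"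
    define G where "G = (\<lambda>c. mps_coeff g c * monom_eval z c)"
    have FG: "(\<lambda>a. norm (F a)) summable_on UNIV" "(\<lambda>b. norm (G b)) summable_on UNIV"
      using r[OF z] by (simp_all add: F_def G_def flip: summable_on_iff_abs_summable_on_complex)
    have "(\<lambda>p. norm ((\<lambda>(a, b). F a * G b) p)) summable_on (UNIV \<times> UNIV)"
      unfolding Infinite_Sum.abs_summable_on_Sigma_iff
    proof (intro conjI ballI)
      fix a
      show "(\<lambda>b. norm (case (a, b) of (a, b) \<Rightarrow> F a * G b)) summable_on UNIV"
        using summable_on_cmult_right[OF FG(2)] by (simp add: norm_mult)
    next
      have "(\<lambda>a. infsum (\<lambda>b. norm (case (a, b) of (a, b) \<Rightarrow> F a * G b)) UNIV) =
          (\<lambda>a. norm (F a) * infsum (\<lambda>b. norm (G b)) UNIV)"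
        by (simp add: norm_mult infsum_cmult_right')
      then show "(\<lambda>a. norm (infsum (\<lambda>b. norm (case (a, b) of (a, b) \<Rightarrow> F a * G b)) UNIV)) summable_on UNIV"
        using summable_on_cmult_left[OF FG(1)] by (simp add: abs_mult infsum_nonneg)
    qed
    then have "(\<lambda>(a, b). F a * G b) summable_on UNIV"
      by (simp add: abs_summable_summable)
    also have "?this \<longleftrightarrow> (\<lambda>(c, a, b). F a * G b) summable_on (SIGMA c:UNIV. splittings c)"
      by (rule summable_on_reindex_bij_witness[where j = "\<lambda>(a, b). (a + b, a, b)" and i = snd])
        (auto simp: splittings_def)
    finally have "(\<lambda>c. infsum (\<lambda>(a, b). F a * G b) (splittings c)) summable_on UNIV"
      by (rule summable_on_Sigma_banach)
    moreover have "infsum (\<lambda>(a, b). F a * G b) (splittings c) = mps_coeff (f * g) c * monom_eval z c" for c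
    proof -
      have "infsum (\<lambda>(a, b). F a * G b) (splittings c) = (\<Sum>(a, b)\<in>splittings c. F a * G b)"
        by simp
      also have "\<dots> = (\<Sum>(a, b)\<in>splittings c. mps_coeff f a * mps_coeff g b * monom_eval z c)"
        by (rule sum.cong) (auto simp: splittings_def F_def G_def monom_eval_add)
      also have "\<dots> = mps_coeff (f * g) c * monom_eval z c"
        by (simp add: times_mps.rep_eq sum_distrib_right split_def)
      finally show ?thesis .
    qed
    ultimately show ?thesis by simp
  qed
  then show ?thesis
    using \<open>r > 0\<close> unfolding convergent_mps_def by blast
qed

lemma convergent_mps_zero: "convergent_mps 0"
  by (rule convergent_finite) (simp add: zero_mps.rep_eq)

lemma convergent_mps_one: "convergent_mps 1"
  by (rule convergent_finite) (simp add: one_mps.rep_eq)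

lemma convergent_mps_var: "convergent_mps (mps_var i)"
  by (rule convergent_finite) (simp add: mps_var.rep_eq)

lemma convergent_mps_minus: "convergent_mps f \<Longrightarrow> convergent_mps g \<Longrightarrow> convergent_mps (f - g)"
  using convergent_mps_add[of f "- g"] convergent_mps_uminus[of g] by simp

typedef (overloaded) 'n cps = "{f :: 'n::finite mps. convergent_mps f}"
  morphisms to_formal Abs_cps
  using convergent_mps_zero by auto

setup_lifting type_definition_cps

instantiation cps :: (finite) comm_ring_1
begin

lift_definition zero_cps :: "'a cps" is 0 by (rule convergent_mps_zero)
lift_definition one_cps :: "'a cps" is 1 by (rule convergent_mps_one)
lift_definition plus_cps :: "'a cps \<Rightarrow> 'a cps \<Rightarrow> 'a cps" is "(+)" by (rule convergent_mps_add)
lift_definition minus_cps :: "'a cps \<Rightarrow> 'a cps \<Rightarrow> 'a cps" is "(-)" by (rule convergent_mps_minus)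
lift_definition uminus_cps :: "'a cps \<Rightarrow> 'a cps" is uminus by (rule convergent_mps_uminus)
lift_definition times_cps :: "'a cps \<Rightarrow> 'a cps \<Rightarrow> 'a cps" is "(*)" by (rule convergent_mps_mult)

instance
proof
  fix f g h :: "'a cps"
  show "f * g * h = f * (g * h)" by transfer (rule mult.assoc)
  show "f * g = g * f" by transfer (rule mult.commute)
  show "1 * f = f" by transfer (rule mult_1_left)
  show "(f + g) * h = f * h + g * h" by transfer (rule distrib_right)
  show "f + g + h = f + (g + h)" by transfer (rule add.assoc)
  show "f + g = g + f" by transfer (rule add.commute)
  show "0 + f = f" by transfer (rule add_0_left)
  show "- f + f = 0" by transfer (rule left_minus)
  show "f - g = f + - g" by transfer (rule diff_conv_add_uminus)
  show "(0 :: 'a cps) \<noteq> 1" by transfer (rule zero_neq_one)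
qed

end

lift_definition cps_var :: "'n::finite \<Rightarrow> 'n cps" is mps_var by (rule convergent_mps_var)

lift_definition cps_scale :: "complex \<Rightarrow> 'n::finite cps \<Rightarrow> 'n cps" is mps_scale
  by (rule convergent_mps_scale)

lemma module_cps: "module (cps_scale :: complex \<Rightarrow> 'n::finite cps \<Rightarrow> 'n cps)"
proof
  fix a b :: complex and f g :: "'n cps"
  interpret mps: module "mps_scale :: complex \<Rightarrow> 'n mps \<Rightarrow> 'n mps" by (rule module_mps)
  show "cps_scale a (f + g) = cps_scale a f + cps_scale a g"
    by transfer (rule mps.scale_right_distrib)
  show "cps_scale (a + b) f = cps_scale a f + cps_scale b f"
    by transfer (rule mps.scale_left_distrib)
  show "cps_scale a (cps_scale b f) = cps_scale (a * b) f"
    by transfer (rule mps.scale_scale)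
  show "cps_scale 1 f = f"
    by transfer (rule mps.scale_one)
qed


section \<open>Maximal ideal and adic topology\<close>

text \<open>
  From here on everything is stated for a commutative ring \<open>'a\<close> so that it applies both to
  \<open>'n cps\<close> and to \<open>'n mps\<close>. The family \<open>x\<close> stands for the coordinates \<open>cps_var\<close> or \<open>mps_var\<close>, and
  \<open>s\<close> for the scalar multiplication \<open>cps_scale\<close> or \<open>mps_scale\<close>.
\<close>

text \<open>
  An ideal is a submodule of the ring over itself. The locale is not interpreted globally because
  its simplification rule \<open>a * (b * c) = (a * b) * c\<close> clashes with \<open>algebra_simps\<close>.
\<close>

lemma module_ring: "module ((*) :: 'a::comm_ring_1 \<Rightarrow> 'a \<Rightarrow> 'a)"
  by standard (simp_all add: algebra_simps)

definition max_ideal :: "('n \<Rightarrow> 'a::comm_ring_1) \<Rightarrow> 'a set" where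
  "max_ideal x = module.span (*) (range x)"

primrec ideal_power :: "'a::comm_ring_1 set \<Rightarrow> nat \<Rightarrow> 'a set" where
  "ideal_power I 0 = UNIV"
| "ideal_power I (Suc k) = module.span (*) {a * b | a b. a \<in> I \<and> b \<in> ideal_power I k}"

definition adic_topology :: "'a::comm_ring_1 set \<Rightarrow> 'a topology" where
  "adic_topology I = topology (\<lambda>U. \<forall>g\<in>U. \<exists>k. \<forall>h. h - g \<in> ideal_power I k \<longrightarrow> h \<in> U)"

lemma subspace_ideal_power: "module.subspace (*) (ideal_power I k)"
  by (cases k) (simp_all add: module.subspace_UNIV[OF module_ring] module.subspace_span[OF module_ring])

lemma ideal_power_antimono: "j \<le> k \<Longrightarrow> ideal_power I k \<subseteq> ideal_power I j"
proof (induction rule: dec_induct)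
  case (step m)
  have "ideal_power I (Suc m) \<subseteq> ideal_power I m"
    unfolding ideal_power.simps
    by (rule module.span_minimal[OF module_ring])
      (auto intro: module.subspace_scale[OF module_ring] subspace_ideal_power)
  with step show ?case by blast
qed simp

lemma openin_adic_topology:
  "openin (adic_topology I) U \<longleftrightarrow> (\<forall>g\<in>U. \<exists>k. \<forall>h. h - g \<in> ideal_power I k \<longrightarrow> h \<in> U)"
proof -
  have "istopology (\<lambda>U. \<forall>g\<in>U. \<exists>k. \<forall>h. h - g \<in> ideal_power I k \<longrightarrow> h \<in> U)"
    unfolding istopology_def
  proof (intro conjI allI impI ballI)
    fix S T g
    assume S: "\<forall>g\<in>S. \<exists>k. \<forall>h. h - g \<in> ideal_power I k \<longrightarrow> h \<in> S"
      and T: "\<forall>g\<in>T. \<exists>k. \<forall>h. h - g \<in> ideal_power I k \<longrightarrow> h \<in> T"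
      and g: "g \<in> S \<inter> T"
    obtain k l where "\<forall>h. h - g \<in> ideal_power I k \<longrightarrow> h \<in> S" "\<forall>h. h - g \<in> ideal_power I l \<longrightarrow> h \<in> T"
      using S T g by blast
    moreover have "ideal_power I (max k l) \<subseteq> ideal_power I k" "ideal_power I (max k l) \<subseteq> ideal_power I l"
      by (simp_all add: ideal_power_antimono)
    ultimately show "\<exists>k. \<forall>h. h - g \<in> ideal_power I k \<longrightarrow> h \<in> S \<inter> T"
      by (intro exI[of _ "max k l"]) auto
  next
    fix K g
    assume "\<forall>S\<in>K. \<forall>g\<in>S. \<exists>k. \<forall>h. h - g \<in> ideal_power I k \<longrightarrow> h \<in> S" "g \<in> \<Union> K"
    then show "\<exists>k. \<forall>h. h - g \<in> ideal_power I k \<longrightarrow> h \<in> \<Union> K"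
      by (meson Union_iff)
  qed
  then show ?thesis
    by (simp add: adic_topology_def)
qed


section \<open>Logarithmic derivations and free germs\<close>

definition derivation :: "('k::comm_ring_1 \<Rightarrow> 'a::comm_ring_1 \<Rightarrow> 'a) \<Rightarrow> ('a \<Rightarrow> 'a) \<Rightarrow> bool" where
  "derivation s \<delta> \<longleftrightarrow> module_hom s s \<delta> \<and> (\<forall>g h. \<delta> (g * h) = g * \<delta> h + h * \<delta> g)"

definition log_der :: "('k::comm_ring_1 \<Rightarrow> 'a::comm_ring_1 \<Rightarrow> 'a) \<Rightarrow> 'a \<Rightarrow> ('a \<Rightarrow> 'a) set" where
  "log_der s f = {\<delta>. derivation s \<delta> \<and> f dvd \<delta> f}"

definition der_scale :: "'a::comm_ring_1 \<Rightarrow> ('a \<Rightarrow> 'a) \<Rightarrow> ('a \<Rightarrow> 'a)" where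
  "der_scale a \<delta> = (\<lambda>g. a * \<delta> g)"

lemma module_der: "module (der_scale :: 'a::comm_ring_1 \<Rightarrow> ('a \<Rightarrow> 'a) \<Rightarrow> ('a \<Rightarrow> 'a))"
  by standard (simp_all add: der_scale_def fun_eq_iff algebra_simps)

definition der_basis :: "('a::comm_ring_1 \<Rightarrow> 'a) set \<Rightarrow> ('a \<Rightarrow> 'a) set \<Rightarrow> bool" where
  "der_basis B M \<longleftrightarrow> \<not> module.dependent der_scale B \<and> module.span der_scale B = M"

text \<open>\<^const>\<open>squarefree\<close> excludes \<open>f = 0\<close>.\<close>

definition free_germ :: "'n::finite cps \<Rightarrow> bool" where
  "free_germ f \<longleftrightarrow> squarefree f \<and> (\<exists>B. der_basis B (log_der cps_scale f))"

text \<open>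
  A derivation \<open>\<Sum>\<^sub>i a\<^sub>i \<partial>\<^sub>i\<close> has the coefficients \<open>a\<^sub>i = \<delta> (x i)\<close>.
\<close>

definition singular_der :: "('n \<Rightarrow> 'a::comm_ring_1) \<Rightarrow> ('a \<Rightarrow> 'a) \<Rightarrow> bool" where
  "singular_der x \<delta> \<longleftrightarrow> (\<forall>i. \<delta> (x i) \<in> max_ideal x)"

definition saito_matrix :: "('n \<Rightarrow> 'a::comm_ring_1) \<Rightarrow> ('n \<Rightarrow> 'a \<Rightarrow> 'a) \<Rightarrow> 'a^'n^'n" where
  "saito_matrix x \<delta> = (\<chi> i j. \<delta> i (x j))"


section \<open>Semisimple and topologically nilpotent derivations\<close>

abbreviation mps_topology :: "'n::finite mps topology" where
  "mps_topology \<equiv> adic_topology (max_ideal mps_var)"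

definition semisimple_der :: "('n::finite mps \<Rightarrow> 'n mps) \<Rightarrow> bool" where
  "semisimple_der \<delta> \<longleftrightarrow> derivation mps_scale \<delta> \<and> singular_der mps_var \<delta> \<and>
     (\<forall>H. module.subspace mps_scale H \<and> closedin mps_topology H \<and> \<delta> ` H \<subseteq> H \<longrightarrow>
       (\<exists>K. module.subspace mps_scale K \<and> \<delta> ` K \<subseteq> K \<and>
            H \<inter> K = {0} \<and> {h + k | h k. h \<in> H \<and> k \<in> K} = UNIV))"

definition top_nilpotent_der :: "('n::finite mps \<Rightarrow> 'n mps) \<Rightarrow> bool" where
  "top_nilpotent_der \<delta> \<longleftrightarrow> derivation mps_scale \<delta> \<and> singular_der mps_var \<delta> \<and>
     (\<forall>h. limitin mps_topology (\<lambda>m. (\<delta> ^^ m) h) 0 sequentially)"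

end

theory Submission
  imports
    "HOL-Algebra.Algebraic_Closure_Type"
    "HOL-Computational_Algebra.Polynomial_Factorial"
    Defs
begin

text \<open>
  Let \<open>\<delta>\<^sub>1, \<dots>, \<delta>\<^sub>n\<close> be a basis of the logarithmic derivations of \<open>f\<close>. Over formal power series each
  \<open>\<delta>\<^sub>i\<close>, being singular, is the sum of a semisimple derivation \<open>\<sigma>\<^sub>i\<close> and a topologically nilpotent
  derivation \<open>\<nu>\<^sub>i\<close>. Both are limits of polynomials in \<open>\<delta>\<^sub>i\<close>, so they preserve the closed ideal
  generated by \<open>f\<close> and are logarithmic. Hence \<open>\<sigma>\<^sub>i\<close> and \<open>\<nu>\<^sub>i\<close> are combinations of the basis whose
  coefficient rows add up to the unit matrix; expanding the determinant of the unit matrix by rows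
  shows that some choice of \<open>\<sigma>\<^sub>i\<close> or \<open>\<nu>\<^sub>i\<close> for each \<open>i\<close> has a coefficient matrix with unit determinant.

  It remains to see that the \<open>\<delta>\<^sub>i\<close> are also a basis over formal power series and that the
  determinant of their Saito matrix is \<open>f\<close> up to a formal unit. After a generic shift
  \<open>f(x + z t)\<close>, Weierstrass preparation turns \<open>f\<close> into a polynomial in \<open>t\<close> with convergent
  coefficients. As convergent power series are completely integrally closed, a repeated factor of this
  polynomial over the fraction field would be convergent and would give a square factor of \<open>f\<close> at
  \<open>t = 0\<close>. So a nonzero series in \<open>x\<close> alone lies in the ideal of the shifts of \<open>f\<close> and of its
  derivative along \<open>z\<close>, and uniqueness of Weierstrass division replaces all arguments with prime factors
  of \<open>f\<close>.
\<close>

text \<open>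
  Unification leaves \<open>0\<close> in the eta-expanded form \<open>\<lambda>x. 0 x\<close>, which the simplification rule
  would turn into \<open>\<lambda>x. 0\<close>; likewise for sums.
\<close>
declare zero_fun_apply [simp del] plus_fun_apply [simp del]

section \<open>Monomials and order\<close>

text \<open>\<open>free_germ\<close> provides a basis over convergent series whose size is unknown,
  and \<open>squarefree\<close> speaks of convergent factors only, while the result is formal. The
  series in \<open>x\<close> alone is the bridge: it is found from convergent data, but the identity
  that expresses it can be multiplied by arbitrary formal series and so replaces coprimality of
  \<open>f\<close> with its derivative along \<open>z\<close>. The extra variable is introduced
  because \<open>f\<close> need not be regular in any of its own variables; setting
  \<open>t = 0\<close> undoes the shift. One device serves algebra and analysis alike. The weights
  that order the monomials are also the values of the monomials at a point, so at radii
  \<open>p i\<close> to the power \<open>-s\<close> the terms that come first in the order dominate.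
  A single division recursion therefore yields existence, uniqueness and convergence of quotients.
  Singularity of the logarithmic derivations enters twice: it makes \<open>f\<close> a non-unit,
  hence the direction \<open>z\<close> nonzero, and it makes the derivations preserve the filtration
  by order, on whose finite-dimensional quotients the Jordan decomposition is linear
  algebra.\<close>

definition unit_idx :: "'n \<Rightarrow> 'n \<Rightarrow> nat" where
  "unit_idx i = (\<lambda>j. if j = i then 1 else 0)"

definition mdeg :: "('n::finite \<Rightarrow> nat) \<Rightarrow> nat" where
  "mdeg c = (\<Sum>i\<in>UNIV. c i)"

lemma mdeg_0 [simp]: "mdeg 0 = 0"
  by (simp add: mdeg_def zero_fun_apply)

lemma mdeg_add [simp]: "mdeg (a + b) = mdeg a + mdeg b"
  by (simp add: mdeg_def sum.distrib plus_fun_apply)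

lemma mdeg_unit_idx [simp]: "mdeg (unit_idx i) = 1"
  by (simp add: mdeg_def unit_idx_def)

lemma mdeg_eq_0_iff [simp]: "mdeg c = 0 \<longleftrightarrow> c = 0"
  by (auto simp: mdeg_def fun_eq_iff zero_fun_apply plus_fun_apply)

lemma finite_mdeg_le: "finite {c :: 'n::finite \<Rightarrow> nat. mdeg c \<le> k}"
proof (rule finite_subset)
  show "{c :: 'n \<Rightarrow> nat. mdeg c \<le> k} \<subseteq> {c. c \<le> (\<lambda>_. k)}"
  proof clarify
    fix c :: "'n \<Rightarrow> nat" assume c: "mdeg c \<le> k"
    show "c \<le> (\<lambda>_. k)"
    proof (rule le_funI)
      fix i
      have "c i \<le> mdeg c" unfolding mdeg_def by (rule member_le_sum) auto
      with c show "c i \<le> k" by simp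
    qed
  qed
qed (rule finite_below)

lemma mps_coeff_zero [simp]: "mps_coeff 0 c = 0"
  by (simp add: zero_mps.rep_eq)

lemma mps_coeff_one: "mps_coeff 1 c = (if c = 0 then 1 else 0)"
  by (simp add: one_mps.rep_eq)

lemma mps_coeff_add [simp]: "mps_coeff (f + g) c = mps_coeff f c + mps_coeff g c"
  by (simp add: plus_mps.rep_eq)

lemma mps_coeff_diff [simp]: "mps_coeff (f - g) c = mps_coeff f c - mps_coeff g c"
  by (simp add: minus_mps.rep_eq)

lemma mps_coeff_uminus [simp]: "mps_coeff (- f) c = - mps_coeff f c"
  by (simp add: uminus_mps.rep_eq)

lemma mps_coeff_scale [simp]: "mps_coeff (mps_scale z f) c = z * mps_coeff f c"
  by (simp add: mps_scale.rep_eq)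

lemma mps_coeff_sum [simp]: "mps_coeff (\<Sum>i\<in>I. f i) c = (\<Sum>i\<in>I. mps_coeff (f i) c)"
  by (induction I rule: infinite_finite_induct) auto

lemma mps_coeff_mult: "mps_coeff (f * g) c = (\<Sum>(a, b)\<in>splittings c. mps_coeff f a * mps_coeff g b)"
  by (simp add: times_mps.rep_eq)

lemma splittings_0 [simp]: "splittings (0 :: 'n \<Rightarrow> nat) = {(0, 0)}"
  by (auto simp: splittings_def fun_eq_iff zero_fun_apply plus_fun_apply)

lemma mps_coeff_mult_0 [simp]: "mps_coeff (f * g) 0 = mps_coeff f 0 * mps_coeff g 0"
  by (simp add: mps_coeff_mult)

lift_definition mono_mps :: "('n::finite \<Rightarrow> nat) \<Rightarrow> 'n mps" is "\<lambda>a c. if c = a then 1 else 0" .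

lemma mps_coeff_mono: "mps_coeff (mono_mps a) c = (if c = a then 1 else 0)"
  by (simp add: mono_mps.rep_eq)

lemma mps_var_mono: "mps_var i = mono_mps (unit_idx i)"
  by (rule mps_eqI) (simp add: mps_var.rep_eq mono_mps.rep_eq unit_idx_def)

lemma mono_mps_0: "mono_mps 0 = 1"
  by (rule mps_eqI) (simp add: mps_coeff_one mps_coeff_mono)

lemma le_iff_add_idx: "(a :: 'n \<Rightarrow> nat) \<le> c \<longleftrightarrow> (\<exists>b. c = a + b)"
proof
  assume "a \<le> c"
  then have "c = a + (\<lambda>i. c i - a i)" by (auto simp: fun_eq_iff le_fun_def plus_fun_apply)
  then show "\<exists>b. c = a + b" by blast
qed (auto simp: le_fun_def plus_fun_apply)

lemma add_idx_cancel [simp]: "(a :: 'n \<Rightarrow> nat) + b - a = b" "b + a - a = b"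
  by (auto simp: fun_eq_iff zero_fun_apply plus_fun_apply)

lemma mps_coeff_mono_mult:
  "mps_coeff (mono_mps a * f) c = (if a \<le> c then mps_coeff f (c - a) else 0)"
proof (cases "a \<le> c")
  case True
  then obtain b where c: "c = a + b" unfolding le_iff_add_idx by blast
  have "mps_coeff (mono_mps a * f) c = (\<Sum>(x, y)\<in>splittings c. mps_coeff (mono_mps a) x * mps_coeff f y)"
    by (rule mps_coeff_mult)
  also have "\<dots> = (\<Sum>(x, y)\<in>{(a, b)}. mps_coeff (mono_mps a) x * mps_coeff f y)"
    by (rule sum.mono_neutral_right) (simp, auto simp: splittings_def c mps_coeff_mono split: if_splits)
  finally show ?thesis using True c by (simp add: mps_coeff_mono)
next
  case False
  have "mps_coeff (mono_mps a * f) c = (\<Sum>(x, y)\<in>splittings c. mps_coeff (mono_mps a) x * mps_coeff f y)"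
    by (rule mps_coeff_mult)
  also have "\<dots> = 0"
    using False by (intro sum.neutral) (auto simp: splittings_def mps_coeff_mono le_iff_add_idx)
  finally show ?thesis using False by simp
qed

lemma mono_mps_add: "mono_mps (a + b) = mono_mps a * mono_mps b"
proof (rule mps_eqI)
  fix c
  show "mps_coeff (mono_mps (a + b)) c = mps_coeff (mono_mps a * mono_mps b) c"
    unfolding mps_coeff_mono_mult mps_coeff_mono by (auto simp: le_iff_add_idx)
qed

lemma mps_mult_scale: "f * mps_scale z g = mps_scale z (f * g)"
  by (metis mps_scale_mult mult.commute)

lemma mps_scale_simps [simp]: "mps_scale 0 f = 0" "mps_scale 1 f = f" "mps_scale z 0 = 0"
  "mps_scale y (mps_scale z f) = mps_scale (y * z) f"
  by (auto intro!: mps_eqI)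

lemma mps_scale_add: "mps_scale z (f + g) = mps_scale z f + mps_scale z g"
  "mps_scale (y + z) f = mps_scale y f + mps_scale z f"
  "mps_scale z (f - g) = mps_scale z f - mps_scale z g"
  "mps_scale (y - z) f = mps_scale y f - mps_scale z f"
  by (auto intro!: mps_eqI simp: algebra_simps)

lemma mps_scale_sum: "mps_scale z (\<Sum>i\<in>I. f i) = (\<Sum>i\<in>I. mps_scale z (f i))"
  by (auto intro!: mps_eqI simp: sum_distrib_left)

text \<open>This is the \<open>k\<close>-th power of the maximal ideal (see
  \<open>ideal_power_mps\<close>), in a coefficientwise form that makes separatedness and the
  closure properties immediate.\<close>

definition ordge :: "nat \<Rightarrow> 'n::finite mps set" where
  "ordge k = {f. \<forall>c. mdeg c < k \<longrightarrow> mps_coeff f c = 0}"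

lemma ordge_0 [simp]: "ordge 0 = UNIV"
  by (simp add: ordge_def)

lemma ordge_zero [simp]: "0 \<in> ordge k"
  by (simp add: ordge_def)

lemma ordge_add: "f \<in> ordge k \<Longrightarrow> g \<in> ordge k \<Longrightarrow> f + g \<in> ordge k"
  and ordge_diff: "f \<in> ordge k \<Longrightarrow> g \<in> ordge k \<Longrightarrow> f - g \<in> ordge k"
  and ordge_uminus: "f \<in> ordge k \<Longrightarrow> - f \<in> ordge k"
  and ordge_scale: "f \<in> ordge k \<Longrightarrow> mps_scale z f \<in> ordge k"
  by (simp_all add: ordge_def)

lemma ordge_sum: "(\<And>i. i \<in> I \<Longrightarrow> f i \<in> ordge k) \<Longrightarrow> sum f I \<in> ordge k"
  by (simp add: ordge_def)

lemma ordge_antimono: "j \<le> k \<Longrightarrow> f \<in> ordge k \<Longrightarrow> f \<in> ordge j"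
  by (simp add: ordge_def)

lemma ordge_mult: "(f :: 'n::finite mps) \<in> ordge j \<Longrightarrow> g \<in> ordge k \<Longrightarrow> f * g \<in> ordge (j + k)"
proof -
  assume f: "f \<in> ordge j" and g: "g \<in> ordge k"
  have "mps_coeff (f * g) c = 0" if c: "mdeg c < j + k" for c
    unfolding mps_coeff_mult
  proof (rule sum.neutral, clarify)
    fix a b assume "(a, b) \<in> splittings c"
    then have "mdeg a < j \<or> mdeg b < k" using c by (auto simp: splittings_def)
    with f g show "mps_coeff f a * mps_coeff g b = 0" by (auto simp: ordge_def)
  qed
  then show ?thesis by (simp add: ordge_def)
qed

lemma ordge_mult_right: "g \<in> ordge k \<Longrightarrow> f * g \<in> ordge k"
  using ordge_mult[of f 0 g k] by simp

lemma ordge_mult_left: "f \<in> ordge k \<Longrightarrow> f * g \<in> ordge k"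
  using ordge_mult[of f k g 0] by simp

lemma ordge_1_iff: "f \<in> ordge 1 \<longleftrightarrow> mps_coeff f 0 = 0"
  by (simp add: ordge_def)

lemma ordge_eqI: "(\<And>k. f - g \<in> ordge k) \<Longrightarrow> f = g"
proof (rule mps_eqI)
  fix c assume *: "\<And>k. f - g \<in> ordge k"
  show "mps_coeff f c = mps_coeff g c"
    using *[of "Suc (mdeg c)"] by (auto simp: ordge_def)
qed

lemma ordge_0I: "(\<And>k. f \<in> ordge k) \<Longrightarrow> f = 0"
  by (rule ordge_eqI) simp

lemma mps_var_ordge: "mps_var i \<in> ordge 1"
  unfolding ordge_1_iff mps_var_mono mps_coeff_mono by (auto simp: unit_idx_def fun_eq_iff zero_fun_apply plus_fun_apply)

lemma mps_coeff_var_0 [simp]: "mps_coeff (mps_var (i :: 'n::finite)) 0 = 0"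
  using mps_var_ordge[of i] unfolding ordge_1_iff .

text \<open>Each nonzero multi-index \<open>c\<close> is charged to one variable that occurs in it.\<close>

definition pick_idx :: "('n \<Rightarrow> nat) \<Rightarrow> 'n" where
  "pick_idx c = (SOME i. c i > 0)"

lift_definition part_mps :: "'n::finite \<Rightarrow> 'n mps \<Rightarrow> 'n mps" is
  "\<lambda>i f c. if pick_idx (c + unit_idx i) = i then f (c + unit_idx i) else 0" .

lemma mps_decompose:
  fixes f :: "'n::finite mps"
  shows "f = mps_scale (mps_coeff f 0) 1 + (\<Sum>i\<in>UNIV. mps_var i * part_mps i f)"
proof (rule mps_eqI)
  fix c :: "'n \<Rightarrow> nat"
  have le: "unit_idx i \<le> c \<longleftrightarrow> c i > 0" for i
    by (auto simp: unit_idx_def le_fun_def)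
  have eq: "c - unit_idx i + unit_idx i = c" if "c i > 0" for i
    using that by (auto simp: unit_idx_def fun_eq_iff zero_fun_apply plus_fun_apply)
  have *: "mps_coeff (mps_var i * part_mps i f) c = (if c i > 0 \<and> i = pick_idx c then mps_coeff f c else 0)" for i
    by (auto simp: mps_var_mono mps_coeff_mono_mult le part_mps.rep_eq eq)
  show "mps_coeff f c = mps_coeff (mps_scale (mps_coeff f 0) 1 + (\<Sum>i\<in>UNIV. mps_var i * part_mps i f)) c"
  proof (cases "c = 0")
    case True
    then show ?thesis by (simp add: * mps_coeff_one)
  next
    case False
    then obtain i where "c i \<noteq> 0" by (auto simp: fun_eq_iff zero_fun_apply plus_fun_apply)
    then have "c i > 0" by simp
    then have "c (pick_idx c) > 0"
      unfolding pick_idx_def by (rule someI[of "\<lambda>i. c i > 0"])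
    then have "(\<Sum>i\<in>UNIV. mps_coeff (mps_var i * part_mps i f) c) = (\<Sum>i\<in>UNIV. if i = pick_idx c then mps_coeff f c else 0)"
      by (intro sum.cong) (auto simp: *)
    then show ?thesis using False by (simp add: mps_coeff_one)
  qed
qed

lemma part_mps_ordge: "f \<in> ordge (Suc k) \<Longrightarrow> part_mps i f \<in> ordge k"
  by (auto simp: ordge_def part_mps.rep_eq)

lemma max_ideal_mps: "max_ideal (mps_var :: 'n::finite \<Rightarrow> _) = ordge 1"
proof
  interpret R: Modules.module "(*) :: 'n mps \<Rightarrow> _" by (rule module_ring)
  have sub: "R.subspace (ordge 1)"
    by (auto simp: R.subspace_def intro: ordge_add ordge_mult_right)
  show "max_ideal mps_var \<subseteq> (ordge 1 :: 'n mps set)"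
    unfolding max_ideal_def by (rule R.span_minimal[OF _ sub]) (auto intro: mps_var_ordge[simplified])
  show "ordge 1 \<subseteq> max_ideal (mps_var :: 'n \<Rightarrow> _)"
  proof
    fix f :: "'n mps" assume "f \<in> ordge 1"
    then have "f = (\<Sum>i\<in>UNIV. part_mps i f * mps_var i)"
      unfolding ordge_1_iff by (subst mps_decompose) (simp add: mult.commute)
    also have "\<dots> \<in> max_ideal mps_var"
      unfolding max_ideal_def by (intro R.span_sum R.span_scale R.span_base) auto
    finally show "f \<in> max_ideal mps_var" .
  qed
qed

text \<open>Dividing each term by the variable it is charged to lowers the order by at most one, so
  one factor from the maximal ideal can be split off at each step.\<close>

lemma ideal_power_mps: "ideal_power (max_ideal (mps_var :: 'n::finite \<Rightarrow> _)) k = ordge k"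
proof (induction k)
  case (Suc k)
  interpret R: Modules.module "(*) :: 'n mps \<Rightarrow> _" by (rule module_ring)
  have sub: "R.subspace (ordge (Suc k))"
    by (auto simp: R.subspace_def intro: ordge_add ordge_mult_right)
  have "R.span {a * b |a b. a \<in> ordge 1 \<and> b \<in> ordge k} \<subseteq> (ordge (Suc k) :: 'n mps set)"
    by (rule R.span_minimal[OF _ sub]) (auto dest: ordge_mult)
  moreover have "f \<in> R.span {a * b |a b. a \<in> ordge 1 \<and> b \<in> ordge k}" if f: "f \<in> ordge (Suc k)" for f
  proof -
    have "f = (\<Sum>i\<in>UNIV. mps_var i * part_mps i f)"
      using f by (subst mps_decompose) (simp add: ordge_def)
    also have "\<dots> \<in> R.span {a * b |a b. a \<in> ordge 1 \<and> b \<in> ordge k}"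
      using part_mps_ordge[OF f] mps_var_ordge by (intro R.span_sum R.span_base) blast
    finally show ?thesis .
  qed
  ultimately show ?case
    unfolding ideal_power.simps Suc.IH unfolding max_ideal_mps by blast
qed simp

text \<open>
  Used with \<open>d\<close> the difference of two maps and the decomposition \<open>f = f\<^sub>0 + \<Sum>\<^sub>i x\<^sub>i f\<^sub>i\<close>: by induction
  the values of \<open>d\<close> have arbitrarily large order.
\<close>

lemma vanishing_principle:
  fixes d :: "'a \<Rightarrow> 'k::finite mps" and \<phi> :: "'n::finite \<Rightarrow> 'k mps"
  assumes dec: "\<And>f. \<exists>g. d f = (\<Sum>i\<in>UNIV. \<phi> i * d (g i))"
    and \<phi>: "\<And>i. \<phi> i \<in> ordge 1"
  shows "d f = 0"
proof -
  have "\<forall>f. d f \<in> ordge k" for k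
  proof (induction k)
    case (Suc k)
    show ?case
    proof
      fix f
      obtain g where "d f = (\<Sum>i\<in>UNIV. \<phi> i * d (g i))" using dec by blast
      moreover have "\<phi> i * d (g i) \<in> ordge (Suc k)" for i
        using ordge_mult[OF \<phi>, of "d (g i)" k i] Suc by simp
      ultimately show "d f \<in> ordge (Suc k)" by (simp add: ordge_sum)
    qed
  qed simp
  then show ?thesis by (intro ordge_0I) blast
qed

section \<open>Division by a power series\<close>

text \<open>
  Multi-indices are ordered by the natural number \<open>\<Prod>\<^sub>i p\<^sub>i\<^bsup>c\<^sub>i\<^esup>\<close> for distinct primes \<open>p\<^sub>i\<close>: this is a
  monomial order of type \<open>\<omega>\<close> and at the same time evaluation of the monomial at \<open>p\<close>.
\<close>

locale weights =
  fixes p :: "'n::finite \<Rightarrow> nat"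
  assumes prime_p: "prime (p i)" and inj_p: "inj p"
begin

definition wt :: "('n \<Rightarrow> nat) \<Rightarrow> nat" where
  "wt c = (\<Prod>i\<in>UNIV. p i ^ c i)"

lemma wt_0 [simp]: "wt 0 = 1"
  by (simp add: wt_def zero_fun_apply)

lemma wt_add: "wt (a + b) = wt a * wt b"
  by (simp add: wt_def power_add prod.distrib plus_fun_apply)

lemma wt_pos [simp]: "wt a > 0"
  unfolding wt_def using prime_p by (intro prod_pos) (simp add: prime_gt_0_nat)

text \<open>Unique factorization: \<open>c i\<close> is the multiplicity of the prime
  \<open>p i\<close> in \<open>wt c\<close>.\<close>

lemma wt_inj: "wt a = wt b \<Longrightarrow> a = b"
proof
  fix i assume eq: "wt a = wt b"
  have *: "multiplicity (p i) (wt c) = c i" for c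
  proof -
    have "wt c = (\<Prod>q\<in>range p. q ^ c (inv_into UNIV p q))"
      unfolding wt_def using inj_p by (subst prod.reindex) auto
    then show ?thesis
      using prime_p inj_p multiplicity_prod_prime_powers[of "range p" "p i" "\<lambda>q. c (inv_into UNIV p q)"]
      by auto
  qed
  show "a i = b i" using *[of a] *[of b] eq by simp
qed

text \<open>All weights are at least 2. The bound links the monomial order to the filtration
  \<open>ordge\<close> and makes sets of bounded weight finite.\<close>

lemma mdeg_less_wt: "mdeg c < wt c"
proof -
  have "mdeg c < 2 ^ mdeg c" by (rule less_exp)
  also have "2 ^ mdeg c = (\<Prod>i\<in>UNIV. 2 ^ c i)"
    by (simp add: mdeg_def power_sum)
  also have "\<dots> \<le> wt c"
    unfolding wt_def using prime_p by (intro prod_mono) (auto intro!: power_mono prime_ge_2_nat)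
  finally show ?thesis .
qed

lemma finite_wt_le: "finite {c. wt c \<le> K}"
  by (rule finite_subset[OF _ finite_mdeg_le[of K]]) (use mdeg_less_wt in \<open>auto intro: order.trans[OF less_imp_le]\<close>)

text \<open>The term of least weight leads, as suits power series; for the series \<open>0\<close>
  the value is arbitrary.\<close>

definition lm :: "'n mps \<Rightarrow> 'n \<Rightarrow> nat" where
  "lm f = arg_min wt (\<lambda>c. mps_coeff f c \<noteq> 0)"

lemma lm_nonzero: "(f :: 'n mps) \<noteq> 0 \<Longrightarrow> mps_coeff f (lm f) \<noteq> 0"
  and lm_le: "mps_coeff (f :: 'n mps) c \<noteq> 0 \<Longrightarrow> wt (lm f) \<le> wt c"
proof -
  have *: "mps_coeff f (lm f) \<noteq> 0 \<and> (\<forall>c. mps_coeff f c \<noteq> 0 \<longrightarrow> wt (lm f) \<le> wt c)"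
    if "mps_coeff f c \<noteq> 0" for c
    unfolding lm_def by (rule arg_min_nat_lemma) (rule that)
  show "mps_coeff f (lm f) \<noteq> 0" if "f \<noteq> 0"
    using * that by (metis mps_eqI mps_coeff_zero)
  show "wt (lm f) \<le> wt c" if "mps_coeff f c \<noteq> 0"
    using * that by blast
qed

lemma lm_eqI:
  assumes "mps_coeff f a \<noteq> 0" "\<And>c. mps_coeff f c \<noteq> 0 \<Longrightarrow> wt a \<le> wt c"
  shows "lm f = a"
proof -
  have "f \<noteq> 0" using assms(1) by auto
  then show ?thesis
    using assms lm_nonzero[of f] lm_le[of f a] by (intro wt_inj antisym) auto
qed

text \<open>Only one pair of terms contributes to the coefficient at the sum of the leading indices.\<close>

lemma coeff_mult_lm: "mps_coeff ((f :: 'n mps) * g) (lm f + lm g) = mps_coeff f (lm f) * mps_coeff g (lm g)"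
proof -
  have "mps_coeff (f * g) (lm f + lm g) =
      (\<Sum>(a, b)\<in>splittings (lm f + lm g). mps_coeff f a * mps_coeff g b)"
    by (rule mps_coeff_mult)
  also have "\<dots> = (\<Sum>(a, b)\<in>{(lm f, lm g)}. mps_coeff f a * mps_coeff g b)"
  proof (rule sum.mono_neutral_right)
    show "\<forall>i\<in>splittings (lm f + lm g) - {(lm f, lm g)}. (case i of (a, b) \<Rightarrow> mps_coeff f a * mps_coeff g b) = 0"
    proof
      fix x assume x: "x \<in> splittings (lm f + lm g) - {(lm f, lm g)}"
      obtain a b where ab: "x = (a, b)" by (cases x)
      show "(case x of (a, b) \<Rightarrow> mps_coeff f a * mps_coeff g b) = 0"
      proof (rule ccontr)
        assume "(case x of (a, b) \<Rightarrow> mps_coeff f a * mps_coeff g b) \<noteq> 0"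
        then have l: "wt (lm f) \<le> wt a" "wt (lm g) \<le> wt b" using lm_le by (auto simp: ab)
        have e: "wt a * wt b = wt (lm f) * wt (lm g)"
          using x by (auto simp: ab splittings_def simp flip: wt_add)
        have a: "wt a = wt (lm f)"
        proof (rule ccontr)
          assume "wt a \<noteq> wt (lm f)"
          with l have "wt (lm f) * wt (lm g) < wt a * wt b"
            by (intro mult_less_le_imp_less) auto
          with e show False by simp
        qed
        with e have "wt b = wt (lm g)" using wt_pos[of "lm f"] by simp
        with a x show False using wt_inj by (auto simp: ab)
      qed
    qed
  qed (simp, simp add: splittings_def)
  finally show ?thesis by simp
qed

lemma mult_nonzero: "(f :: 'n mps) \<noteq> 0 \<Longrightarrow> g \<noteq> 0 \<Longrightarrow> f * g \<noteq> 0"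
  using coeff_mult_lm[of f g] lm_nonzero[of f] lm_nonzero[of g] by (metis mps_coeff_zero mult_eq_0_iff)

lemma lm_mult:
  fixes f :: "'n mps"
  assumes "f \<noteq> 0" "g \<noteq> 0"
  shows "lm (f * g) = lm f + lm g"
proof (rule lm_eqI)
  show "mps_coeff (f * g) (lm f + lm g) \<noteq> 0"
    using assms by (simp add: coeff_mult_lm lm_nonzero)
  fix c assume "mps_coeff (f * g) c \<noteq> 0"
  then obtain a b where "a + b = c" "mps_coeff f a \<noteq> 0" "mps_coeff g b \<noteq> 0"
    unfolding mps_coeff_mult by (auto simp: splittings_def elim!: sum.not_neutral_contains_not_neutral)
  then show "wt (lm f + lm g) \<le> wt c"
    using lm_le by (auto simp: wt_add intro!: mult_mono)
qed

text \<open>A pair \<open>(b, c)\<close> contributes only if \<open>wt c\<close> is at least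
  \<open>wt (lm f)\<close>, which forces \<open>wt b \<le> wt a\<close>, with equality only for
  \<open>b = a\<close>. Thus this coefficient of the product determines \<open>q\<close> at
  \<open>a\<close> from values of \<open>q\<close> at smaller weights.\<close>

lemma quotient_recursion:
  fixes f :: "'n mps"
  assumes f: "f \<noteq> 0"
  shows "mps_coeff (q * f) (a + lm f) =
    mps_coeff q a * mps_coeff f (lm f) +
    (\<Sum>(b, c)\<in>{(b, c)\<in>splittings (a + lm f). wt b < wt a}. mps_coeff q b * mps_coeff f c)"
proof -
  let ?S = "splittings (a + lm f)" and ?h = "\<lambda>(b, c). mps_coeff q b * mps_coeff f c"
  have "mps_coeff (q * f) (a + lm f) = sum ?h ?S" by (rule mps_coeff_mult)
  also have "\<dots> = sum ?h (insert (a, lm f) {(b, c)\<in>?S. wt b < wt a})"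
  proof (rule sum.mono_neutral_right)
    show "\<forall>i\<in>?S - insert (a, lm f) {(b, c)\<in>?S. wt b < wt a}. ?h i = 0"
    proof
      fix x assume x: "x \<in> ?S - insert (a, lm f) {(b, c)\<in>?S. wt b < wt a}"
      obtain b c where bc: "x = (b, c)" by (cases x)
      show "?h x = 0"
      proof (rule ccontr)
        assume "?h x \<noteq> 0"
        then have l: "wt (lm f) \<le> wt c" "wt a \<le> wt b" using x lm_le by (auto simp: bc)
        have e: "wt b * wt c = wt a * wt (lm f)"
          using x by (auto simp: bc splittings_def simp flip: wt_add)
        have b: "wt b = wt a"
        proof (rule ccontr)
          assume "wt b \<noteq> wt a"
          with l have "wt a * wt (lm f) < wt b * wt c"
            by (intro mult_less_le_imp_less) auto
          with e show False by simp
        qed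
        with e have "wt c = wt (lm f)" using wt_pos[of a] by simp
        with b x show False using wt_inj by (auto simp: bc)
      qed
    qed
  qed (simp, auto simp: splittings_def)
  also have "\<dots> = ?h (a, lm f) + sum ?h {(b, c)\<in>?S. wt b < wt a}"
    by (subst sum.insert) (auto intro: finite_subset[OF _ finite_splittings[of "a + lm f"]])
  finally show ?thesis by simp
qed

text \<open>The conditions at the indices \<open>a + lm f\<close> form a triangular linear system
  for the coefficients of \<open>q\<close>, solved by recursion on \<open>wt\<close>.\<close>

lemma division_ex:
  fixes f :: "'n mps"
  assumes f: "f \<noteq> 0"
  shows "\<exists>q. \<forall>c. lm f \<le> c \<longrightarrow> mps_coeff (g - q * f) c = 0"
proof -
  define Q where "Q = wfrec (Wellfounded.measure wt) (\<lambda>h a. (mps_coeff g (a + lm f) -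
    (\<Sum>(b, c)\<in>{(b, c)\<in>splittings (a + lm f). wt b < wt a}. h b * mps_coeff f c)) / mps_coeff f (lm f))"
  have Q: "Q a = (mps_coeff g (a + lm f) -
    (\<Sum>(b, c)\<in>{(b, c)\<in>splittings (a + lm f). wt b < wt a}. Q b * mps_coeff f c)) / mps_coeff f (lm f)" for a
  proof -
    have "Q a = (mps_coeff g (a + lm f) -
      (\<Sum>(b, c)\<in>{(b, c)\<in>splittings (a + lm f). wt b < wt a}. cut Q (Wellfounded.measure wt) a b * mps_coeff f c)) / mps_coeff f (lm f)"
      unfolding Q_def by (subst wfrec) auto
    also have "(\<Sum>(b, c)\<in>{(b, c)\<in>splittings (a + lm f). wt b < wt a}. cut Q (Wellfounded.measure wt) a b * mps_coeff f c) =
       (\<Sum>(b, c)\<in>{(b, c)\<in>splittings (a + lm f). wt b < wt a}. Q b * mps_coeff f c)"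
      by (rule sum.cong) (auto simp: cut_apply)
    finally show ?thesis .
  qed
  define q where "q = Abs_mps Q"
  have q: "mps_coeff q = Q" unfolding q_def by (simp add: Abs_mps_inverse)
  have "mps_coeff (g - q * f) c = 0" if c: "lm f \<le> c" for c
  proof -
    obtain a where a: "c = a + lm f" using c le_iff_add_idx by (metis add.commute)
    show ?thesis
      using lm_nonzero[OF f] unfolding a mps_coeff_diff quotient_recursion[OF f] q
      by (subst Q[of a]) simp
  qed
  then show ?thesis by blast
qed

text \<open>A nonzero \<open>q\<close> would leave the nonzero leading coefficient of
  \<open>q * f\<close> at \<open>lm q + lm f\<close>.\<close>

lemma division_unique:
  fixes f :: "'n mps"
  assumes "f \<noteq> 0" "\<And>c. lm f \<le> c \<Longrightarrow> mps_coeff (q * f) c = 0"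
  shows "q = 0"
proof (rule ccontr)
  assume "q \<noteq> 0"
  then have "mps_coeff (q * f) (lm q + lm f) \<noteq> 0"
    using assms(1) by (simp add: coeff_mult_lm lm_nonzero)
  moreover have "lm f \<le> lm q + lm f" by (auto simp: le_fun_def plus_fun_apply)
  ultimately show False using assms(2) by blast
qed

lemma lm_power: "(f :: 'n mps) \<noteq> 0 \<Longrightarrow> f ^ k \<noteq> 0 \<and> lm (f ^ k) = (\<lambda>i. k * lm f i)"
proof (induction k)
  case 0
  have "lm 1 = 0" by (rule lm_eqI) (auto simp: mps_coeff_one split: if_splits)
  then show ?case by (auto simp: fun_eq_iff zero_fun_apply plus_fun_apply)
next
  case (Suc k)
  then show ?case by (auto simp: lm_mult mult_nonzero fun_eq_iff zero_fun_apply plus_fun_apply)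
qed

text \<open>
  Division replaces \<open>a\<close> by its remainder, for which
  \<open>b\<^sup>k dvd e r\<^sup>k\<close> for all \<open>k\<close> forces \<open>lm b \<le> lm r\<close>.
\<close>

lemma completely_integrally_closed_mps:
  fixes a b e :: "'n mps"
  assumes b: "b \<noteq> 0" and e: "e \<noteq> 0" and dvd: "\<And>k. b ^ k dvd e * a ^ k"
  shows "b dvd a"
proof -
  obtain q where q: "\<And>c. lm b \<le> c \<Longrightarrow> mps_coeff (a - q * b) c = 0"
    using division_ex[OF b] by blast
  define r where "r = a - q * b"
  have "r = 0"
  proof (rule ccontr)
    assume r: "r \<noteq> 0"
    have dvdr: "b ^ k dvd e * r ^ k" for k
    proof -
      \<comment> \<open>In each term \<open>e * a ^ i\<close> supplies \<open>b ^ i\<close>, and the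
        power of \<open>q * b\<close> supplies the remaining \<open>b ^ (k - i)\<close>.\<close>
      have "e * r ^ k = (\<Sum>i\<le>k. e * (of_nat (k choose i) * a ^ i * (- (q * b)) ^ (k - i)))"
        unfolding r_def diff_conv_add_uminus binomial_ring sum_distrib_left ..
      also have "b ^ k dvd \<dots>"
      proof (rule dvd_sum)
        fix i assume "i \<in> {..k}"
        then have k: "b ^ k = b ^ i * b ^ (k - i)" by (simp flip: power_add)
        have "b ^ (k - i) dvd (- (q * b)) ^ (k - i)"
          by (intro dvd_power_same) auto
        then have "b ^ k dvd (e * a ^ i) * (- (q * b)) ^ (k - i)"
          unfolding k by (intro mult_dvd_mono dvd)
        then have "b ^ k dvd of_nat (k choose i) * ((e * a ^ i) * (- (q * b)) ^ (k - i))"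
          by (rule dvd_mult)
        then show "b ^ k dvd e * (of_nat (k choose i) * a ^ i * (- (q * b)) ^ (k - i))"
          by (simp add: mult.assoc mult.left_commute)
      qed
      finally show ?thesis .
    qed
    have "lm b i \<le> lm r i" for i
    proof (rule ccontr)
      assume *: "\<not> lm b i \<le> lm r i"
      \<comment> \<open>A deficit of one in the \<open>i\<close>-th exponent grows to
        \<open>k\<close> in the \<open>k\<close>-th power, more than the exponent
        \<open>lm e i\<close> can make up.\<close>
      define k where "k = Suc (lm e i)"
      obtain s where s: "e * r ^ k = b ^ k * s" using dvdr by blast
      have "s \<noteq> 0" using s mult_nonzero[OF e] lm_power[OF r] by auto
      then have "lm e + lm (r ^ k) = lm (b ^ k) + lm s"
        using s lm_mult e lm_power[OF r] lm_power[OF b] by metis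
      then have "lm e i + k * lm r i = k * lm b i + lm s i"
        using lm_power[OF r] lm_power[OF b] by (metis plus_fun_apply)
      moreover have "k * lm b i \<ge> k * Suc (lm r i)" using * by (intro mult_le_mono) auto
      ultimately show False by (simp add: k_def)
    qed
    then have "mps_coeff r (lm r) = 0" unfolding r_def by (intro q) (auto simp: le_fun_def r_def plus_fun_apply)
    with lm_nonzero[OF r] show False by simp
  qed
  then show ?thesis by (simp add: r_def)
qed

text \<open>Krull's theorem for principal ideals: the remainder of \<open>g\<close> is also the remainder of \<open>g - s f\<close>.\<close>

lemma dvd_if_approx:
  fixes f g :: "'n mps"
  assumes "\<And>k. \<exists>s. g - s * f \<in> ordge k"
  shows "f dvd g"
proof (cases "f = 0")
  case True
  then have "g = 0" using assms by (intro ordge_0I) auto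
  then show ?thesis by simp
next
  case False
  obtain q where q: "\<And>c. lm f \<le> c \<Longrightarrow> mps_coeff (g - q * f) c = 0"
    using division_ex[OF False] by blast
  define r where "r = g - q * f"
  have "r = 0"
  proof (rule ccontr)
    assume r: "r \<noteq> 0"
    \<comment> \<open>By \<open>mdeg_less_wt\<close>, this order covers all indices of weight up to
      \<open>wt (lm r)\<close>. There \<open>q' * f\<close> agrees with \<open>- r\<close>, so
      \<open>r\<close> would have a nonzero coefficient at the leading index of
      \<open>q' * f\<close>, which lies above \<open>lm f\<close>.\<close>
    obtain s where s: "g - s * f \<in> ordge (wt (lm r))" using assms by blast
    define q' where "q' = q - s"
    have eq: "g - s * f = q' * f + r" by (simp add: r_def q'_def algebra_simps)
    have small: "mps_coeff (q' * f) c = - mps_coeff r c" if "wt c \<le> wt (lm r)" for c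
    proof -
      have "mdeg c < wt (lm r)" using mdeg_less_wt[of c] that by simp
      then have "mps_coeff (q' * f + r) c = 0" using s unfolding eq by (simp add: ordge_def)
      then show ?thesis by (simp add: add_eq_0_iff)
    qed
    have nz: "mps_coeff (q' * f) (lm r) \<noteq> 0" using small[of "lm r"] lm_nonzero[OF r] by simp
    then have "q' * f \<noteq> 0" by auto
    then have q': "q' \<noteq> 0" by auto
    have lm: "lm (q' * f) = lm q' + lm f" by (rule lm_mult[OF q' False])
    have w: "wt (lm (q' * f)) \<le> wt (lm r)" by (rule lm_le[OF nz])
    have "mps_coeff r (lm (q' * f)) \<noteq> 0"
      using small[OF w] lm_nonzero[OF \<open>q' * f \<noteq> 0\<close>] by auto
    moreover have "mps_coeff r (lm (q' * f)) = 0"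
      unfolding r_def lm by (rule q) (auto simp: le_fun_def plus_fun_apply)
    ultimately show False by simp
  qed
  then show ?thesis by (simp add: r_def)
qed

end

text \<open>The bound \<open>K\<close> serves Weierstrass division, where all weights except that of
  \<open>t\<close> must exceed a given power of 2.\<close>

lemma ex_primes_above:
  fixes A :: "'n set"
  assumes "finite A"
  shows "\<exists>p :: 'n \<Rightarrow> nat. inj_on p A \<and> (\<forall>i\<in>A. prime (p i) \<and> p i > K)"
  using assms
proof (induction A)
  case (insert x A)
  then obtain p :: "'n \<Rightarrow> nat" where p: "inj_on p A" "\<And>i. i \<in> A \<Longrightarrow> prime (p i) \<and> p i > K" by auto
  obtain q where q: "prime q" "q > max K (Max (insert 0 (p ` A)))" using bigger_prime by blast
  have "q \<notin> p ` A"
  proof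
    assume "q \<in> p ` A"
    then have "q \<le> Max (insert 0 (p ` A))" using insert.hyps by (intro Max_ge) auto
    with q show False by simp
  qed
  then show ?case
    using p q insert.hyps by (intro exI[of _ "p(x := q)"]) (auto simp: inj_on_def)
qed auto

lemma ex_weights: "\<exists>p :: 'n::finite \<Rightarrow> nat. weights p"
  using ex_primes_above[of "UNIV :: 'n set" 0] by (auto simp: weights_def)

instance mps :: (finite) idom
proof
  fix a b :: "'a mps"
  obtain p :: "'a \<Rightarrow> nat" where "weights p" using ex_weights by blast
  then interpret weights p .
  show "a \<noteq> 0 \<Longrightarrow> b \<noteq> 0 \<Longrightarrow> a * b \<noteq> 0" by (rule mult_nonzero)
qed

text \<open>A nonzero constant coefficient makes \<open>lm f = 0\<close>; every index lies above
  \<open>0\<close>, so division of \<open>1\<close> by \<open>f\<close> leaves no remainder.\<close>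

lemma mps_dvd_1_iff: "(f :: 'n::finite mps) dvd 1 \<longleftrightarrow> mps_coeff f 0 \<noteq> 0"
proof
  assume "f dvd 1"
  then obtain g where "1 = f * g" by blast
  then have "mps_coeff f 0 * mps_coeff g 0 = 1" by (metis mps_coeff_mult_0 mps_coeff_one)
  then show "mps_coeff f 0 \<noteq> 0" by auto
next
  assume f: "mps_coeff f 0 \<noteq> 0"
  obtain p :: "'n \<Rightarrow> nat" where "weights p" using ex_weights by blast
  then interpret weights p .
  have lm: "lm f = 0" by (rule lm_eqI[OF f]) (simp add: Suc_leI)
  have "f \<noteq> 0" using f by auto
  from division_ex[OF this, of 1] obtain q where "\<And>c. mps_coeff (1 - q * f) c = 0"
    unfolding lm by (auto simp: le_fun_def zero_fun_apply)
  then have "1 - q * f = 0" by (intro mps_eqI) simp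
  then show "f dvd 1" by (metis dvd_triv_right eq_iff_diff_eq_0)
qed

section \<open>Convergence\<close>

definition mev :: "('n::finite \<Rightarrow> real) \<Rightarrow> ('n \<Rightarrow> nat) \<Rightarrow> real" where
  "mev \<rho> c = (\<Prod>i\<in>UNIV. \<rho> i ^ c i)"

lemma mev_add: "mev \<rho> (a + b) = mev \<rho> a * mev \<rho> b"
  by (simp add: mev_def power_add prod.distrib plus_fun_apply)

lemma mev_pos: "(\<And>i. \<rho> i > 0) \<Longrightarrow> mev \<rho> c > 0"
  by (simp add: mev_def prod_pos)

lemma mev_0 [simp]: "mev \<rho> 0 = 1"
  by (simp add: mev_def zero_fun_apply)

lemma mev_unit_idx [simp]: "mev \<rho> (unit_idx i) = \<rho> i"
proof -
  have "mev \<rho> (unit_idx i) = (\<Prod>j\<in>UNIV. if j = i then \<rho> j else 1)"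
    unfolding mev_def unit_idx_def by (rule prod.cong) auto
  then show ?thesis by simp
qed

text \<open>A bound for the weighted l1-norm with radii \<open>\<rho>\<close>, stated through finite
  partial sums so that estimates carry no summability side conditions.\<close>

definition majorized :: "('n::finite \<Rightarrow> real) \<Rightarrow> 'n mps \<Rightarrow> real \<Rightarrow> bool" where
  "majorized \<rho> f M \<longleftrightarrow> (\<forall>F. finite F \<longrightarrow> (\<Sum>c\<in>F. norm (mps_coeff f c) * mev \<rho> c) \<le> M)"

lemma majorizedD: "majorized \<rho> f M \<Longrightarrow> finite F \<Longrightarrow> (\<Sum>c\<in>F. norm (mps_coeff f c) * mev \<rho> c) \<le> M"
  by (simp add: majorized_def)

lemma convergent_majorized:
  fixes f :: "'n::finite mps"
  assumes "convergent_mps f"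
  shows "\<exists>r>0. \<forall>\<rho>. (\<forall>i. 0 < \<rho> i \<and> \<rho> i < r) \<longrightarrow> (\<exists>M. majorized \<rho> f M)"
proof -
  obtain r where "r > 0"
    and r: "\<And>z. (\<And>i. norm (z i) < r) \<Longrightarrow> (\<lambda>c. mps_coeff f c * monom_eval z c) summable_on UNIV"
    using assms unfolding convergent_mps_def by blast
  have "\<exists>M. majorized \<rho> f M" if \<rho>: "\<And>i. 0 < \<rho> i \<and> \<rho> i < r" for \<rho>
  proof -
    define z where "z = (\<lambda>i. complex_of_real (\<rho> i))"
    have "norm (z i) < r" for i using \<rho>[of i] by (simp add: z_def)
    from r[OF this] have *: "(\<lambda>c. norm (mps_coeff f c * monom_eval z c)) summable_on UNIV"
      by (simp add: summable_on_iff_abs_summable_on_complex)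
    have n: "norm (mps_coeff f c * monom_eval z c) = norm (mps_coeff f c) * mev \<rho> c" for c
      using \<rho> by (simp add: norm_mult monom_eval_def z_def mev_def norm_power less_imp_le flip: prod_norm)
    have "majorized \<rho> f (infsum (\<lambda>c. norm (mps_coeff f c * monom_eval z c)) UNIV)"
      unfolding majorized_def n[symmetric] using * by (auto intro!: finite_sum_le_infsum)
    then show ?thesis by blast
  qed
  then show ?thesis using \<open>r > 0\<close> by blast
qed

lemma majorized_convergent:
  fixes f :: "'n::finite mps"
  assumes "majorized \<rho> f M" and \<rho>: "\<And>i. \<rho> i > 0"
  shows "convergent_mps f"
proof -
  define r where "r = Min (range \<rho>)"
  have r: "r > 0" "\<And>i. r \<le> \<rho> i" unfolding r_def using \<rho> by auto
  have "(\<lambda>c. mps_coeff f c * monom_eval z c) summable_on UNIV" if z: "\<And>i. norm (z i) < r" for z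
  proof -
    have "(\<lambda>c. norm (mps_coeff f c) * mev \<rho> c) summable_on UNIV"
      using assms(1) mev_pos[of \<rho>, OF \<rho>]
      by (intro nonneg_bdd_above_summable_on bdd_aboveI[of _ M])
        (auto simp: majorized_def less_imp_le)
    then have "(\<lambda>c. norm (mps_coeff f c * monom_eval z c)) summable_on UNIV"
    proof (rule summable_on_comparison_test)
      fix c
      have "norm (monom_eval z c) \<le> mev \<rho> c"
        unfolding monom_eval_def mev_def prod_norm[symmetric] norm_power
        using z r by (intro prod_mono conjI power_mono) (auto intro: order.trans[OF less_imp_le])
      then show "norm (mps_coeff f c * monom_eval z c) \<le> norm (mps_coeff f c) * mev \<rho> c"
        by (simp add: norm_mult mult_left_mono)
    qed auto
    then show ?thesis by (simp add: abs_summable_summable)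
  qed
  then show ?thesis unfolding convergent_mps_def using r by blast
qed

lemma mev_scale: "mev (\<lambda>i. z * \<rho> i) c = z ^ mdeg c * mev \<rho> c"
  by (simp add: mev_def mdeg_def power_mult_distrib prod.distrib power_sum)

text \<open>Halving the radii absorbs the powers of 2. Such powers also dominate the integer factors
  produced by differentiation, so the lemma covers both \<open>part_mps\<close> and
  \<open>pd\<close>.\<close>

lemma convergent_shift:
  fixes f g :: "'n::finite mps"
  assumes f: "convergent_mps f"
    and le: "\<And>c. norm (mps_coeff g c) \<le> 2 ^ mdeg (c + e) * norm (mps_coeff f (c + e))"
  shows "convergent_mps g"
proof -
  obtain r where r: "r > 0" "\<And>\<rho>. (\<And>i. 0 < \<rho> i \<and> \<rho> i < r) \<Longrightarrow> \<exists>M. majorized \<rho> f M"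
    using convergent_majorized[OF f] by blast
  define \<rho> where "\<rho> = (\<lambda>i :: 'n. r / 4)"
  have \<rho>: "\<rho> i > 0" for i using r by (simp add: \<rho>_def)
  obtain M where M: "majorized (\<lambda>i. 2 * \<rho> i) f M"
    using r(2)[of "\<lambda>i. 2 * \<rho> i"] r(1) by (auto simp: \<rho>_def)
  have "majorized \<rho> g (M / mev \<rho> e)"
    unfolding majorized_def
  proof (intro allI impI)
    fix F :: "('n \<Rightarrow> nat) set" assume F: "finite F"
    have "(\<Sum>c\<in>F. norm (mps_coeff g c) * mev \<rho> c) * mev \<rho> e
        \<le> (\<Sum>c\<in>F. norm (mps_coeff f (c + e)) * mev (\<lambda>i. 2 * \<rho> i) (c + e))"
      unfolding sum_distrib_right
    proof (rule sum_mono)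
      fix c
      have "norm (mps_coeff g c) * mev \<rho> (c + e) \<le> 2 ^ mdeg (c + e) * norm (mps_coeff f (c + e)) * mev \<rho> (c + e)"
        using le mev_pos[of \<rho>, OF \<rho>] by (intro mult_right_mono) (auto simp: less_imp_le)
      then show "norm (mps_coeff g c) * mev \<rho> c * mev \<rho> e \<le> norm (mps_coeff f (c + e)) * mev (\<lambda>i. 2 * \<rho> i) (c + e)"
        unfolding mev_scale by (simp add: mev_add mult_ac)
    qed
    also have "\<dots> = (\<Sum>c\<in>(\<lambda>c. c + e) ` F. norm (mps_coeff f c) * mev (\<lambda>i. 2 * \<rho> i) c)"
      by (subst sum.reindex) (auto simp: inj_on_def)
    also have "\<dots> \<le> M" using F by (intro majorizedD[OF M]) auto
    finally show "(\<Sum>c\<in>F. norm (mps_coeff g c) * mev \<rho> c) \<le> M / mev \<rho> e"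
      using mev_pos[of \<rho> e, OF \<rho>] by (simp add: pos_le_divide_eq)
  qed
  then show ?thesis using \<rho> by (rule majorized_convergent)
qed

lemma convergent_part:
  assumes "convergent_mps f"
  shows "convergent_mps (part_mps i f)"
proof (rule convergent_shift[OF assms])
  fix c
  have "1 * norm (mps_coeff f (c + unit_idx i)) \<le> 2 ^ mdeg (c + unit_idx i) * norm (mps_coeff f (c + unit_idx i))"
    by (rule mult_right_mono) (simp_all only: one_le_power one_le_numeral norm_ge_zero)
  then show "norm (mps_coeff (part_mps i f) c) \<le> 2 ^ mdeg (c + unit_idx i) * norm (mps_coeff f (c + unit_idx i))"
    by (simp add: part_mps.rep_eq)
qed

section \<open>Dominance of the leading term at small radii, and convergence of quotients\<close>

context weights
begin

text \<open>At these radii the monomial with index \<open>c\<close> has the value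
  \<open>wt c\<close> to the power \<open>-s\<close>: the monomial order becomes the order of
  magnitude, and a larger \<open>s\<close> separates the magnitudes further.\<close>

definition rad :: "nat \<Rightarrow> 'n \<Rightarrow> real" where
  "rad s i = (1 / real (p i)) ^ s"

lemma rad_pos: "rad s i > 0"
  using prime_p[of i] by (simp add: rad_def prime_gt_0_nat)

lemma mev_rad: "mev (rad s) c = (1 / real (wt c)) ^ s"
proof -
  have "mev (rad s) c = (\<Prod>i\<in>UNIV. ((1 / real (p i)) ^ c i) ^ s)"
    unfolding mev_def rad_def by (simp only: power_mult[symmetric] mult.commute)
  also have "\<dots> = (\<Prod>i\<in>UNIV. (1 / real (p i)) ^ c i) ^ s"
    by (simp only: prod_power_distrib)
  also have "(\<Prod>i\<in>UNIV. (1 / real (p i)) ^ c i) = 1 / real (wt c)"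
    by (simp add: wt_def power_one_over prod_dividef)
  finally show ?thesis .
qed

lemma convergent_rad:
  fixes f :: "'n mps"
  assumes "convergent_mps f"
  shows "\<exists>s0. \<forall>s\<ge>s0. \<exists>M. majorized (rad s) f M"
proof -
  obtain r where r: "r > 0" "\<And>\<rho>. (\<And>i. 0 < \<rho> i \<and> \<rho> i < r) \<Longrightarrow> \<exists>M. majorized \<rho> f M"
    using convergent_majorized[OF assms] by blast
  obtain s0 where s0: "(1 / 2 :: real) ^ s0 < r" using real_arch_pow_inv[of r "1/2"] r by auto
  have "\<exists>M. majorized (rad s) f M" if "s \<ge> s0" for s
  proof (rule r(2))
    fix i
    have "rad s i \<le> (1 / 2) ^ s"
      unfolding rad_def using prime_ge_2_nat[OF prime_p[of i]] by (intro power_mono) (auto simp: field_simps)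
    also have "\<dots> \<le> (1 / 2) ^ s0" using that by (intro power_decreasing) auto
    finally show "0 < rad s i \<and> rad s i < r" using s0 rad_pos[of s i] by simp
  qed
  then show ?thesis by blast
qed

text \<open>Put \<open>m = wt (lm f)\<close>. Passing from \<open>s1\<close> to
  \<open>s1 + k\<close> multiplies the leading term by the \<open>k\<close>-th power of
  \<open>1 / m\<close>, but every other nonzero term by at most that of \<open>1 / (m + 1)\<close>,
  since weights are integers. The ratio \<open>z = m / (m + 1)\<close> is below 1, so a large
  \<open>k\<close> outweighs the bound \<open>M\<close>.\<close>

lemma dominant_lm:
  fixes f :: "'n mps"
  assumes f: "f \<noteq> 0" "convergent_mps f"
  shows "\<exists>s0. \<forall>s\<ge>s0. \<forall>C. finite C \<longrightarrow> lm f \<notin> C \<longrightarrow>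
    (\<Sum>c\<in>C. norm (mps_coeff f c) * mev (rad s) c) \<le> norm (mps_coeff f (lm f)) * mev (rad s) (lm f) / 2"
proof -
  obtain s1 M where M: "majorized (rad s1) f M" using convergent_rad[OF f(2)] by blast
  define m where "m = wt (lm f)"
  have m: "m > 0" by (simp add: m_def)
  define z where "z = real m / (real m + 1)"
  define K where "K = norm (mps_coeff f (lm f)) * (1 / real m) ^ s1 / 2"
  have K: "K > 0" using lm_nonzero[OF f(1)] m by (simp add: K_def)
  have z: "0 < z" "z < 1" using m by (auto simp: z_def)
  have "M \<ge> 0" using majorizedD[OF M, of "{}"] by simp
  obtain k0 where k0: "z ^ k0 < K / (M + 1)" using real_arch_pow_inv[of "K / (M + 1)" z] z K \<open>M \<ge> 0\<close> by auto
  have "(\<Sum>c\<in>C. norm (mps_coeff f c) * mev (rad s) c) \<le> norm (mps_coeff f (lm f)) * mev (rad s) (lm f) / 2"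
    if s: "s \<ge> s1 + k0" and C: "finite C" "lm f \<notin> C" for s C
  proof -
    obtain k where k: "s = s1 + k" "k \<ge> k0" using s by (metis add.assoc le_Suc_ex le_add1)
    have "(\<Sum>c\<in>C. norm (mps_coeff f c) * mev (rad s) c) \<le>
        (\<Sum>c\<in>C. norm (mps_coeff f c) * mev (rad s1) c * (1 / (real m + 1)) ^ k)"
    proof (rule sum_mono)
      fix c assume c: "c \<in> C"
      show "norm (mps_coeff f c) * mev (rad s) c \<le> norm (mps_coeff f c) * mev (rad s1) c * (1 / (real m + 1)) ^ k"
      proof (cases "mps_coeff f c = 0")
        case False
        then have "m \<le> wt c" unfolding m_def by (rule lm_le)
        moreover have "m \<noteq> wt c" using c C wt_inj unfolding m_def by metis
        ultimately have "real m + 1 \<le> real (wt c)" by linarith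
        then have "(1 / real (wt c)) ^ k \<le> (1 / (real m + 1)) ^ k"
          using m by (intro power_mono) (auto simp: field_simps)
        then show ?thesis
          unfolding mev_rad k power_add mult.assoc[symmetric] by (rule mult_left_mono) simp
      qed simp
    qed
    also have "\<dots> \<le> M * (1 / (real m + 1)) ^ k"
      unfolding sum_distrib_right[symmetric] by (intro mult_right_mono majorizedD[OF M] C) auto
    also have "\<dots> \<le> K * (1 / real m) ^ k"
    proof -
      have "M * z ^ k \<le> M * z ^ k0"
        using z k \<open>M \<ge> 0\<close> by (intro mult_left_mono power_decreasing) auto
      also have "\<dots> \<le> (M + 1) * z ^ k0" using z by (intro mult_right_mono) auto
      also have "\<dots> \<le> K" using k0 \<open>M \<ge> 0\<close> by (simp add: field_simps)
      finally have "M * z ^ k * (1 / real m) ^ k \<le> K * (1 / real m) ^ k"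
        by (rule mult_right_mono) simp
      moreover have "z ^ k * (1 / real m) ^ k = (1 / (real m + 1)) ^ k"
        unfolding power_mult_distrib[symmetric] using m by (simp add: z_def)
      ultimately show ?thesis by (simp add: mult.assoc)
    qed
    also have "\<dots> = norm (mps_coeff f (lm f)) * mev (rad s) (lm f) / 2"
      unfolding mev_rad K_def k power_add m_def by simp
    finally show ?thesis .
  qed
  then show ?thesis by blast
qed

text \<open>In the weighted norm the division recursion bounds \<open>S * L\<close>, for a partial
  sum \<open>S\<close> of \<open>q\<close>, by the norm \<open>M\<close> of \<open>g\<close> plus
  \<open>S\<close> times the non-leading part of \<open>f\<close>. At a radius where that part is at
  most \<open>L / 2\<close>, this gives \<open>S * L \<le> 2 * M\<close>.\<close>

lemma convergent_quotient:
  fixes f g q :: "'n mps"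
  assumes f: "f \<noteq> 0" "convergent_mps f" and g: "convergent_mps g"
    and q: "\<And>c. lm f \<le> c \<Longrightarrow> mps_coeff (g - q * f) c = 0"
  shows "convergent_mps q"
proof -
  define b where "b = lm f"
  obtain s0 where s0: "\<And>s C. s \<ge> s0 \<Longrightarrow> finite C \<Longrightarrow> lm f \<notin> C \<Longrightarrow>
    (\<Sum>c\<in>C. norm (mps_coeff f c) * mev (rad s) c) \<le> norm (mps_coeff f (lm f)) * mev (rad s) (lm f) / 2"
    using dominant_lm[OF f] by blast
  obtain s1 where s1: "\<And>s. s \<ge> s1 \<Longrightarrow> \<exists>M. majorized (rad s) g M" using convergent_rad[OF g] by blast
  define s where "s = max s0 s1"
  define w where "w = mev (rad s)"
  obtain M where M: "majorized (rad s) g M" using s1[of s] by (auto simp: s_def)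
  have wpos: "w c > 0" for c unfolding w_def by (rule mev_pos) (rule rad_pos)
  have wadd: "w (x + y) = w x * w y" for x y by (simp add: w_def mev_add)
  define L where "L = norm (mps_coeff f b) * w b"
  have L: "L > 0" using lm_nonzero[OF f(1)] wpos by (simp add: L_def b_def)
  define P where "P = (\<lambda>a. {(x, y)\<in>splittings (a + b). wt x < wt a})"
  have finP: "finite (P a)" for a
    unfolding P_def by (rule finite_subset[OF _ finite_splittings[of "a + b"]]) auto
  have rec: "norm (mps_coeff q a) * w a * L \<le> norm (mps_coeff g (a + b)) * w (a + b) +
      (\<Sum>(x, y)\<in>P a. norm (mps_coeff q x) * w x * (norm (mps_coeff f y) * w y))" for a
  proof -
    have "mps_coeff (g - q * f) (a + b) = 0"
      unfolding b_def by (rule q) (simp add: le_fun_def plus_fun_apply)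
    then have "mps_coeff q a * mps_coeff f b =
        mps_coeff g (a + b) - (\<Sum>(x, y)\<in>P a. mps_coeff q x * mps_coeff f y)"
      using quotient_recursion[OF f(1), of q a] by (simp add: b_def P_def)
    then have "norm (mps_coeff q a) * norm (mps_coeff f b) \<le>
        norm (mps_coeff g (a + b)) + norm (\<Sum>(x, y)\<in>P a. mps_coeff q x * mps_coeff f y)"
      unfolding norm_mult[symmetric] by (simp add: norm_triangle_ineq4)
    also have "norm (\<Sum>(x, y)\<in>P a. mps_coeff q x * mps_coeff f y) \<le>
        (\<Sum>(x, y)\<in>P a. norm (mps_coeff q x) * norm (mps_coeff f y))"
      by (rule order.trans[OF norm_sum]) (simp add: norm_mult split_def)
    finally have "norm (mps_coeff q a) * norm (mps_coeff f b) \<le>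
      norm (mps_coeff g (a + b)) + (\<Sum>(x, y)\<in>P a. norm (mps_coeff q x) * norm (mps_coeff f y))"
      by (simp only: add_left_mono)
    then have "norm (mps_coeff q a) * norm (mps_coeff f b) * w (a + b) \<le>
      (norm (mps_coeff g (a + b)) + (\<Sum>(x, y)\<in>P a. norm (mps_coeff q x) * norm (mps_coeff f y))) * w (a + b)"
      by (rule mult_right_mono[OF _ less_imp_le[OF wpos]])
    also have "\<dots> = norm (mps_coeff g (a + b)) * w (a + b) +
      (\<Sum>(x, y)\<in>P a. norm (mps_coeff q x) * norm (mps_coeff f y) * w (a + b))"
      by (simp add: distrib_right sum_distrib_right split_def)
    also have "(\<Sum>(x, y)\<in>P a. norm (mps_coeff q x) * norm (mps_coeff f y) * w (a + b)) =
        (\<Sum>(x, y)\<in>P a. norm (mps_coeff q x) * w x * (norm (mps_coeff f y) * w y))"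
    proof (rule sum.cong, simp, clarify)
      fix x y assume "(x, y) \<in> P a"
      then have "a + b = x + y" by (simp add: P_def splittings_def)
      then have "w (a + b) = w x * w y" by (simp only: wadd)
      then show "norm (mps_coeff q x) * norm (mps_coeff f y) * w (a + b) =
          norm (mps_coeff q x) * w x * (norm (mps_coeff f y) * w y)" by simp
    qed
    finally show ?thesis by (simp add: L_def wadd mult_ac)
  qed
  have "majorized (rad s) q (2 * M / L)"
    unfolding majorized_def w_def[symmetric]
  proof (intro allI impI)
    fix F :: "('n \<Rightarrow> nat) set" assume F: "finite F"
    \<comment> \<open>\<open>G\<close> is closed under passing to smaller weight, so the recursion
      at indices in \<open>G\<close> refers only to coefficients of \<open>q\<close> in
      \<open>G\<close>.\<close>
    define G where "G = {a. wt a \<le> Max (insert 0 (wt ` F))}"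
    have G: "finite G" "F \<subseteq> G" unfolding G_def using F finite_wt_le by auto
    define S where "S = (\<Sum>a\<in>G. norm (mps_coeff q a) * w a)"
    define C where "C = snd ` (\<Union>a\<in>G. P a)"
    have C: "finite C" unfolding C_def using G finP by auto
    \<comment> \<open>\<open>y = b\<close> would give \<open>x = a\<close>, against
      \<open>wt x < wt a\<close>. Hence the leading term of \<open>f\<close> does not occur and
      \<open>s0\<close> applies to \<open>C\<close>.\<close>
    have bC: "b \<notin> C"
      by (auto simp: C_def P_def splittings_def)
    have "S * L \<le> (\<Sum>a\<in>G. norm (mps_coeff g (a + b)) * w (a + b)) +
        (\<Sum>a\<in>G. \<Sum>(x, y)\<in>P a. norm (mps_coeff q x) * w x * (norm (mps_coeff f y) * w y))"
      unfolding S_def sum_distrib_right sum.distrib[symmetric] by (intro sum_mono rec)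
    also have "(\<Sum>a\<in>G. norm (mps_coeff g (a + b)) * w (a + b)) =
        (\<Sum>c\<in>(\<lambda>a. a + b) ` G. norm (mps_coeff g c) * w c)"
      by (subst sum.reindex) (auto simp: inj_on_def)
    also have "\<dots> \<le> M" unfolding w_def using G by (intro majorizedD[OF M]) auto
    also have "(\<Sum>a\<in>G. \<Sum>(x, y)\<in>P a. norm (mps_coeff q x) * w x * (norm (mps_coeff f y) * w y)) =
        (\<Sum>(a, x, y)\<in>Sigma G P. norm (mps_coeff q x) * w x * (norm (mps_coeff f y) * w y))"
      using G finP by (subst sum.Sigma) auto
    also have "\<dots> \<le> (\<Sum>(x, y)\<in>G \<times> C. norm (mps_coeff q x) * w x * (norm (mps_coeff f y) * w y))"
    proof (rule sum_le_included[where i = "\<lambda>(x, y). (x + y - b, x, y)"])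
      show "\<forall>z\<in>Sigma G P. \<exists>y\<in>G \<times> C. (case y of (x, y) \<Rightarrow> (x + y - b, x, y)) = z \<and>
          (case z of (a, x, y) \<Rightarrow> norm (mps_coeff q x) * w x * (norm (mps_coeff f y) * w y))
          \<le> (case y of (x, y) \<Rightarrow> norm (mps_coeff q x) * w x * (norm (mps_coeff f y) * w y))"
      proof
        fix z assume z: "z \<in> Sigma G P"
        obtain a x y where zz: "z = (a, x, y)" by (cases z)
        have "x \<in> G" "x + y = a + b" using z by (auto simp: zz G_def P_def splittings_def)
        moreover have "y \<in> C" using z unfolding zz C_def by force
        ultimately show "\<exists>y\<in>G \<times> C. (case y of (x, y) \<Rightarrow> (x + y - b, x, y)) = z \<and>
          (case z of (a, x, y) \<Rightarrow> norm (mps_coeff q x) * w x * (norm (mps_coeff f y) * w y))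
          \<le> (case y of (x, y) \<Rightarrow> norm (mps_coeff q x) * w x * (norm (mps_coeff f y) * w y))"
          by (intro bexI[of _ "(x, y)"]) (auto simp: zz)
      qed
    qed (use G C finP wpos in \<open>auto intro!: finite_SigmaI simp: less_imp_le\<close>)
    also have "\<dots> = S * (\<Sum>y\<in>C. norm (mps_coeff f y) * w y)"
      unfolding S_def by (simp add: sum_product sum.cartesian_product)
    also have "\<dots> \<le> S * (L / 2)"
      unfolding L_def w_def b_def using C bC wpos
      by (intro mult_left_mono s0) (auto simp: s_def b_def S_def less_imp_le intro!: sum_nonneg)
    also have "S * (L / 2) = S * L / 2" by simp
    finally have "S * L \<le> 2 * M" by linarith
    then have "S \<le> 2 * M / L" using L by (simp add: pos_le_divide_eq)
    moreover have "(\<Sum>c\<in>F. norm (mps_coeff q c) * w c) \<le> S"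
      unfolding S_def using G wpos by (intro sum_mono2) (auto simp: less_imp_le)
    ultimately show "(\<Sum>c\<in>F. norm (mps_coeff q c) * w c) \<le> 2 * M / L" by simp
  qed
  then show ?thesis by (rule majorized_convergent) (rule rad_pos)
qed

end

text \<open>The cofactor \<open>q\<close> is the quotient of a division with remainder
  \<open>0\<close>, so the estimate for quotients applies to it.\<close>

lemma convergent_factor:
  fixes f q :: "'n::finite mps"
  assumes "f \<noteq> 0" "convergent_mps f" "convergent_mps (q * f)"
  shows "convergent_mps q"
proof -
  obtain p :: "'n \<Rightarrow> nat" where "weights p" using ex_weights by blast
  then interpret weights p .
  show ?thesis by (rule convergent_quotient[OF assms]) simp
qed

section \<open>The ring of convergent power series\<close>

lemmas to_formal_simps [simp] = zero_cps.rep_eq one_cps.rep_eq plus_cps.rep_eq minus_cps.rep_eq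
  uminus_cps.rep_eq times_cps.rep_eq cps_var.rep_eq cps_scale.rep_eq

lemma convergent_to_formal [simp]: "convergent_mps (to_formal f)"
  using to_formal[of f] by simp

lemma to_formal_eq_iff: "to_formal f = to_formal g \<longleftrightarrow> f = g"
  by (rule to_formal_inject)

lemma to_formal_eq_0_iff [simp]: "to_formal f = 0 \<longleftrightarrow> f = 0"
  using to_formal_inject[of f 0] by simp

lemma to_formal_sum [simp]: "to_formal (sum f A) = (\<Sum>i\<in>A. to_formal (f i))"
  by (induction A rule: infinite_finite_induct) auto

lemma to_formal_power [simp]: "to_formal (f ^ k) = to_formal f ^ k"
  by (induction k) auto

lemma to_formal_of_nat [simp]: "to_formal (of_nat k) = of_nat k"
  by (induction k) auto

lemma obtain_cps:
  assumes "convergent_mps f"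
  obtains g where "to_formal g = f"
  using assms Abs_cps_inverse[of f] by auto

instance cps :: (finite) idom
proof
  fix a b :: "'a cps"
  assume "a \<noteq> 0" "b \<noteq> 0"
  then have "to_formal a * to_formal b \<noteq> 0" by simp
  then show "a * b \<noteq> 0" by (metis times_cps.rep_eq to_formal_eq_0_iff)
qed

text \<open>By \<open>convergent_factor\<close> a formal cofactor of convergent series is
  convergent. This lets \<open>squarefree\<close> and the basis property be used in formal
  computations.\<close>

lemma to_formal_dvd_iff: "to_formal f dvd to_formal g \<longleftrightarrow> f dvd g"
proof
  assume "to_formal f dvd to_formal g"
  then obtain q where q: "to_formal g = q * to_formal f" by (metis dvdE mult.commute)
  show "f dvd g"
  proof (cases "f = 0")
    case True
    then show ?thesis using q by simp
  next
    case False
    have "convergent_mps (q * to_formal f)" unfolding q[symmetric] by (rule convergent_to_formal)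
    with False have "convergent_mps q"
      using convergent_factor[of "to_formal f" q] by simp
    then obtain r where r: "to_formal r = q" by (rule obtain_cps)
    have "to_formal g = to_formal (r * f)" unfolding q by (simp add: r)
    then have "g = r * f" unfolding to_formal_eq_iff .
    then show ?thesis by simp
  qed
next
  assume "f dvd g"
  then obtain h where "g = f * h" by blast
  then show "to_formal f dvd to_formal g" by simp
qed

text \<open>The fraction \<open>a / b\<close> has powers with the common denominator
  \<open>e\<close>, and must then lie in the ring; the divisibility form stays inside the
  ring.\<close>

definition completely_integrally_closed :: "'a::comm_ring_1 itself \<Rightarrow> bool" where
  "completely_integrally_closed _ \<longleftrightarrow>
     (\<forall>a b e :: 'a. b \<noteq> 0 \<longrightarrow> e \<noteq> 0 \<longrightarrow> (\<forall>k. b ^ k dvd e * a ^ k) \<longrightarrow> b dvd a)"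

lemma completely_integrally_closed_cps: "completely_integrally_closed TYPE('n::finite cps)"
  unfolding completely_integrally_closed_def
proof (intro allI impI)
  fix a b e :: "'n cps"
  assume b: "b \<noteq> 0" and e: "e \<noteq> 0" and dvd: "\<forall>k. b ^ k dvd e * a ^ k"
  obtain p :: "'n \<Rightarrow> nat" where "weights p" using ex_weights by blast
  then interpret weights p .
  have "to_formal b dvd to_formal a"
  proof (rule completely_integrally_closed_mps)
    fix k
    have "b ^ k dvd e * a ^ k" using dvd by blast
    then show "to_formal b ^ k dvd to_formal e * to_formal a ^ k"
      unfolding to_formal_dvd_iff[symmetric] by simp
  qed (use b e in auto)
  then show "b dvd a" by (simp add: to_formal_dvd_iff)
qed

section \<open>Derivations\<close>

lift_definition pd :: "'n::finite \<Rightarrow> 'n mps \<Rightarrow> 'n mps" is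
  "\<lambda>i f c. of_nat (Suc (c i)) * f (c + unit_idx i)" .

lemma mps_coeff_pd: "mps_coeff (pd i f) c = of_nat (Suc (c i)) * mps_coeff f (c + unit_idx i)"
  by (simp add: pd.rep_eq)

lemma pd_add: "pd i (f + g) = pd i f + pd i g"
  and pd_scale: "pd i (mps_scale z f) = mps_scale z (pd i f)"
  by (auto intro!: mps_eqI simp: mps_coeff_pd algebra_simps)

lemma pd_var: "pd i (mps_var j) = (if i = j then 1 else 0)"
proof (rule mps_eqI)
  fix c
  have "c + unit_idx i = unit_idx j \<longleftrightarrow> c = 0 \<and> i = j"
  proof
    assume *: "c + unit_idx i = unit_idx j"
    have "mdeg c + 1 = 1" using arg_cong[OF *, of mdeg] by simp
    then have "c = 0" by simp
    with * have "unit_idx i = unit_idx j" by simp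
    then show "c = 0 \<and> i = j" using \<open>c = 0\<close> by (auto simp: unit_idx_def fun_eq_iff split: if_splits)
  qed auto
  then show "mps_coeff (pd i (mps_var j)) c = mps_coeff (if i = j then 1 else 0) c"
    by (auto simp: mps_coeff_pd mps_var_mono mps_coeff_mono mps_coeff_one zero_fun_apply)
qed

text \<open>The index shift behind the product rule: the factor \<open>b i\<close> produced by
  differentiation kills the pairs whose second component does not involve variable
  \<open>i\<close>.\<close>

lemma sum_splittings_shift:
  fixes h :: "('n::finite \<Rightarrow> nat) \<Rightarrow> ('n \<Rightarrow> nat) \<Rightarrow> 'a::comm_monoid_add"
  assumes "\<And>a b. b i = 0 \<Longrightarrow> h a b = 0"
  shows "(\<Sum>(a, b)\<in>splittings (c + unit_idx i). h a b) = (\<Sum>(a, b)\<in>splittings c. h a (b + unit_idx i))"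
proof -
  have "(\<Sum>(a, b)\<in>splittings (c + unit_idx i). h a b) =
      (\<Sum>(a, b)\<in>{(a, b)\<in>splittings (c + unit_idx i). b i > 0}. h a b)"
    by (rule sum.mono_neutral_right) (auto simp: assms intro: ccontr)
  also have "\<dots> = (\<Sum>(a, b)\<in>splittings c. h a (b + unit_idx i))"
  proof (rule sum.reindex_bij_witness[where j = "\<lambda>(a, b). (a, b - unit_idx i)" and i = "\<lambda>(a, b). (a, b + unit_idx i)"])
    fix x assume x: "x \<in> {(a, b)\<in>splittings (c + unit_idx i). b i > 0}"
    obtain a b where ab: "x = (a, b)" by (cases x)
    have b: "b - unit_idx i + unit_idx i = b" using x by (auto simp: ab unit_idx_def fun_eq_iff plus_fun_apply)
    have "a + (b - unit_idx i) + unit_idx i = c + unit_idx i"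
      using x b by (simp add: ab splittings_def add.assoc)
    then have "a + (b - unit_idx i) = c" by simp
    then show "(case x of (a, b) \<Rightarrow> (a, b - unit_idx i)) \<in> splittings c"
      by (simp add: ab splittings_def)
    show "(case case x of (a, b) \<Rightarrow> (a, b - unit_idx i) of (a, b) \<Rightarrow> (a, b + unit_idx i)) = x"
      using b by (simp add: ab)
    show "(case case x of (a, b) \<Rightarrow> (a, b - unit_idx i) of (a, b) \<Rightarrow> h a (b + unit_idx i)) = (case x of (a, b) \<Rightarrow> h a b)"
      using b by (simp add: ab)
  qed (auto simp: splittings_def unit_idx_def add.assoc plus_fun_apply)
  finally show ?thesis .
qed

lemma sum_splittings_swap:
  "(\<Sum>(a, b)\<in>splittings c. h a b) = (\<Sum>(a, b)\<in>splittings c. h b a)"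
  by (rule sum.reindex_bij_witness[where i = prod.swap and j = prod.swap])
    (auto simp: splittings_def add.commute)

lemma pd_mult: "pd i (f * g) = f * pd i g + g * pd i f"
proof (rule mps_eqI)
  fix c :: "'a \<Rightarrow> nat"
  have *: "mps_coeff (u * pd i v) c = (\<Sum>(a, b)\<in>splittings (c + unit_idx i). of_nat (b i) * (mps_coeff u a * mps_coeff v b))"
    for u v
    by (subst sum_splittings_shift) (auto simp: mps_coeff_mult mps_coeff_pd unit_idx_def mult_ac plus_fun_apply)
  have "mps_coeff (f * pd i g + g * pd i f) c =
    (\<Sum>(a, b)\<in>splittings (c + unit_idx i). of_nat (b i) * (mps_coeff f a * mps_coeff g b)) +
    (\<Sum>(a, b)\<in>splittings (c + unit_idx i). of_nat (a i) * (mps_coeff f a * mps_coeff g b))"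
    unfolding mps_coeff_add * by (subst (2) sum_splittings_swap) (simp add: mult_ac)
  also have "\<dots> = (\<Sum>(a, b)\<in>splittings (c + unit_idx i). of_nat (Suc (c i)) * (mps_coeff f a * mps_coeff g b))"
    unfolding sum.distrib[symmetric]
  proof (rule sum.cong, simp, clarify)
    fix a b assume "(a, b) \<in> splittings (c + unit_idx i)"
    then have "a i + b i = Suc (c i)" by (auto simp: splittings_def fun_eq_iff unit_idx_def plus_fun_apply)
    then have "of_nat (b i) + of_nat (a i) = (of_nat (Suc (c i)) :: complex)"
      by (metis add.commute of_nat_add)
    then show "of_nat (b i) * (mps_coeff f a * mps_coeff g b) + of_nat (a i) * (mps_coeff f a * mps_coeff g b) =
      of_nat (Suc (c i)) * (mps_coeff f a * mps_coeff g b)"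
      by (metis distrib_right)
  qed
  also have "\<dots> = mps_coeff (pd i (f * g)) c"
    by (simp add: mps_coeff_pd mps_coeff_mult sum_distrib_left split_def)
  finally show "mps_coeff (pd i (f * g)) c = mps_coeff (f * pd i g + g * pd i f) c" ..
qed

lemma pd_one [simp]: "pd i 1 = 0"
  using pd_mult[of i 1 1] by (simp only: mult_1_left mult_1_right) (metis add_cancel_right_right)

lemma pd_zero [simp]: "pd i 0 = 0"
  using pd_scale[of i 0 0] by simp

lemma convergent_pd:
  assumes "convergent_mps f"
  shows "convergent_mps (pd i f)"
proof (rule convergent_shift[OF assms])
  fix c :: "'a \<Rightarrow> nat"
  have "Suc (c i) \<le> 2 ^ Suc (c i)" by (rule less_imp_le[OF less_exp])
  also have "c i \<le> mdeg c" unfolding mdeg_def by (rule member_le_sum) auto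
  then have "(2::nat) ^ Suc (c i) \<le> 2 ^ mdeg (c + unit_idx i)" by (intro power_increasing) auto
  finally have "real (Suc (c i)) \<le> real (2 ^ mdeg (c + unit_idx i))" by (rule of_nat_mono)
  then show "norm (mps_coeff (pd i f) c) \<le> 2 ^ mdeg (c + unit_idx i) * norm (mps_coeff f (c + unit_idx i))"
    unfolding mps_coeff_pd norm_mult norm_of_nat by (intro mult_right_mono) auto
qed

lemma derivation_mps_iff:
  "derivation mps_scale \<delta> \<longleftrightarrow> (\<forall>f g. \<delta> (f + g) = \<delta> f + \<delta> g) \<and> (\<forall>z f. \<delta> (mps_scale z f) = mps_scale z (\<delta> f)) \<and>
     (\<forall>g h. \<delta> (g * h) = g * \<delta> h + h * \<delta> g)"
  unfolding derivation_def module_hom_def module_hom_axioms_def by (auto simp: module_mps)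

lemma derivation_cps_iff:
  "derivation cps_scale \<delta> \<longleftrightarrow> (\<forall>f g. \<delta> (f + g) = \<delta> f + \<delta> g) \<and> (\<forall>z f. \<delta> (cps_scale z f) = cps_scale z (\<delta> f)) \<and>
     (\<forall>g h. \<delta> (g * h) = g * \<delta> h + h * \<delta> g)"
  unfolding derivation_def module_hom_def module_hom_axioms_def by (auto simp: module_cps)

lemma module_hom_sumD:
  assumes "\<And>f g :: 'a::ab_group_add. \<delta> (f + g) = \<delta> f + \<delta> g"
  shows "\<delta> (sum h A) = (\<Sum>i\<in>A. \<delta> (h i) :: 'b::ab_group_add)" and "\<delta> 0 = 0"
proof -
  show 0: "\<delta> 0 = 0" using assms[of 0 0] by simp
  show "\<delta> (sum h A) = (\<Sum>i\<in>A. \<delta> (h i))"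
    by (induction A rule: infinite_finite_induct) (auto simp: assms 0)
qed

lemma derivation_one:
  fixes \<delta> :: "'a::comm_ring_1 \<Rightarrow> 'a"
  assumes "\<And>g h. \<delta> (g * h) = g * \<delta> h + h * \<delta> g"
  shows "\<delta> 1 = 0"
  using assms[of 1 1] by simp

definition vf :: "('n::finite \<Rightarrow> 'n mps) \<Rightarrow> 'n mps \<Rightarrow> 'n mps" where
  "vf a f = (\<Sum>i\<in>UNIV. a i * pd i f)"

lemma vf_add: "vf a (f + g) = vf a f + vf a g"
  and vf_scale: "vf a (mps_scale z f) = mps_scale z (vf a f)"
  by (simp_all add: vf_def pd_add pd_scale distrib_left sum.distrib mps_mult_scale mps_scale_sum)

lemma vf_mult: "vf a (f * g) = f * vf a g + g * vf a f"
  unfolding vf_def pd_mult sum_distrib_left sum.distrib[symmetric]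
  by (rule sum.cong) (auto simp: algebra_simps)

lemma vf_one: "vf a 1 = 0"
  by (rule derivation_one) (rule vf_mult)

lemma vf_var [simp]: "vf a (mps_var j) = a j"
proof -
  have "vf a (mps_var j) = (\<Sum>i\<in>UNIV. if i = j then a i else 0)"
    unfolding vf_def by (rule sum.cong) (auto simp: pd_var)
  then show ?thesis by simp
qed

lemma derivation_vf: "derivation mps_scale (vf a)"
  by (simp add: derivation_mps_iff vf_add vf_scale vf_mult)

text \<open>Since \<open>\<delta>\<close> is not given as continuous, agreement on the variables
  cannot be extended by a limit. Instead the difference kills constants and commutes with
  multiplication by variables, so \<open>vanishing_principle\<close> applies.\<close>

lemma derivation_eq_vf:
  assumes "derivation mps_scale \<delta>"
  shows "\<delta> = vf (\<lambda>i. \<delta> (mps_var i))"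
proof
  fix f
  have add: "\<delta> (f + g) = \<delta> f + \<delta> g" and sc: "\<delta> (mps_scale z f) = mps_scale z (\<delta> f)"
    and mu: "\<delta> (f * g) = f * \<delta> g + g * \<delta> f" for f g z
    using assms by (auto simp: derivation_mps_iff)
  define d where "d = (\<lambda>f. \<delta> f - vf (\<lambda>i. \<delta> (mps_var i)) f)"
  have dadd: "d (f + g) = d f + d g" for f g by (simp add: d_def add vf_add)
  have d1: "d (mps_scale z 1) = 0" for z
    using derivation_one[of \<delta>, OF mu] by (simp add: d_def sc vf_scale vf_one)
  have dv: "d (mps_var i * g) = mps_var i * d g" for i g
    by (simp add: d_def mu vf_mult algebra_simps)
  have "d f = 0"
  proof (rule vanishing_principle[of d mps_var])
    fix f
    have "d f = (\<Sum>i\<in>UNIV. mps_var i * d (part_mps i f))"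
      by (subst mps_decompose) (simp add: dadd d1 dv module_hom_sumD(1)[of d, OF dadd])
    then show "\<exists>g. d f = (\<Sum>i\<in>UNIV. mps_var i * d (g i))" by (intro exI[of _ "\<lambda>i. part_mps i f"])
  qed (rule mps_var_ordge)
  then show "\<delta> f = vf (\<lambda>i. \<delta> (mps_var i)) f" by (simp add: d_def)
qed

lemma cps_decompose:
  fixes f :: "'n::finite cps"
  shows "\<exists>z g. f = cps_scale z 1 + (\<Sum>i\<in>UNIV. cps_var i * g i)"
proof -
  have "\<exists>g. to_formal g = part_mps i (to_formal f)" for i
    by (metis obtain_cps convergent_part convergent_to_formal)
  then obtain g where g: "\<And>i. to_formal (g i) = part_mps i (to_formal f)" by metis
  have "f = cps_scale (mps_coeff (to_formal f) 0) 1 + (\<Sum>i\<in>UNIV. cps_var i * g i)"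
    unfolding to_formal_eq_iff[symmetric] using mps_decompose[of "to_formal f"] by (simp add: g)
  then show ?thesis by blast
qed

lemma derivation_cps_eq_vf:
  fixes f :: "'n::finite cps"
  assumes "derivation cps_scale \<delta>"
  shows "to_formal (\<delta> f) = vf (\<lambda>i. to_formal (\<delta> (cps_var i))) (to_formal f)"
proof -
  have add: "\<delta> (f + g) = \<delta> f + \<delta> g" and sc: "\<delta> (cps_scale z f) = cps_scale z (\<delta> f)"
    and mu: "\<delta> (f * g) = f * \<delta> g + g * \<delta> f" for f g z
    using assms by (auto simp: derivation_cps_iff)
  define d where "d = (\<lambda>f. to_formal (\<delta> f) - vf (\<lambda>i. to_formal (\<delta> (cps_var i))) (to_formal f))"
  have dadd: "d (f + g) = d f + d g" for f g by (simp add: d_def add vf_add)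
  have d1: "d (cps_scale z 1) = 0" for z
    using derivation_one[of \<delta>, OF mu] by (simp add: d_def sc vf_scale vf_one)
  have dv: "d (cps_var i * g) = mps_var i * d g" for i g
    by (simp add: d_def mu vf_mult algebra_simps)
  have "d f = 0"
  proof (rule vanishing_principle[of d mps_var])
    fix f :: "'n cps"
    obtain z g where f: "f = cps_scale z 1 + (\<Sum>i\<in>UNIV. cps_var i * g i)" using cps_decompose by blast
    have "d f = (\<Sum>i\<in>UNIV. mps_var i * d (g i))"
      by (subst f) (simp add: dadd d1 dv module_hom_sumD(1)[of d, OF dadd])
    then show "\<exists>g. d f = (\<Sum>i\<in>UNIV. mps_var i * d (g i))" by (intro exI[of _ g])
  qed (rule mps_var_ordge)
  then show ?thesis by (simp add: d_def)
qed

lift_definition pd_cps :: "'n::finite \<Rightarrow> 'n cps \<Rightarrow> 'n cps" is pd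
  by (rule convergent_pd)

definition vf_cps :: "('n::finite \<Rightarrow> 'n cps) \<Rightarrow> 'n cps \<Rightarrow> 'n cps" where
  "vf_cps a f = (\<Sum>i\<in>UNIV. a i * pd_cps i f)"

lemma to_formal_vf_cps: "to_formal (vf_cps a f) = vf (\<lambda>i. to_formal (a i)) (to_formal f)"
  by (simp add: vf_cps_def vf_def pd_cps.rep_eq)

lemma vf_cps_var [simp]: "vf_cps a (cps_var j) = a j"
  by (simp add: to_formal_vf_cps flip: to_formal_eq_iff)

lemma derivation_vf_cps: "derivation cps_scale (vf_cps a)"
  unfolding derivation_cps_iff to_formal_eq_iff[symmetric]
  by (simp add: to_formal_vf_cps vf_add vf_scale vf_mult)

lemma derivation_cps_eq:
  assumes "derivation cps_scale \<delta>"
  shows "\<delta> = vf_cps (\<lambda>i. \<delta> (cps_var i))"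
proof
  fix f
  show "\<delta> f = vf_cps (\<lambda>i. \<delta> (cps_var i)) f"
    unfolding to_formal_eq_iff[symmetric] to_formal_vf_cps by (rule derivation_cps_eq_vf[OF assms])
qed

text \<open>Differentiation lowers the order by at most one, and the singular coefficient raises it
  again.\<close>

lemma vf_ordge:
  assumes a: "\<And>i. a i \<in> ordge 1" and f: "f \<in> ordge k"
  shows "vf a f \<in> ordge k"
proof (cases k)
  case (Suc j)
  have "pd i f \<in> ordge j" for i using f by (auto simp: ordge_def mps_coeff_pd Suc)
  then have "a i * pd i f \<in> ordge k" for i using ordge_mult[OF a, of "pd i f" j i] by (simp add: Suc)
  then show ?thesis unfolding vf_def by (simp add: ordge_sum)
qed simp

section \<open>Substitution\<close>

definition subst_mono :: "('n::finite \<Rightarrow> 'k::finite mps) \<Rightarrow> ('n \<Rightarrow> nat) \<Rightarrow> 'k mps" where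
  "subst_mono L a = (\<Prod>i\<in>UNIV. L i ^ a i)"

text \<open>If every \<open>L i\<close> has positive order, \<open>subst_mono L a\<close> has order
  at least \<open>mdeg a\<close>, so the bound on \<open>mdeg a\<close> drops only zero terms. It
  makes the sum finite for arbitrary \<open>L\<close>, so that linearity holds without
  conditions.\<close>

definition subst :: "('n::finite \<Rightarrow> 'k::finite mps) \<Rightarrow> 'n mps \<Rightarrow> 'k mps" where
  "subst L f = Abs_mps (\<lambda>c. \<Sum>a | mdeg a \<le> mdeg c. mps_coeff f a * mps_coeff (subst_mono L a) c)"

lemma mps_coeff_subst:
  "mps_coeff (subst L f) c = (\<Sum>a | mdeg a \<le> mdeg c. mps_coeff f a * mps_coeff (subst_mono L a) c)"
  by (simp add: subst_def Abs_mps_inverse)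

lemma subst_mono_add: "subst_mono L (a + b) = subst_mono L a * subst_mono L b"
  by (simp add: subst_mono_def power_add prod.distrib plus_fun_apply)

lemma subst_mono_0 [simp]: "subst_mono L 0 = 1"
  by (simp add: subst_mono_def zero_fun_apply)

lemma subst_mono_unit_idx [simp]: "subst_mono L (unit_idx i) = L i"
proof -
  have "subst_mono L (unit_idx i) = (\<Prod>j\<in>UNIV. if j = i then L j else 1)"
    unfolding subst_mono_def unit_idx_def by (rule prod.cong) auto
  then show ?thesis by simp
qed

lemma ordge_power: "f \<in> ordge k \<Longrightarrow> f ^ j \<in> ordge (j * k)"
  by (induction j) (auto dest: ordge_mult)

lemma ordge_prod: "finite I \<Longrightarrow> (\<And>i. i \<in> I \<Longrightarrow> f i \<in> ordge (k i)) \<Longrightarrow> prod f I \<in> ordge (sum k I)"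
  by (induction I rule: finite_induct) (auto intro: ordge_mult)

lemma subst_add: "subst L (f + g) = subst L f + subst L g"
  and subst_diff: "subst L (f - g) = subst L f - subst L g"
  and subst_scale: "subst L (mps_scale z f) = mps_scale z (subst L f)"
  by (auto intro!: mps_eqI simp: mps_coeff_subst algebra_simps sum.distrib sum_subtractf sum_distrib_left)

lemma subst_zero [simp]: "subst L 0 = 0"
  by (auto intro!: mps_eqI simp: mps_coeff_subst)

lemma subst_sum: "subst L (sum f I) = (\<Sum>i\<in>I. subst L (f i))"
  by (rule module_hom_sumD) (rule subst_add)

context
  fixes L :: "'n::finite \<Rightarrow> 'k::finite mps"
  assumes L: "\<And>i. L i \<in> ordge 1"
begin

lemma subst_mono_ordge: "subst_mono L a \<in> ordge (mdeg a)"
  unfolding subst_mono_def mdeg_def using ordge_power[OF L] by (intro ordge_prod) auto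

text \<open>A common bound \<open>k\<close> makes the sums for different indices \<open>c\<close>
  range over the same set.\<close>

lemma mps_coeff_subst_le:
  assumes "mdeg c \<le> k"
  shows "mps_coeff (subst L f) c = (\<Sum>a | mdeg a \<le> k. mps_coeff f a * mps_coeff (subst_mono L a) c)"
  unfolding mps_coeff_subst
  using assms subst_mono_ordge by (intro sum.mono_neutral_left) (auto simp: finite_mdeg_le ordge_def not_le)

lemma subst_one [simp]: "subst L 1 = 1"
proof (rule mps_eqI)
  fix c
  have "mps_coeff (subst L 1) c = (\<Sum>a\<in>{0}. mps_coeff 1 a * mps_coeff (subst_mono L a) c)"
    unfolding mps_coeff_subst
    by (rule sum.mono_neutral_right) (auto simp: finite_mdeg_le mps_coeff_one)
  then show "mps_coeff (subst L 1) c = mps_coeff 1 c" by (simp add: mps_coeff_one)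
qed

lemma subst_mult [simp]: "subst L (f * g) = subst L f * subst L g"
proof (rule mps_eqI)
  fix c :: "'k \<Rightarrow> nat"
  define A where "A = {a :: 'n \<Rightarrow> nat. mdeg a \<le> mdeg c}"
  have finA [simp]: "finite A" by (simp add: A_def finite_mdeg_le)
  let ?h = "\<lambda>x y. mps_coeff f x * mps_coeff g y * mps_coeff (subst_mono L (x + y)) c"
  have "mps_coeff (subst L f * subst L g) c =
      (\<Sum>(a, b)\<in>splittings c. (\<Sum>x\<in>A. mps_coeff f x * mps_coeff (subst_mono L x) a) *
         (\<Sum>y\<in>A. mps_coeff g y * mps_coeff (subst_mono L y) b))"
    unfolding mps_coeff_mult
  proof (rule sum.cong, simp, clarify)
    fix a b assume "(a, b) \<in> splittings c"
    then have "mdeg a \<le> mdeg c" "mdeg b \<le> mdeg c" by (auto simp: splittings_def)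
    then show "mps_coeff (subst L f) a * mps_coeff (subst L g) b =
      (\<Sum>x\<in>A. mps_coeff f x * mps_coeff (subst_mono L x) a) * (\<Sum>y\<in>A. mps_coeff g y * mps_coeff (subst_mono L y) b)"
      by (simp add: A_def mps_coeff_subst_le)
  qed
  also have "\<dots> = (\<Sum>s\<in>splittings c. \<Sum>x\<in>A. \<Sum>y\<in>A. mps_coeff f x * mps_coeff g y *
      (mps_coeff (subst_mono L x) (fst s) * mps_coeff (subst_mono L y) (snd s)))"
    by (simp add: split_def sum_product mult_ac)
  also have "\<dots> = (\<Sum>x\<in>A. \<Sum>y\<in>A. \<Sum>s\<in>splittings c. mps_coeff f x * mps_coeff g y *
      (mps_coeff (subst_mono L x) (fst s) * mps_coeff (subst_mono L y) (snd s)))"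
    by (subst sum.swap) (intro sum.cong refl, rule sum.swap)
  also have "\<dots> = (\<Sum>x\<in>A. \<Sum>y\<in>A. ?h x y)"
    by (simp add: subst_mono_add mps_coeff_mult split_def sum_distrib_left)
  also have "\<dots> = (\<Sum>(x, y)\<in>A \<times> A. ?h x y)"
    by (simp add: sum.cartesian_product)
  \<comment> \<open>For \<open>mdeg (x + y) > mdeg c\<close> the monomial has too high an order to
    reach \<open>c\<close>; the remaining pairs are grouped by their sum.\<close>
  also have "\<dots> = (\<Sum>(x, y)\<in>{(x, y). mdeg (x + y) \<le> mdeg c}. ?h x y)"
  proof (rule sum.mono_neutral_right)
    have *: "mdeg d \<le> mdeg c" if "mps_coeff (subst_mono L d) c \<noteq> 0" for d
      using subst_mono_ordge[of d] that by (auto simp: ordge_def not_le[symmetric])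
    show "\<forall>z\<in>A \<times> A - {(x, y). mdeg (x + y) \<le> mdeg c}. (case z of (x, y) \<Rightarrow> ?h x y) = 0"
      by (auto simp del: mdeg_add intro!: *)
  qed (simp, auto simp: A_def)
  also have "\<dots> = (\<Sum>(d, x, y)\<in>Sigma A splittings. ?h x y)"
    by (rule sum.reindex_bij_witness[where j = "\<lambda>(x, y). (x + y, x, y)" and i = snd])
      (auto simp: A_def splittings_def)
  also have "\<dots> = (\<Sum>d\<in>A. \<Sum>(x, y)\<in>splittings d. ?h x y)"
    by (subst sum.Sigma) auto
  also have "\<dots> = (\<Sum>d\<in>A. mps_coeff (f * g) d * mps_coeff (subst_mono L d) c)"
    unfolding mps_coeff_mult sum_distrib_right
    by (intro sum.cong refl) (auto simp: splittings_def)
  also have "\<dots> = mps_coeff (subst L (f * g)) c"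
    by (simp add: mps_coeff_subst A_def)
  finally show "mps_coeff (subst L (f * g)) c = mps_coeff (subst L f * subst L g) c" ..
qed

lemma subst_var [simp]: "subst L (mps_var i) = L i"
proof (rule mps_eqI)
  fix c
  have "mps_coeff (subst L (mps_var i)) c = (\<Sum>a | mdeg a \<le> max 1 (mdeg c). mps_coeff (mps_var i) a * mps_coeff (subst_mono L a) c)"
    by (rule mps_coeff_subst_le) simp
  also have "\<dots> = (\<Sum>a\<in>{unit_idx i}. mps_coeff (mps_var i) a * mps_coeff (subst_mono L a) c)"
    by (rule sum.mono_neutral_right) (auto simp: finite_mdeg_le mps_var_mono mps_coeff_mono)
  finally show "mps_coeff (subst L (mps_var i)) c = mps_coeff (L i) c"
    by (simp add: mps_var_mono mps_coeff_mono)
qed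

lemma subst_power [simp]: "subst L (f ^ k) = subst L f ^ k"
  by (induction k) auto

lemma mps_coeff_subst_0 [simp]: "mps_coeff (subst L f) 0 = mps_coeff f 0"
  by (simp add: mps_coeff_subst mps_coeff_one)

end

lemma subst_eq_if_var:
  fixes L :: "'n::finite \<Rightarrow> 'k::finite mps" and R :: "'k \<Rightarrow> 'n mps"
  assumes L: "\<And>i. L i \<in> ordge 1" and R: "\<And>i. R i \<in> ordge 1" and "\<And>i. subst R (L i) = mps_var i"
  shows "subst R (subst L f) = f"
proof -
  define d where "d = (\<lambda>f. subst R (subst L f) - f)"
  have add: "d (f + g) = d f + d g" for f g by (simp add: d_def subst_add)
  have "d f = 0"
  proof (rule vanishing_principle[of d mps_var])
    fix f
    have "d f = (\<Sum>i\<in>UNIV. mps_var i * d (part_mps i f))"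
    proof -
      have "d (mps_scale z 1) = 0" for z
        by (simp add: d_def subst_scale subst_one[OF L] subst_one[OF R])
      moreover have "d (mps_var i * g) = mps_var i * d g" for i g
        by (simp add: d_def subst_mult[OF L] subst_mult[OF R] subst_var[OF L] assms(3) algebra_simps)
      ultimately show ?thesis
        by (subst mps_decompose[of f]) (simp add: add module_hom_sumD(1)[of d, OF add])
    qed
    then show "\<exists>g. d f = (\<Sum>i\<in>UNIV. mps_var i * d (g i))" by (intro exI[of _ "\<lambda>i. part_mps i f"])
  qed (rule mps_var_ordge)
  then show ?thesis by (simp add: d_def)
qed

section \<open>Majorants of products and substitutions\<close>

lemma majorized_add: "majorized \<rho> f M \<Longrightarrow> majorized \<rho> g N \<Longrightarrow> (\<And>i. \<rho> i > 0) \<Longrightarrow> majorized \<rho> (f + g) (M + N)"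
  unfolding majorized_def
proof (intro allI impI)
  fix F :: "('a \<Rightarrow> nat) set"
  assume f: "\<forall>F. finite F \<longrightarrow> (\<Sum>c\<in>F. norm (mps_coeff f c) * mev \<rho> c) \<le> M"
    and g: "\<forall>F. finite F \<longrightarrow> (\<Sum>c\<in>F. norm (mps_coeff g c) * mev \<rho> c) \<le> N"
    and \<rho>: "\<And>i. \<rho> i > 0" and F: "finite F"
  have "(\<Sum>c\<in>F. norm (mps_coeff (f + g) c) * mev \<rho> c) \<le>
      (\<Sum>c\<in>F. norm (mps_coeff f c) * mev \<rho> c + norm (mps_coeff g c) * mev \<rho> c)"
    unfolding distrib_right[symmetric] using mev_pos[of \<rho>, OF \<rho>]
    by (intro sum_mono mult_right_mono) (auto simp: norm_triangle_ineq less_imp_le)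
  also have "\<dots> \<le> M + N" using f g F by (auto simp: sum.distrib intro: add_mono)
  finally show "(\<Sum>c\<in>F. norm (mps_coeff (f + g) c) * mev \<rho> c) \<le> M + N" .
qed

lemma majorized_scale_mono:
  assumes "\<And>i. \<rho> i > 0"
  shows "majorized \<rho> (mps_scale z (mono_mps a)) (norm z * mev \<rho> a)"
  unfolding majorized_def
proof (intro allI impI)
  fix F :: "('a \<Rightarrow> nat) set" assume F: "finite F"
  have "(\<Sum>c\<in>F. norm (mps_coeff (mps_scale z (mono_mps a)) c) * mev \<rho> c) =
      (\<Sum>c\<in>F. if c = a then norm z * mev \<rho> a else 0)"
    by (rule sum.cong) (auto simp: mps_coeff_mono)
  also have "\<dots> \<le> norm z * mev \<rho> a" using F mev_pos[of \<rho> a, OF assms] by (simp add: less_imp_le)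
  finally show "(\<Sum>c\<in>F. norm (mps_coeff (mps_scale z (mono_mps a)) c) * mev \<rho> c) \<le> norm z * mev \<rho> a" .
qed

lemma majorized_nonneg: "majorized \<rho> f M \<Longrightarrow> M \<ge> 0"
  using majorizedD[of \<rho> f M "{}"] by simp

lemma majorized_mult:
  assumes f: "majorized \<rho> f M" and g: "majorized \<rho> g N" and \<rho>: "\<And>i. \<rho> i > 0"
  shows "majorized \<rho> (f * g) (M * N)"
  unfolding majorized_def
proof (intro allI impI)
  fix F :: "('a \<Rightarrow> nat) set" assume F: "finite F"
  define S where "S = Sigma F splittings"
  define A where "A = fst ` snd ` S"
  define B where "B = snd ` snd ` S"
  have S: "finite S" unfolding S_def using F by auto
  have AB: "finite A" "finite B" unfolding A_def B_def using S by auto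
  let ?h = "\<lambda>a b. (norm (mps_coeff f a) * mev \<rho> a) * (norm (mps_coeff g b) * mev \<rho> b)"
  have pos: "mev \<rho> c \<ge> 0" for c using mev_pos[of \<rho> c, OF \<rho>] by simp
  have "(\<Sum>c\<in>F. norm (mps_coeff (f * g) c) * mev \<rho> c) \<le> (\<Sum>c\<in>F. \<Sum>(a, b)\<in>splittings c. ?h a b)"
  proof (rule sum_mono)
    fix c
    have "norm (mps_coeff (f * g) c) * mev \<rho> c \<le> (\<Sum>(a, b)\<in>splittings c. norm (mps_coeff f a * mps_coeff g b)) * mev \<rho> c"
      unfolding mps_coeff_mult by (intro mult_right_mono order.trans[OF norm_sum] pos) (simp add: split_def)
    also have "\<dots> = (\<Sum>(a, b)\<in>splittings c. ?h a b)"
      unfolding sum_distrib_right by (rule sum.cong) (auto simp: splittings_def mev_add norm_mult)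
    finally show "norm (mps_coeff (f * g) c) * mev \<rho> c \<le> (\<Sum>(a, b)\<in>splittings c. ?h a b)" .
  qed
  also have "\<dots> = (\<Sum>(c, a, b)\<in>S. ?h a b)"
    unfolding S_def using F by (subst sum.Sigma) auto
  also have "\<dots> \<le> (\<Sum>(a, b)\<in>A \<times> B. ?h a b)"
  proof (rule sum_le_included[where i = "\<lambda>(a, b). (a + b, a, b)"])
    show "\<forall>x\<in>S. \<exists>y\<in>A \<times> B. (case y of (a, b) \<Rightarrow> (a + b, a, b)) = x \<and>
       (case x of (c, a, b) \<Rightarrow> ?h a b) \<le> (case y of (a, b) \<Rightarrow> ?h a b)"
    proof
      fix x assume x: "x \<in> S"
      obtain c a b where c: "x = (c, a, b)" by (cases x)
      have "a + b = c" using x by (auto simp: c S_def splittings_def)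
      moreover have "a \<in> A" "b \<in> B" unfolding A_def B_def using x c by force+
      ultimately show "\<exists>y\<in>A \<times> B. (case y of (a, b) \<Rightarrow> (a + b, a, b)) = x \<and>
         (case x of (c, a, b) \<Rightarrow> ?h a b) \<le> (case y of (a, b) \<Rightarrow> ?h a b)"
        by (intro bexI[of _ "(a, b)"]) (auto simp: c)
    qed
  qed (use S AB pos in auto)
  also have "\<dots> = (\<Sum>a\<in>A. norm (mps_coeff f a) * mev \<rho> a) * (\<Sum>b\<in>B. norm (mps_coeff g b) * mev \<rho> b)"
    by (simp add: sum_product sum.cartesian_product)
  also have "\<dots> \<le> M * N"
    using majorized_nonneg[OF f] pos by (intro mult_mono majorizedD[OF f] majorizedD[OF g] AB sum_nonneg) auto
  finally show "(\<Sum>c\<in>F. norm (mps_coeff (f * g) c) * mev \<rho> c) \<le> M * N" .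
qed

lemma majorized_subst_mono:
  assumes L: "\<And>i. majorized \<rho> (L i) (M i)" and \<rho>: "\<And>i. \<rho> i > 0"
  shows "majorized \<rho> (subst_mono L a) (mev M a)"
proof -
  have 1: "majorized \<rho> 1 1"
    using majorized_scale_mono[of \<rho> 1 0, OF \<rho>] by (simp add: mono_mps_0)
  have pow: "majorized \<rho> (L i ^ k) (M i ^ k)" for i k
    by (induction k) (auto intro: 1 majorized_mult L \<rho>)
  have "majorized \<rho> (\<Prod>i\<in>I. L i ^ a i) (\<Prod>i\<in>I. M i ^ a i)" if "finite I" for I
    using that by (induction I rule: finite_induct) (auto intro: 1 majorized_mult pow \<rho>)
  then show ?thesis by (simp add: subst_mono_def mev_def)
qed

text \<open>If the norm of each \<open>L i\<close> at radii \<open>\<rho>\<close> is at most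
  \<open>M i\<close>, that of \<open>subst_mono L a\<close> is at most the value of the monomial at
  \<open>M\<close>. Substitution thus does not increase norms when the source carries the radii
  \<open>M\<close>.\<close>

lemma majorized_subst:
  fixes L :: "'n::finite \<Rightarrow> 'k::finite mps"
  assumes L: "\<And>i. majorized \<rho> (L i) (M i)" "\<And>i. L i \<in> ordge 1" and \<rho>: "\<And>i. \<rho> i > 0"
    and f: "majorized M f K"
  shows "majorized \<rho> (subst L f) K"
  unfolding majorized_def
proof (intro allI impI)
  fix F :: "('k \<Rightarrow> nat) set" assume F: "finite F"
  define k where "k = Max (insert 0 (mdeg ` F))"
  define A where "A = {a :: 'n \<Rightarrow> nat. mdeg a \<le> k}"
  have A: "finite A" by (simp add: A_def finite_mdeg_le)
  have pos: "mev \<rho> c \<ge> 0" for c using mev_pos[of \<rho> c, OF \<rho>] by simp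
  have "(\<Sum>c\<in>F. norm (mps_coeff (subst L f) c) * mev \<rho> c) \<le>
      (\<Sum>c\<in>F. \<Sum>a\<in>A. norm (mps_coeff f a) * (norm (mps_coeff (subst_mono L a) c) * mev \<rho> c))"
  proof (rule sum_mono)
    fix c assume "c \<in> F"
    then have c: "mdeg c \<le> k" unfolding k_def using F by (intro Max_ge) auto
    have "norm (mps_coeff (subst L f) c) * mev \<rho> c \<le> (\<Sum>a\<in>A. norm (mps_coeff f a * mps_coeff (subst_mono L a) c)) * mev \<rho> c"
      unfolding mps_coeff_subst_le[OF L(2) c] A_def by (intro mult_right_mono norm_sum pos)
    then show "norm (mps_coeff (subst L f) c) * mev \<rho> c \<le>
      (\<Sum>a\<in>A. norm (mps_coeff f a) * (norm (mps_coeff (subst_mono L a) c) * mev \<rho> c))"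
      by (simp add: sum_distrib_right norm_mult mult.assoc)
  qed
  also have "\<dots> = (\<Sum>a\<in>A. norm (mps_coeff f a) * (\<Sum>c\<in>F. norm (mps_coeff (subst_mono L a) c) * mev \<rho> c))"
    by (subst sum.swap) (simp add: sum_distrib_left)
  also have "\<dots> \<le> (\<Sum>a\<in>A. norm (mps_coeff f a) * mev M a)"
    by (intro sum_mono mult_left_mono majorizedD[OF majorized_subst_mono[OF L(1) \<rho>]] F) auto
  also have "\<dots> \<le> K" by (rule majorizedD[OF f A])
  finally show "(\<Sum>c\<in>F. norm (mps_coeff (subst L f) c) * mev \<rho> c) \<le> K" .
qed

section \<open>One additional variable\<close>

text \<open>
  In power series over \<open>'n option\<close> the variable \<open>None\<close>, written \<open>t\<close>, is distinguished.
\<close>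

definition opt :: "('n \<Rightarrow> nat) \<Rightarrow> nat \<Rightarrow> 'n option \<Rightarrow> nat" where
  "opt a k = case_option k a"

lemma opt_simps [simp]: "opt a k None = k" "opt a k (Some i) = a i" "opt a k \<circ> Some = a"
  by (auto simp: opt_def)

lemma opt_surj: "c = opt (c \<circ> Some) (c None)"
  by (auto simp: opt_def fun_eq_iff split: option.split)

lemma opt_inj [simp]: "opt a k = opt b j \<longleftrightarrow> a = b \<and> k = j"
  by (metis opt_simps)

lemma opt_add: "opt a j + opt b k = opt (a + b) (j + k)"
  by (auto simp: opt_def fun_eq_iff plus_fun_apply split: option.split)

lemma opt_0 [simp]: "opt 0 0 = 0"
  by (auto simp: opt_def fun_eq_iff zero_fun_apply split: option.split)

lift_definition iota :: "'n::finite mps \<Rightarrow> 'n option mps" is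
  "\<lambda>f c. if c None = 0 then f (c \<circ> Some) else 0" .

lemma mps_coeff_iota: "mps_coeff (iota f) c = (if c None = 0 then mps_coeff f (c \<circ> Some) else 0)"
  by (simp add: iota.rep_eq)

lemma iota_add: "iota (f + g) = iota f + iota g"
  and iota_scale: "iota (mps_scale z f) = mps_scale z (iota f)"
  and iota_zero [simp]: "iota 0 = 0"
  by (auto intro!: mps_eqI simp: mps_coeff_iota)

lemma iota_one [simp]: "iota 1 = 1"
proof (rule mps_eqI)
  fix c :: "'a option \<Rightarrow> nat"
  have "c = 0 \<longleftrightarrow> c None = 0 \<and> c \<circ> Some = 0"
    by (metis opt_0 opt_simps opt_surj)
  then show "mps_coeff (iota 1) c = mps_coeff 1 c" by (auto simp: mps_coeff_iota mps_coeff_one)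
qed

lemma iota_mult: "iota (f * g) = iota f * iota g"
proof (rule mps_eqI)
  fix c :: "'a option \<Rightarrow> nat"
  define a k where "a = c \<circ> Some" and "k = c None"
  have c: "c = opt a k" using opt_surj[of c] by (simp add: a_def k_def)
  have "mps_coeff (iota f * iota g) c = (\<Sum>(x, y)\<in>splittings (opt a k). mps_coeff (iota f) x * mps_coeff (iota g) y)"
    by (simp add: mps_coeff_mult c)
  also have "\<dots> = (\<Sum>(x, y)\<in>{(x, y)\<in>splittings (opt a k). x None = 0 \<and> y None = 0}. mps_coeff (iota f) x * mps_coeff (iota g) y)"
    by (rule sum.mono_neutral_right) (simp, auto simp: mps_coeff_iota split: if_splits)
  also have "\<dots> = mps_coeff (iota (f * g)) c"
  proof (cases "k = 0")
    case True
    have "(\<Sum>(x, y)\<in>{(x, y)\<in>splittings (opt a k). x None = 0 \<and> y None = 0}. mps_coeff (iota f) x * mps_coeff (iota g) y) =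
      (\<Sum>(x, y)\<in>splittings a. mps_coeff f x * mps_coeff g y)"
    proof (rule sum.reindex_bij_witness[where j = "\<lambda>(x, y). (x \<circ> Some, y \<circ> Some)" and i = "\<lambda>(x, y). (opt x 0, opt y 0)"])
      fix z assume z: "z \<in> {(x, y)\<in>splittings (opt a k). x None = 0 \<and> y None = 0}"
      obtain x y where xy: "z = (x, y)" by (cases z)
      have x: "x = opt (x \<circ> Some) 0" and y: "y = opt (y \<circ> Some) 0"
        using opt_surj[of x] opt_surj[of y] z by (auto simp: xy)
      show "(case case z of (x, y) \<Rightarrow> (x \<circ> Some, y \<circ> Some) of (x, y) \<Rightarrow> (opt x 0, opt y 0)) = z"
        by (simp add: xy x[symmetric] y[symmetric])
      have "opt ((x \<circ> Some) + (y \<circ> Some)) (0 + 0) = x + y"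
        unfolding opt_add[symmetric] x[symmetric] y[symmetric] ..
      also have "x + y = opt a k" using z by (simp add: xy splittings_def)
      finally have "opt ((x \<circ> Some) + (y \<circ> Some)) 0 = opt a k" by simp
      then show "(case z of (x, y) \<Rightarrow> (x \<circ> Some, y \<circ> Some)) \<in> splittings a"
        by (simp add: xy splittings_def)
      show "(case case z of (x, y) \<Rightarrow> (x \<circ> Some, y \<circ> Some) of (x, y) \<Rightarrow> mps_coeff f x * mps_coeff g y) =
        (case z of (x, y) \<Rightarrow> mps_coeff (iota f) x * mps_coeff (iota g) y)"
        using z by (auto simp: xy mps_coeff_iota)
    qed (auto simp: splittings_def opt_add True)
    then show ?thesis by (simp add: c True mps_coeff_iota mps_coeff_mult)
  next
    case False
    have "x None + y None = k" if "x + y = opt a k" for x y :: "'a option \<Rightarrow> nat"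
      using fun_cong[OF that, of None] by (simp add: plus_fun_apply)
    with False have E: "{(x, y)\<in>splittings (opt a k). x None = 0 \<and> y None = 0} = {}"
      by (fastforce simp: splittings_def)
    show ?thesis using False unfolding E by (simp add: c mps_coeff_iota)
  qed
  finally show "mps_coeff (iota (f * g)) c = mps_coeff (iota f * iota g) c" ..
qed

lemma iota_power: "iota (f ^ k) = iota f ^ k"
  by (induction k) (auto simp: iota_mult)

lemma iota_eq_0_iff [simp]: "iota f = 0 \<longleftrightarrow> f = 0"
proof
  assume *: "iota f = 0"
  show "f = 0"
  proof (rule mps_eqI)
    fix a
    have "mps_coeff (iota f) (opt a 0) = 0" using * by simp
    then show "mps_coeff f a = mps_coeff 0 a" by (simp add: mps_coeff_iota)
  qed
qed simp

lemma iota_var: "iota (mps_var i) = mps_var (Some i)"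
proof (rule mps_eqI)
  fix c :: "'a option \<Rightarrow> nat"
  have u: "unit_idx (Some i) = opt (unit_idx i) 0"
    by (auto simp: opt_def unit_idx_def fun_eq_iff split: option.split)
  have "c = unit_idx (Some i) \<longleftrightarrow> c None = 0 \<and> c \<circ> Some = unit_idx i"
    unfolding u by (metis opt_simps opt_surj)
  then show "mps_coeff (iota (mps_var i)) c = mps_coeff (mps_var (Some i)) c"
    by (auto simp: mps_coeff_iota mps_var_mono mps_coeff_mono)
qed

lift_definition slice :: "nat \<Rightarrow> 'n::finite option mps \<Rightarrow> 'n mps" is
  "\<lambda>k F a. F (opt a k)" .

lemma mps_coeff_slice: "mps_coeff (slice k F) a = mps_coeff F (opt a k)"
  by (simp add: slice.rep_eq)

definition tdeg_lt :: "nat \<Rightarrow> 'n::finite option mps \<Rightarrow> bool" where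
  "tdeg_lt m r \<longleftrightarrow> (\<forall>c. m \<le> c None \<longrightarrow> mps_coeff r c = 0)"

abbreviation tvar :: "'n::finite option mps" where
  "tvar \<equiv> mps_var None"

lemma tvar_power: "tvar ^ k = mono_mps (opt 0 k)"
proof (induction k)
  case (Suc k)
  have u: "unit_idx None = opt (0 :: 'a \<Rightarrow> nat) 1"
    by (auto simp: opt_def unit_idx_def fun_eq_iff zero_fun_apply split: option.split)
  have "tvar ^ Suc k = mono_mps (opt (0 :: 'a \<Rightarrow> nat) 1) * mono_mps (opt 0 k)"
    unfolding power_Suc Suc.IH by (simp add: mps_var_mono u)
  then show ?case
    by (simp add: opt_add flip: mono_mps_add)
qed (simp add: mono_mps_0)

lemma opt_le_iff: "opt 0 k \<le> c \<longleftrightarrow> k \<le> c None"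
  by (auto simp: le_fun_def opt_def zero_fun_apply split: option.split)

lemma tdeg_lt_expand:
  assumes "tdeg_lt m r"
  shows "r = (\<Sum>k<m. iota (slice k r) * tvar ^ k)"
proof (rule mps_eqI)
  fix c :: "'a option \<Rightarrow> nat"
  have *: "mps_coeff (iota (slice k r) * tvar ^ k) c = (if k = c None then mps_coeff r c else 0)" for k
  proof (cases "k \<le> c None")
    case True
    have "(c - opt 0 k) \<circ> Some = c \<circ> Some" "(c - opt 0 k) None = c None - k"
      by (auto simp: fun_eq_iff zero_fun_apply)
    then have "mps_coeff (mono_mps (opt 0 k) * iota (slice k r)) c = (if k = c None then mps_coeff r c else 0)"
      using True opt_surj[of c] by (auto simp: mps_coeff_mono_mult opt_le_iff mps_coeff_iota mps_coeff_slice)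
    then show ?thesis by (simp add: tvar_power mult.commute)
  next
    case False
    then show ?thesis by (simp add: tvar_power mult.commute[of "iota _"] mps_coeff_mono_mult opt_le_iff)
  qed
  show "mps_coeff r c = mps_coeff (\<Sum>k<m. iota (slice k r) * tvar ^ k) c"
    using assms by (auto simp: * tdeg_lt_def not_less)
qed

lemma tdeg_lt_mult_iota:
  fixes r :: "'n::finite option mps"
  assumes "tdeg_lt m r"
  shows "tdeg_lt m (r * iota d)"
  unfolding tdeg_lt_def mps_coeff_mult
proof (intro allI impI sum.neutral ballI, clarify)
  fix c a b :: "'n option \<Rightarrow> nat"
  assume c: "m \<le> c None" "(a, b) \<in> splittings c"
  then have "a None + b None = c None" by (auto simp: splittings_def plus_fun_apply)
  then show "mps_coeff r a * mps_coeff (iota d) b = 0"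
    using c assms by (cases "b None = 0") (auto simp: tdeg_lt_def mps_coeff_iota)
qed

lemma convergent_slice:
  assumes "convergent_mps F"
  shows "convergent_mps (slice k F)"
proof -
  obtain r where r: "r > 0" "\<And>\<rho>. (\<And>i. 0 < \<rho> i \<and> \<rho> i < r) \<Longrightarrow> \<exists>M. majorized \<rho> F M"
    using convergent_majorized[OF assms] by blast
  define e where "e = r / 2"
  have e: "e > 0" using r by (simp add: e_def)
  obtain M where M: "majorized (\<lambda>_. e) F M" using r(2)[of "\<lambda>_. e"] r(1) by (auto simp: e_def)
  have mev: "mev (\<lambda>_. e) (opt a k) = mev (\<lambda>_. e) a * e ^ k" for a :: "'a \<Rightarrow> nat"
    by (simp add: mev_def UNIV_option_conv prod.reindex)
  have "majorized (\<lambda>_. e) (slice k F) (M / e ^ k)"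
    unfolding majorized_def
  proof (intro allI impI)
    fix A :: "('a \<Rightarrow> nat) set" assume A: "finite A"
    have "(\<Sum>a\<in>A. norm (mps_coeff (slice k F) a) * mev (\<lambda>_. e) a) * e ^ k =
        (\<Sum>c\<in>(\<lambda>a. opt a k) ` A. norm (mps_coeff F c) * mev (\<lambda>_. e) c)"
      by (subst sum.reindex) (auto simp: inj_on_def mev mps_coeff_slice sum_distrib_right mult.assoc)
    also have "\<dots> \<le> M" using A by (intro majorizedD[OF M]) auto
    finally show "(\<Sum>a\<in>A. norm (mps_coeff (slice k F) a) * mev (\<lambda>_. e) a) \<le> M / e ^ k"
      using e by (simp add: pos_le_divide_eq)
  qed
  then show ?thesis by (rule majorized_convergent) (rule e)
qed

text \<open>Evaluation at \<open>t = 0\<close>, a left inverse of \<open>iota\<close> and of every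
  shift; as a substitution it inherits the ring homomorphism laws.\<close>

definition rho0 :: "'n::finite option mps \<Rightarrow> 'n mps" where
  "rho0 = subst (\<lambda>j. case j of None \<Rightarrow> 0 | Some i \<Rightarrow> mps_var i)"

lemma rho0_ordge: "(case j of None \<Rightarrow> 0 | Some i \<Rightarrow> mps_var i) \<in> ordge 1"
  using mps_var_ordge by (cases j) (auto simp del: One_nat_def)

lemma rho0_mult [simp]: "rho0 (F * G) = rho0 F * rho0 G"
  and rho0_one [simp]: "rho0 1 = 1"
  and rho0_power [simp]: "rho0 (F ^ k) = rho0 F ^ k"
  and rho0_zero [simp]: "rho0 0 = 0"
  and rho0_add: "rho0 (F + G) = rho0 F + rho0 G"
  and rho0_sum: "rho0 (sum h I) = (\<Sum>i\<in>I. rho0 (h i))"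
  and rho0_tvar [simp]: "rho0 tvar = 0"
  and rho0_var: "rho0 (mps_var (Some i)) = mps_var i"
  and mps_coeff_rho0_0 [simp]: "mps_coeff (rho0 F) 0 = mps_coeff F 0"
  unfolding rho0_def by (simp_all add: subst_mult[OF rho0_ordge] subst_one[OF rho0_ordge]
      subst_power[OF rho0_ordge] subst_var[OF rho0_ordge] subst_add subst_sum mps_coeff_subst_0[OF rho0_ordge])

lemma rho0_iota [simp]: "rho0 (iota f) = f"
proof -
  define d where "d = (\<lambda>f :: 'a mps. rho0 (iota f) - f)"
  have add: "d (f + g) = d f + d g" for f g by (simp add: d_def iota_add rho0_add)
  have sc: "d (mps_scale z 1) = 0" for z
    by (simp add: d_def iota_scale rho0_def subst_scale subst_one[OF rho0_ordge])
  have v: "d (mps_var i * g) = mps_var i * d g" for i g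
    by (simp add: d_def iota_mult iota_var rho0_var algebra_simps)
  have "d f = 0"
  proof (rule vanishing_principle[of d mps_var])
    fix f
    have "d f = (\<Sum>i\<in>UNIV. mps_var i * d (part_mps i f))"
      by (subst mps_decompose[of f]) (simp add: add sc v module_hom_sumD(1)[of d, OF add])
    then show "\<exists>g. d f = (\<Sum>i\<in>UNIV. mps_var i * d (g i))" by (intro exI[of _ "\<lambda>i. part_mps i f"])
  qed (rule mps_var_ordge)
  then show ?thesis by (simp add: d_def)
qed

section \<open>Weierstrass division\<close>

text \<open>Regularity of order \<open>m\<close> in \<open>t\<close>: on the \<open>t\<close>-axis
  the series starts with the power \<open>m\<close>.\<close>

definition treg :: "'n::finite option mps \<Rightarrow> nat \<Rightarrow> bool" where
  "treg F m \<longleftrightarrow> (\<forall>k<m. mps_coeff F (opt 0 k) = 0) \<and> mps_coeff F (opt 0 m) \<noteq> 0"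

text \<open>With \<open>t\<close> of weight \<open>2\<close> and all other weights above \<open>2\<^sup>m\<close>, the leading monomial is \<open>t\<^sup>m\<close>.\<close>

lemma treg_weights:
  fixes F :: "'n::finite option mps"
  assumes "treg F m"
  obtains p :: "'n option \<Rightarrow> nat" where "weights p" "weights.lm p F = opt 0 m"
proof -
  obtain q :: "'n \<Rightarrow> nat" where q: "inj q" "\<And>i. prime (q i)" "\<And>i. q i > 2 ^ Suc m"
    using ex_primes_above[of "UNIV :: 'n set" "2 ^ Suc m"] by auto
  define p where "p = case_option 2 q"
  have q2: "q i > 2" for i
  proof -
    have "2 ^ 1 < q i" by (rule le_less_trans[OF _ q(3)]) (rule power_increasing, auto)
    then show ?thesis by (simp only: power_one_right)
  qed
  have p: "weights p"
  proof
    show "prime (p i)" for i using q by (cases i) (auto simp: p_def)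
    show "inj p"
      unfolding inj_on_def p_def
      using q(1) q2 by (auto split: option.splits dest: injD) (metis less_irrefl)+
  qed
  interpret weights p by (rule p)
  have wt: "wt (opt a k) = 2 ^ k * (\<Prod>i\<in>UNIV. q i ^ a i)" for a k
    unfolding wt_def UNIV_option_conv by (simp add: prod.reindex p_def)
  have "lm F = opt 0 m"
  proof (rule lm_eqI)
    show "mps_coeff F (opt 0 m) \<noteq> 0" using assms by (simp add: treg_def)
    fix c assume c: "mps_coeff F c \<noteq> 0"
    define a k where "a = c \<circ> Some" and "k = c None"
    have ck: "c = opt a k" using opt_surj[of c] by (simp add: a_def k_def)
    show "wt (opt 0 m) \<le> wt c"
    proof (cases "a = 0")
      case True
      then have "m \<le> k" using c assms by (auto simp: ck treg_def not_less intro: leI)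
      then show ?thesis by (simp add: ck True wt zero_fun_apply)
    next
      case False
      then obtain i where i: "a i \<noteq> 0" by (auto simp: fun_eq_iff zero_fun_apply)
      have "wt (opt 0 m) = 2 ^ m" by (simp add: wt zero_fun_apply)
      also have "\<dots> \<le> q i" using q(3)[of i] by simp
      also have "\<dots> \<le> q i ^ a i" using i q2[of i] by (intro self_le_power) auto
      also have "\<dots> \<le> (\<Prod>i\<in>UNIV. q i ^ a i)"
        using q2 by (intro dvd_imp_le dvd_prodI prod_pos) (auto intro: less_trans[of 0 2])
      also have "\<dots> \<le> wt c" by (simp add: ck wt)
      finally show ?thesis .
    qed
  qed
  with p show ?thesis by (rule that)
qed

lemma treg_nonzero: "treg F m \<Longrightarrow> F \<noteq> 0"
  by (auto simp: treg_def)

text \<open>With leading index \<open>opt 0 m\<close>, the indices above it are exactly those with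
  \<open>t\<close>-exponent at least \<open>m\<close>, so the general division becomes Weierstrass
  division.\<close>

lemma weierstrass_division:
  assumes "treg F m"
  obtains q where "tdeg_lt m (G - q * F)"
proof -
  obtain p where p: "weights p" "weights.lm p F = opt 0 m" using treg_weights[OF assms] .
  interpret weights p by (rule p(1))
  show ?thesis
    using division_ex[OF treg_nonzero[OF assms], of G] that by (auto simp: p(2) opt_le_iff tdeg_lt_def)
qed

lemma weierstrass_division_unique:
  assumes "treg F m" "tdeg_lt m (q * F)"
  shows "q = 0"
proof -
  obtain p where p: "weights p" "weights.lm p F = opt 0 m" using treg_weights[OF assms(1)] .
  interpret weights p by (rule p(1))
  show ?thesis
    using division_unique[OF treg_nonzero[OF assms(1)], of q] assms(2) by (auto simp: p(2) opt_le_iff tdeg_lt_def)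
qed

lemma weierstrass_division_convergent:
  assumes "treg F m" "tdeg_lt m (G - q * F)" "convergent_mps F" "convergent_mps G"
  shows "convergent_mps q"
proof -
  obtain p where p: "weights p" "weights.lm p F = opt 0 m" using treg_weights[OF assms(1)] .
  interpret weights p by (rule p(1))
  show ?thesis
    using convergent_quotient[OF treg_nonzero[OF assms(1)] assms(3,4), of q] assms(2)
    by (auto simp: p(2) opt_le_iff tdeg_lt_def)
qed

section \<open>Monic factors over completely integrally closed domains\<close>

abbreviation to_closure :: "'a::idom \<Rightarrow> 'a fract alg_closure" where
  "to_closure a \<equiv> to_ac (to_fract a)"

abbreviation closure_scale :: "'a::idom \<Rightarrow> 'a fract alg_closure \<Rightarrow> 'a fract alg_closure" where
  "closure_scale a x \<equiv> to_closure a * x"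

lemma module_closure: "Modules.module (closure_scale :: 'a::idom \<Rightarrow> _)"
  by standard (simp_all add: algebra_simps)

text \<open>
  A finitely generated module that is stable under multiplication by given integral elements is
  generated by monomials in them of bounded degree.
\<close>

lemma stable_lattice:
  fixes P :: "'a::idom poly" and R :: "'a fract alg_closure set"
  assumes monic: "lead_coeff P = 1"
    and "finite R" "\<And>x. x \<in> R \<Longrightarrow> poly (map_poly to_closure P) x = 0"
  shows "\<exists>T. finite T \<and> 1 \<in> module.span closure_scale T \<and>
    (\<forall>x\<in>R. \<forall>y\<in>module.span closure_scale T. x * y \<in> module.span closure_scale T)"
  using assms(2,3)
proof (induction R rule: finite_induct)
  case empty
  interpret M: Modules.module "closure_scale :: 'a \<Rightarrow> _" by (rule module_closure)
  show ?case by (intro exI[of _ "{1}"]) (auto intro: M.span_base)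
next
  case (insert x R)
  interpret M: Modules.module "closure_scale :: 'a \<Rightarrow> _" by (rule module_closure)
  obtain T where T: "finite T" "1 \<in> M.span T" "\<And>x y. x \<in> R \<Longrightarrow> y \<in> M.span T \<Longrightarrow> x * y \<in> M.span T"
    using insert by auto
  define m where "m = degree P"
  have root: "poly (map_poly to_closure P) x = 0" using insert by auto
  have deg: "degree (map_poly to_closure P) = m"
    unfolding m_def by (rule degree_map_poly) simp
  have "poly (map_poly to_closure P) x = (\<Sum>i\<le>m. to_closure (coeff P i) * x ^ i)"
    unfolding poly_altdef deg by (simp add: coeff_map_poly)
  also have "\<dots> = (\<Sum>i<m. to_closure (coeff P i) * x ^ i) + x ^ m"
    using monic by (simp add: m_def flip: lessThan_Suc_atMost)
  finally have "x ^ m = - (\<Sum>i<m. to_closure (coeff P i) * x ^ i)"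
    using root by (simp add: add_eq_0_iff)
  then have xm: "x ^ m = (\<Sum>i<m. closure_scale (- coeff P i) (x ^ i))"
    by (simp add: sum_negf)
  have m: "m > 0"
  proof (rule ccontr)
    assume "\<not> m > 0"
    then have "x ^ m = 1" "(\<Sum>i<m. closure_scale (- coeff P i) (x ^ i)) = 0" by auto
    with xm show False by simp
  qed
  define T' where "T' = (\<lambda>(y, i). y * x ^ i) ` (T \<times> {..<m})"
  have gen: "y * x ^ i \<in> M.span T'" if "y \<in> M.span T" "i < m" for y i
  proof -
    have "M.span T \<subseteq> {y. y * x ^ i \<in> M.span T'}"
    proof (rule M.span_minimal)
      show "T \<subseteq> {y. y * x ^ i \<in> M.span T'}"
        using that(2) by (auto intro!: M.span_base simp: T'_def)
      show "M.subspace {y. y * x ^ i \<in> M.span T'}"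
        unfolding M.subspace_def using M.span_add M.span_scale M.span_zero
        by (auto simp: distrib_right mult.assoc)
    qed
    with that show ?thesis by blast
  qed
  \<comment> \<open>Multiplication by \<open>x\<close> can raise the exponent \<open>m - 1\<close>
    to \<open>m\<close>; that power is rewritten by the monic equation.\<close>
  have gen': "y * x ^ i \<in> M.span T'" if "y \<in> M.span T" "i \<le> m" for y i
  proof (cases "i < m")
    case False
    then have i: "i = m" using that by simp
    have "y * x ^ m = (\<Sum>i<m. closure_scale (- coeff P i) (y * x ^ i))"
      unfolding xm sum_distrib_left by (simp only: mult_ac)
    also have "\<dots> \<in> M.span T'" using gen[OF that(1)] by (intro M.span_sum M.span_scale) auto
    finally show ?thesis by (simp add: i)
  qed (use gen that in auto)
  have stab: "z * y \<in> M.span T'" if z: "z = x \<or> z \<in> R" and y: "y \<in> M.span T'" for z y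
  proof -
    have "M.span T' \<subseteq> {y. z * y \<in> M.span T'}"
    proof (rule M.span_minimal)
      show "T' \<subseteq> {y. z * y \<in> M.span T'}"
      proof clarify
        fix w assume "w \<in> T'"
        then obtain y i where w: "w = y * x ^ i" "y \<in> T" "i < m" by (auto simp: T'_def)
        have y: "y \<in> M.span T" using w by (simp add: M.span_base)
        show "z * w \<in> M.span T'"
        proof (cases "z = x")
          case True
          then have zw: "z * w = y * x ^ Suc i" by (simp add: w)
          show ?thesis unfolding zw using w(3) by (intro gen'[OF y]) simp
        next
          case False
          then have "z * y \<in> M.span T" using z T(3)[OF _ y] by blast
          from gen[OF this w(3)] show ?thesis by (simp add: w mult.assoc)
        qed
      qed
      show "M.subspace {y. z * y \<in> M.span T'}"
      proof -
        have "z * closure_scale c y \<in> M.span T'" if "z * y \<in> M.span T'" for c y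
          using M.span_scale[OF that, of c] by (simp only: mult.left_commute)
        then show ?thesis
          unfolding M.subspace_def using M.span_add M.span_zero by (auto simp: distrib_left)
      qed
    qed
    with y show ?thesis by blast
  qed
  have "finite T'" unfolding T'_def using T by auto
  moreover have "1 \<in> M.span T'" using gen[OF T(2) m] by simp
  ultimately show ?case using stab by (intro exI[of _ T']) auto
qed

text \<open>A linear retraction of the algebraic closure onto the field. It brings a finite
  generating set found in the closure down to finitely many fractions, which have a common
  denominator.\<close>

lemma closure_functional:
  "\<exists>l :: 'k::field alg_closure \<Rightarrow> 'k. (\<forall>x y. l (x + y) = l x + l y) \<and> (\<forall>k x. l (to_ac k * x) = k * l x) \<and> l 1 = 1"
proof -
  interpret vector_space_pair "\<lambda>(k :: 'k) x. to_ac k * x" "(*) :: 'k \<Rightarrow> 'k \<Rightarrow> 'k"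
    by unfold_locales (simp_all add: algebra_simps)
  have "vs1.independent {1}" by simp
  from linear_independent_extend[OF this, of "\<lambda>_. 1"] obtain l
    where l: "Vector_Spaces.linear (\<lambda>(k :: 'k) x. to_ac k * x) (*) l" "l 1 = 1" by auto
  interpret l: Vector_Spaces.linear "\<lambda>(k :: 'k) x. to_ac k * x" "(*)" l by (rule l(1))
  show ?thesis using l(2) l.add l.scale by blast
qed

lemma common_denominator:
  fixes S :: "'a::idom fract set"
  assumes "finite S"
  shows "\<exists>e. e \<noteq> 0 \<and> (\<forall>x\<in>S. to_fract e * x \<in> range to_fract)"
  using assms
proof (induction S rule: finite_induct)
  case empty
  show ?case by (intro exI[of _ 1]) auto
next
  case (insert x S)
  then obtain e where e: "e \<noteq> 0" "\<And>x. x \<in> S \<Longrightarrow> to_fract e * x \<in> range to_fract" by auto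
  obtain a b where x: "x = Fract a b" "b \<noteq> 0" by (cases x) auto
  have "to_fract (e * b) * y \<in> range to_fract" if "y \<in> insert x S" for y
  proof (cases "y = x")
    case True
    have "to_fract (e * b) * y = to_fract (e * a)"
      using x by (simp add: True Fract_conv_to_fract)
    then show ?thesis by (rule range_eqI)
  next
    case False
    with that obtain c where c: "to_fract e * y = to_fract c" using e by blast
    have "to_fract (e * b) * y = to_fract b * (to_fract e * y)" by simp
    also have "\<dots> = to_fract (b * c)" unfolding c by simp
    finally show ?thesis by (rule range_eqI)
  qed
  then show ?case using e x by (intro exI[of _ "e * b"]) auto
qed

text \<open>A retraction \<open>l\<close> writes each \<open>c ^ k\<close> as a combination, with
  coefficients in the ring, of the finitely many values \<open>l t\<close>. Their common denominator
  \<open>e\<close> serves all \<open>k\<close> at once, and for \<open>c = a / b\<close> this reads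
  \<open>b ^ k dvd e * a ^ k\<close>.\<close>

lemma power_bounded_imp_integral:
  fixes c :: "'a::idom fract" and T :: "'a fract alg_closure set"
  assumes cic: "completely_integrally_closed TYPE('a)" and T: "finite T"
    and c: "\<And>k. to_ac c ^ k \<in> module.span closure_scale T"
  shows "c \<in> range to_fract"
proof -
  interpret M: Modules.module "closure_scale :: 'a \<Rightarrow> _" by (rule module_closure)
  obtain l :: "'a fract alg_closure \<Rightarrow> 'a fract" where l: "\<And>x y. l (x + y) = l x + l y"
    "\<And>k x. l (to_ac k * x) = k * l x" "l 1 = 1" using closure_functional by blast
  have lsum: "l (sum h A) = (\<Sum>i\<in>A. l (h i))" for h and A :: "'a fract alg_closure set"
    by (rule module_hom_sumD) (rule l(1))
  obtain e where e: "e \<noteq> 0" "\<And>t. t \<in> T \<Longrightarrow> to_fract e * l t \<in> range to_fract"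
    using common_denominator[of "l ` T"] T by auto
  obtain a b where ab: "c = Fract a b" "b \<noteq> 0" by (cases c) auto
  have "b ^ k dvd e * a ^ k" for k
  proof -
    obtain u where u: "to_ac c ^ k = (\<Sum>t\<in>T. closure_scale (u t) t)"
      using c[of k] unfolding M.span_finite[OF T] by auto
    have "l (to_ac (c ^ k) * 1) = c ^ k * l 1" by (rule l(2))
    then have "l (to_ac c ^ k) = c ^ k" by (simp add: l(3))
    then have ck: "c ^ k = (\<Sum>t\<in>T. to_fract (u t) * l t)" by (simp add: u lsum l(2))
    have "\<exists>v. \<forall>t\<in>T. to_fract e * l t = to_fract (v t)" using e(2) by (intro bchoice) blast
    then obtain v where v: "\<And>t. t \<in> T \<Longrightarrow> to_fract e * l t = to_fract (v t)" by blast
    have "to_fract e * c ^ k = (\<Sum>t\<in>T. to_fract (u t) * (to_fract e * l t))"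
      by (simp add: ck sum_distrib_left mult_ac)
    also have "\<dots> = (\<Sum>t\<in>T. to_fract (u t * v t))" by (rule sum.cong) (auto simp: v)
    also have "\<dots> = to_fract (\<Sum>t\<in>T. u t * v t)"
      by (rule module_hom_sumD(1)[of to_fract, symmetric]) simp
    finally have "to_fract e * c ^ k = to_fract (\<Sum>t\<in>T. u t * v t)" .
    moreover have pw: "to_fract x ^ k = to_fract (x ^ k)" for x :: 'a by (induction k) auto
    moreover have "c = to_fract a / to_fract b" by (simp add: ab Fract_conv_to_fract)
    ultimately have "to_fract e * to_fract (a ^ k) = to_fract (\<Sum>t\<in>T. u t * v t) * to_fract (b ^ k)"
      using ab(2) by (simp add: power_divide pw field_simps del: to_fract_mult)
    then have "e * a ^ k = (\<Sum>t\<in>T. u t * v t) * b ^ k"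
      by (simp only: to_fract_mult[symmetric] to_fract_eq_iff)
    then show ?thesis by simp
  qed
  with cic e(1) ab(2) have "b dvd a" unfolding completely_integrally_closed_def by blast
  then obtain q where "a = b * q" by blast
  then have "c = to_fract q" using ab by (simp add: Fract_conv_to_fract)
  then show ?thesis by simp
qed

text \<open>A form of Gauss's lemma. The roots of \<open>H\<close> are roots of \<open>P\<close>, so
  they multiply a finitely generated module into itself. The set \<open>E\<close> of all such
  multipliers is a ring, hence contains the coefficients of \<open>H\<close> and their powers; as
  the module contains \<open>1\<close>, these powers stay in it.\<close>

lemma monic_factor_integral:
  fixes P :: "'a::idom poly" and H :: "'a fract poly"
  assumes cic: "completely_integrally_closed TYPE('a)"
    and P: "lead_coeff P = 1" and H: "lead_coeff H = 1" and dvd: "H dvd fract_poly P"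
  obtains G where "H = fract_poly G"
proof -
  interpret M: Modules.module "closure_scale :: 'a \<Rightarrow> _" by (rule module_closure)
  define H' where "H' = map_poly to_ac H"
  have H0: "H \<noteq> 0" using H by auto
  have lcH': "lead_coeff H' = 1" unfolding H'_def using H by (subst degree_map_poly) (auto simp: coeff_map_poly)
  then have "H' \<noteq> 0" by auto
  then obtain R where R: "H' = (\<Prod>x\<in>#R. [:-x, 1:])"
    using alg_closed_imp_factorization[of H'] lcH' by auto
  have to_ac_poly_mult: "map_poly to_ac (p * q) = map_poly to_ac p * map_poly to_ac q" for p q :: "'a fract poly"
    by (intro poly_eqI) (simp add: coeff_mult coeff_map_poly to_ac_sum)
  have root: "poly (map_poly to_closure P) x = 0" if x: "x \<in># R" for x
  proof -
    obtain q where "fract_poly P = H * q" using dvd by blast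
    then have "map_poly to_ac (fract_poly P) = H' * map_poly to_ac q"
      by (simp add: to_ac_poly_mult H'_def)
    moreover have "map_poly to_ac (fract_poly P) = map_poly to_closure P"
      by (intro poly_eqI) (simp add: coeff_map_poly)
    moreover have "poly H' x = 0" unfolding R using x by (auto simp: poly_prod_mset prod_mset_zero_iff)
    ultimately show ?thesis by simp
  qed
  obtain T where T: "finite T" "1 \<in> M.span T" "\<And>x y. x \<in># R \<Longrightarrow> y \<in> M.span T \<Longrightarrow> x * y \<in> M.span T"
    using stable_lattice[OF P, of "set_mset R"] root by auto
  define E where "E = {x. \<forall>y\<in>M.span T. x * y \<in> M.span T}"
  have E: "0 \<in> E" "1 \<in> E" "\<And>x y. x \<in> E \<Longrightarrow> y \<in> E \<Longrightarrow> x + y \<in> E" "\<And>x y. x \<in> E \<Longrightarrow> y \<in> E \<Longrightarrow> x * y \<in> E"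
    "\<And>x. x \<in> E \<Longrightarrow> - x \<in> E" "\<And>x. x \<in># R \<Longrightarrow> x \<in> E"
    using T(3) by (auto simp: E_def M.span_zero M.span_add M.span_neg distrib_right mult.assoc)
  have coeffs: "coeff (\<Prod>x\<in>#S. [:-x, 1:]) i \<in> E" if "S \<subseteq># R" for S i
    using that
  proof (induction S arbitrary: i)
    case (add x S)
    have IH: "coeff (\<Prod>x\<in>#S. [:-x, 1:]) i \<in> E" for i
    proof (rule add.IH)
      show "S \<subseteq># R" by (rule subset_mset.order_trans[OF _ add.prems]) simp
    qed
    have x: "x \<in> E" using add.prems by (intro E(6)) (simp add: insert_subset_eq_iff)
    have "- (x * coeff (\<Prod>x\<in>#S. [:-x, 1:]) i) \<in> E" by (intro E x IH)
    moreover have "coeff (pCons 0 (\<Prod>x\<in>#S. [:-x, 1:])) i \<in> E"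
      using IH E(1) by (cases i) auto
    ultimately have "- (x * coeff (\<Prod>x\<in>#S. [:-x, 1:]) i) + coeff (pCons 0 (\<Prod>x\<in>#S. [:-x, 1:])) i \<in> E"
      by (rule E)
    then show ?case by simp
  qed (auto simp: E coeff_1)
  have "coeff H i \<in> range to_fract" for i
  proof (rule power_bounded_imp_integral[OF cic T(1)])
    fix k
    have "to_ac (coeff H i) = coeff H' i" by (simp add: H'_def coeff_map_poly)
    also have "\<dots> \<in> E" using coeffs[of R i] by (simp add: R)
    finally have "to_ac (coeff H i) \<in> E" .
    then have "to_ac (coeff H i) ^ k \<in> E" by (induction k) (auto intro: E)
    then show "to_ac (coeff H i) ^ k \<in> M.span T" using T(2) unfolding E_def by force
  qed
  then have "\<forall>i. \<exists>g. coeff H i = to_fract g" by blast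
  then obtain g where g: "\<And>i. coeff H i = to_fract (g i)" by metis
  define G where "G = Poly (map g [0..<Suc (degree H)])"
  have "H = fract_poly G"
  proof (rule poly_eqI)
    fix i
    have "g i = 0" if "i > degree H" using g[of i] that by (simp add: coeff_eq_0)
    then show "coeff H i = coeff (fract_poly G) i"
      by (auto simp: G_def coeff_map_poly coeff_Poly_eq nth_default_def g simp del: upt_Suc)
  qed
  then show ?thesis by (rule that)
qed

text \<open>A nonzero combination of least degree divides every combination, because the remainder
  is again a combination.\<close>

lemma field_poly_bezout:
  fixes p q :: "'k::field poly"
  assumes "p \<noteq> 0 \<or> q \<noteq> 0"
  obtains a b where "a * p + b * q \<noteq> 0" "a * p + b * q dvd p" "a * p + b * q dvd q"
proof -
  define I where "I = {d. d \<noteq> 0 \<and> (\<exists>a b. d = a * p + b * q)}"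
  have "\<exists>d. d \<in> I"
  proof (cases "p = 0")
    case True
    then have "q = 0 * p + 1 * q" "q \<noteq> 0" using assms by auto
    then show ?thesis unfolding I_def by blast
  next
    case False
    have "p = 1 * p + 0 * q" by simp
    then show ?thesis using False unfolding I_def by blast
  qed
  then obtain d where d: "d \<in> I" "\<And>d'. d' \<in> I \<Longrightarrow> degree d \<le> degree d'"
    using arg_min_nat_lemma[of "\<lambda>d. d \<in> I" _ degree] by metis
  obtain a b where ab: "d = a * p + b * q" "d \<noteq> 0" using d by (auto simp: I_def)
  have dvd: "d dvd u * p + v * q" for u v
  proof (rule ccontr)
    assume "\<not> d dvd u * p + v * q"
    then have nz: "(u * p + v * q) mod d \<noteq> 0" by (simp add: mod_eq_0_iff_dvd)
    define z where "z = (u * p + v * q) div d"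
    have "(u * p + v * q) mod d = (u * p + v * q) - z * d"
      by (simp add: z_def minus_div_mult_eq_mod)
    also have "\<dots> = (u - z * a) * p + (v - z * b) * q"
      by (simp add: ab(1) algebra_simps)
    finally have "(u * p + v * q) mod d \<in> I" using nz unfolding I_def by blast
    then have "degree d \<le> degree ((u * p + v * q) mod d)" by (rule d)
    moreover have "degree ((u * p + v * q) mod d) < degree d" using degree_mod_less[OF ab(2)] nz by blast
    ultimately show False by simp
  qed
  show ?thesis
    using dvd[of 1 0] dvd[of 0 1] ab by (intro that[of a b]) auto
qed

text \<open>
  Over the fraction field, either the derivative is coprime to \<open>p\<close> or a common factor of minimal
  degree divides \<open>p\<close> twice.
\<close>

lemma square_factor_or_discriminant:
  fixes p :: "'a::{idom, ring_char_0} poly"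
  assumes cic: "completely_integrally_closed TYPE('a)" and p: "lead_coeff p = 1"
  shows "(\<exists>g. lead_coeff g = 1 \<and> degree g > 0 \<and> g ^ 2 dvd p) \<or>
    (\<exists>d a b. d \<noteq> 0 \<and> [:d:] = a * p + b * pderiv p)"
proof -
  define P where "P = fract_poly p"
  have P: "P \<noteq> 0" using p by (auto simp: P_def)
  have lcP: "lead_coeff P = 1"
    unfolding P_def using p by (subst degree_map_poly) (auto simp: coeff_map_poly)
  have dP: "fract_poly (pderiv p) = pderiv P"
  proof (rule poly_eqI)
    fix n
    have "to_fract (of_nat k :: 'a) = of_nat k" for k by (induction k) auto
    then show "coeff (fract_poly (pderiv p)) n = coeff (pderiv P) n"
      by (simp add: P_def coeff_map_poly coeff_pderiv del: of_nat_Suc)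
  qed
  define S where "S = {g. degree g > 0 \<and> g dvd P \<and> g dvd pderiv P}"
  show ?thesis
  proof (cases "S = {}")
    case True
    obtain a b where ab: "a * P + b * pderiv P \<noteq> 0" "a * P + b * pderiv P dvd P" "a * P + b * pderiv P dvd pderiv P"
      using field_poly_bezout[of P "pderiv P"] P by blast
    have "degree (a * P + b * pderiv P) = 0"
    proof (rule ccontr)
      assume "degree (a * P + b * pderiv P) \<noteq> 0"
      then have "a * P + b * pderiv P \<in> S" using ab(2,3) by (simp add: S_def)
      with True show False by simp
    qed
    then obtain c where c: "a * P + b * pderiv P = [:c:]" by (metis degree_eq_zeroE)
    define C where "C = {c} \<union> coeff a ` {..degree a} \<union> coeff b ` {..degree b}"
    have "finite C" by (simp add: C_def)
    from common_denominator[OF this]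
    obtain e where e0: "e \<noteq> 0" and eC: "\<forall>x\<in>C. to_fract e * x \<in> range to_fract" by (elim exE conjE)
    note e = e0 bspec[OF eC]
    have clear: "\<exists>A. smult (to_fract e) q = fract_poly A"
      if q: "\<And>i. i \<le> degree q \<Longrightarrow> to_fract e * coeff q i \<in> range to_fract" for q
    proof -
      have "to_fract e * coeff q i \<in> range to_fract" for i
      proof (cases "i \<le> degree q")
        case False
        then have "to_fract e * coeff q i = to_fract 0" by (simp add: coeff_eq_0)
        then show ?thesis by blast
      qed (rule q)
      then have "\<forall>i. \<exists>g. to_fract e * coeff q i = to_fract g" by blast
      then obtain g where g: "\<And>i. to_fract e * coeff q i = to_fract (g i)" by metis
      define A where "A = Poly (map g [0..<Suc (degree q)])"
      have "smult (to_fract e) q = fract_poly A"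
      proof (rule poly_eqI)
        fix i
        have "g i = 0" if "i > degree q" using g[of i] that by (simp add: coeff_eq_0)
        then show "coeff (smult (to_fract e) q) i = coeff (fract_poly A) i"
          by (auto simp: A_def coeff_map_poly coeff_Poly_eq nth_default_def g simp del: upt_Suc)
      qed
      then show ?thesis by blast
    qed
    obtain A where A: "smult (to_fract e) a = fract_poly A" using clear[of a] e(2) by (auto simp: C_def)
    obtain B where B: "smult (to_fract e) b = fract_poly B" using clear[of b] e(2) by (auto simp: C_def)
    obtain d where d: "to_fract e * c = to_fract d" using e(2)[of c] by (auto simp: C_def)
    have "fract_poly (A * p + B * pderiv p) = smult (to_fract e) (a * P + b * pderiv P)"
      by (simp add: A[symmetric] B[symmetric] dP smult_add_right flip: P_def)
    also have "\<dots> = [:to_fract d:]" by (simp add: c d)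
    also have "\<dots> = fract_poly [:d:]" by (simp add: map_poly_pCons)
    finally have "[:d:] = A * p + B * pderiv p" by (simp only: fract_poly_eq_iff)
    moreover have "d \<noteq> 0" using d e ab(1) c by auto
    ultimately show ?thesis by blast
  next
    case False
    then obtain g where g: "g \<in> S" "\<And>g'. g' \<in> S \<Longrightarrow> degree g \<le> degree g'"
      using arg_min_nat_lemma[of "\<lambda>d. d \<in> S" _ degree] by (metis ex_in_conv)
    have g0: "g \<noteq> 0" "degree g > 0" using g(1) by (auto simp: S_def)
    have charK: "of_nat k \<noteq> (0 :: 'a fract)" if "k > 0" for k
    proof -
      have "(of_nat k :: 'a fract) = to_fract (of_nat k)" by (induction k) auto
      then show ?thesis using that by simp
    qed
    have g': "pderiv g \<noteq> 0"
    proof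
      assume "pderiv g = 0"
      then have "coeff (pderiv g) (degree g - 1) = 0" by simp
      then have "of_nat (degree g) * lead_coeff g = 0" using g0(2) by (simp add: coeff_pderiv)
      with charK[OF g0(2)] g0(1) show False by simp
    qed
    obtain Q where Q: "P = g * Q" using g(1) by (auto simp: S_def)
    obtain a b where ab: "a * g + b * pderiv g \<noteq> 0" "a * g + b * pderiv g dvd g" "a * g + b * pderiv g dvd pderiv g"
      using field_poly_bezout[of g "pderiv g"] g0 by blast
    \<comment> \<open>Minimality makes \<open>g\<close> coprime to its own derivative: a common
      factor of positive degree would again be in \<open>S\<close>, with degree at most
      \<open>degree g - 1\<close>.\<close>
    have "degree (a * g + b * pderiv g) = 0"
    proof (rule ccontr)
      assume *: "degree (a * g + b * pderiv g) \<noteq> 0"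
      have "a * g + b * pderiv g dvd P" "a * g + b * pderiv g dvd pderiv P"
        using ab(2) g(1) by (auto simp: S_def intro: dvd_trans)
      with * have "degree g \<le> degree (a * g + b * pderiv g)" by (intro g(2)) (simp add: S_def)
      also have "\<dots> \<le> degree (pderiv g)" using ab(3) g' by (rule dvd_imp_degree_le)
      also have "\<dots> \<le> degree g - 1" by (rule degree_le) (auto simp: coeff_pderiv coeff_eq_0)
      finally show False using g0 by simp
    qed
    then obtain c where c: "a * g + b * pderiv g = [:c:]" by (metis degree_eq_zeroE)
    then have c0: "c \<noteq> 0" using ab(1) by auto
    \<comment> \<open>With \<open>P = g * Q\<close> the product rule leaves
      \<open>g dvd Q * pderiv g\<close>; coprimality cancels \<open>pderiv g\<close>, so
      \<open>g\<close> divides \<open>Q\<close> and \<open>P\<close> contains the square of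
      \<open>g\<close>.\<close>
    have "g dvd pderiv P" using g(1) by (simp add: S_def)
    then have "g dvd g * pderiv Q + Q * pderiv g" by (simp only: Q pderiv_mult)
    then have "g dvd Q * pderiv g" by (simp only: dvd_add_right_iff[OF dvd_triv_left])
    then have "g dvd pderiv g * Q" by (simp only: mult.commute)
    then have "g dvd b * (pderiv g * Q)" by (rule dvd_mult)
    moreover have "g dvd a * g * Q" by simp
    ultimately have "g dvd a * g * Q + b * (pderiv g * Q)" by (intro dvd_add)
    also have "a * g * Q + b * (pderiv g * Q) = smult c Q"
      using arg_cong[OF c, of "\<lambda>r. r * Q"] by (simp add: algebra_simps)
    finally have "g dvd Q" using c0 by (simp add: dvd_smult_iff)
    then obtain h where h: "P = g * (g * h)" using Q by blast
    define z where "z = lead_coeff g"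
    have z: "z \<noteq> 0" using g0 by (simp add: z_def)
    \<comment> \<open>The leading coefficient is moved to the cofactor so that both factors are
      monic, as \<open>monic_factor_integral\<close> demands.\<close>
    define g1 where "g1 = smult (inverse z) g"
    define h1 where "h1 = smult (z * z) h"
    have zz: "z * (z * (inverse z * inverse z)) = 1" using z by (simp add: field_simps)
    have P1: "P = g1 ^ 2 * h1"
      by (simp add: h g1_def h1_def power2_eq_square zz mult.assoc)
    have lg: "lead_coeff g1 = 1" "degree g1 > 0" using g0 z by (auto simp: g1_def z_def)
    have lh: "lead_coeff h1 = 1"
      using lcP lg by (simp add: P1 lead_coeff_mult lead_coeff_power)
    obtain G where G: "g1 = fract_poly G"
      using monic_factor_integral[OF cic p lg(1)] by (metis P1 P_def dvd_mult2 dvd_triv_left power2_eq_square)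
    obtain H where H: "h1 = fract_poly H"
      using monic_factor_integral[OF cic p lh] P1 by (metis P_def dvd_triv_right)
    have "fract_poly p = fract_poly (G ^ 2 * H)"
      using P1 by (simp add: P_def G H power2_eq_square)
    then have "p = G ^ 2 * H" by (simp only: fract_poly_eq_iff)
    then have "G ^ 2 dvd p" by simp
    moreover have "degree G = degree g1" unfolding G by (rule degree_map_poly[symmetric]) simp
    moreover from this have "to_fract (lead_coeff G) = lead_coeff g1" by (simp add: G coeff_map_poly)
    then have "lead_coeff G = 1" using lg by (metis to_fract_1 to_fract_eq_iff)
    ultimately show ?thesis using lg(2) by (intro disjI1 exI[of _ G]) auto
  qed
qed

lemma mps_coeff_of_nat: "mps_coeff (of_nat k) 0 = of_nat k"
  by (induction k) (auto simp: mps_coeff_one)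

instance mps :: (finite) ring_char_0
proof
  show "inj (of_nat :: nat \<Rightarrow> 'a mps)"
    by (rule injI) (metis mps_coeff_of_nat of_nat_eq_iff)
qed

instance cps :: (finite) ring_char_0
proof
  show "inj (of_nat :: nat \<Rightarrow> 'a cps)"
    by (rule injI) (metis to_formal_of_nat of_nat_eq_iff)
qed

section \<open>Generic shifts and Weierstrass preparation\<close>

definition shift_vars :: "('n::finite \<Rightarrow> complex) \<Rightarrow> 'n \<Rightarrow> 'n option mps" where
  "shift_vars z i = mps_var (Some i) + mps_scale (z i) tvar"

abbreviation shift :: "('n::finite \<Rightarrow> complex) \<Rightarrow> 'n mps \<Rightarrow> 'n option mps" where
  "shift z \<equiv> subst (shift_vars z)"

text \<open>Restriction to the \<open>t\<close>-axis; its subdegree, when it is nonzero, is the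
  order of regularity in \<open>t\<close>.\<close>

definition tail :: "'n::finite option mps \<Rightarrow> complex fps" where
  "tail F = Abs_fps (\<lambda>k. mps_coeff F (opt 0 k))"

lemma tail_nth [simp]: "fps_nth (tail F) k = mps_coeff F (opt 0 k)"
  by (simp add: tail_def)

lemma treg_subdegree: "tail F \<noteq> 0 \<Longrightarrow> treg F (subdegree (tail F))"
  unfolding treg_def tail_nth[symmetric] by (auto simp del: tail_nth dest: nth_less_subdegree_zero)

lemma tail_add: "tail (F + G) = tail F + tail G"
  and tail_scale: "tail (mps_scale z F) = fps_const z * tail F"
  by (simp_all add: fps_eq_iff)

lemma tail_one [simp]: "tail 1 = 1"
proof -
  have "opt (0 :: 'a \<Rightarrow> nat) k = 0 \<longleftrightarrow> k = 0" for k by (metis opt_0 opt_inj)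
  then show ?thesis by (simp add: fps_eq_iff mps_coeff_one fps_one_nth)
qed

lemma tail_mult: "tail (F * G) = tail F * tail G"
proof (rule fps_ext)
  fix k
  have "mps_coeff (F * G) (opt 0 k) = (\<Sum>i=0..k. mps_coeff F (opt 0 i) * mps_coeff G (opt 0 (k - i)))"
    unfolding mps_coeff_mult
  proof (rule sum.reindex_bij_witness[where j = "\<lambda>(a, b). a None" and i = "\<lambda>i. (opt 0 i, opt 0 (k - i))"])
    fix x assume x: "x \<in> splittings (opt (0 :: 'a \<Rightarrow> nat) k)"
    obtain a b where ab: "x = (a, b)" by (cases x)
    have s: "a + b = opt 0 k" using x by (simp add: ab splittings_def)
    have S: "a (Some i) = 0 \<and> b (Some i) = 0" for i
      using fun_cong[OF s, of "Some i"] by (simp add: plus_fun_apply zero_fun_apply)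
    have N: "a None + b None = k" using fun_cong[OF s, of None] by (simp add: plus_fun_apply)
    have "a \<circ> Some = 0" "b \<circ> Some = 0" using S by (auto simp: fun_eq_iff zero_fun_apply)
    then have a: "opt 0 (a None) = a" and b: "opt 0 (b None) = b" using opt_surj[of a] opt_surj[of b] by simp_all
    have b': "k - a None = b None" using N by simp
    show "(opt 0 (case x of (a, b) \<Rightarrow> a None), opt 0 (k - (case x of (a, b) \<Rightarrow> a None))) = x"
      by (simp add: ab a b b')
    show "(case x of (a, b) \<Rightarrow> a None) \<in> {0..k}" using N by (simp add: ab)
    show "mps_coeff F (opt 0 (case x of (a, b) \<Rightarrow> a None)) * mps_coeff G (opt 0 (k - (case x of (a, b) \<Rightarrow> a None))) =
        (case x of (a, b) \<Rightarrow> mps_coeff F a * mps_coeff G b)"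
      by (simp add: ab a b b')
  qed (auto simp: splittings_def opt_add)
  then show "fps_nth (tail (F * G)) k = fps_nth (tail F * tail G) k"
    by (simp add: fps_mult_nth)
qed

lemma tail_power: "tail (F ^ k) = tail F ^ k"
  by (induction k) (auto simp: tail_mult)

lemma tail_prod: "tail (prod h I) = (\<Prod>i\<in>I. tail (h i))"
  by (induction I rule: infinite_finite_induct) (auto simp: tail_mult)

lemma tail_tvar: "tail tvar = fps_X"
proof (rule fps_ext)
  fix k
  have "tvar = (mono_mps (opt 0 1) :: 'a option mps)" using tvar_power[of 1] by simp
  then show "fps_nth (tail (tvar :: 'a option mps)) k = fps_nth fps_X k"
    by (simp add: mps_coeff_mono fps_X_nth)
qed

lemma tail_var_Some: "tail (mps_var (Some i)) = 0"
proof (rule fps_ext)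
  fix k
  have "opt 0 k \<noteq> unit_idx (Some i)"
    by (auto simp: opt_def unit_idx_def fun_eq_iff zero_fun_apply dest: spec[of _ "Some i"])
  then show "fps_nth (tail (mps_var (Some i))) k = fps_nth 0 k"
    by (simp add: mps_var_mono mps_coeff_mono)
qed

lemma shift_vars_ordge: "shift_vars z i \<in> ordge 1"
  unfolding shift_vars_def by (intro ordge_add ordge_scale mps_var_ordge)

lemmas shift_simps = subst_mult[OF shift_vars_ordge] subst_one[OF shift_vars_ordge]
  subst_power[OF shift_vars_ordge] subst_var[OF shift_vars_ordge] mps_coeff_subst_0[OF shift_vars_ordge]

definition cmon :: "('n::finite \<Rightarrow> complex) \<Rightarrow> ('n \<Rightarrow> nat) \<Rightarrow> complex" where
  "cmon z a = (\<Prod>i\<in>UNIV. z i ^ a i)"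

text \<open>On the \<open>t\<close>-axis the shift is \<open>f (z t)\<close>, so the coefficient at
  \<open>k\<close> is the homogeneous part of degree \<open>k\<close> evaluated at
  \<open>z\<close>.\<close>

lemma tail_shift:
  "fps_nth (tail (shift z f)) k = (\<Sum>a | mdeg a = k. mps_coeff f a * cmon z a)"
proof -
  have t: "tail (subst_mono (shift_vars z) a) = fps_const (cmon z a) * fps_X ^ mdeg a" for a
  proof -
    have c: "fps_const (\<Prod>i\<in>I. h i) = (\<Prod>i\<in>I. fps_const (h i :: complex))" for h and I :: "'a set"
      by (induction I rule: infinite_finite_induct) (auto simp flip: fps_const_mult)
    have "tail (subst_mono (shift_vars z) a) = (\<Prod>i\<in>UNIV. (fps_const (z i) * fps_X) ^ a i)"
      by (simp add: subst_mono_def tail_prod tail_power shift_vars_def tail_add tail_scale tail_tvar tail_var_Some)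
    also have "\<dots> = fps_const (cmon z a) * fps_X ^ mdeg a"
      by (simp add: power_mult_distrib prod.distrib cmon_def c fps_const_power mdeg_def power_sum)
    finally show ?thesis .
  qed
  have k: "mdeg (opt (0 :: 'a \<Rightarrow> nat) k) = k"
    by (simp add: mdeg_def UNIV_option_conv sum.reindex zero_fun_apply)
  have "fps_nth (tail (shift z f)) k = (\<Sum>a | mdeg a \<le> k. mps_coeff f a * fps_nth (tail (subst_mono (shift_vars z) a)) k)"
    by (simp add: mps_coeff_subst k)
  also have "\<dots> = (\<Sum>a | mdeg a \<le> k. if mdeg a = k then mps_coeff f a * cmon z a else 0)"
    by (rule sum.cong) (auto simp: t fps_X_power_nth)
  also have "\<dots> = (\<Sum>a | mdeg a = k. mps_coeff f a * cmon z a)"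
    by (rule sum.mono_neutral_cong_right) (auto simp: finite_mdeg_le)
  finally show ?thesis .
qed

text \<open>Distinct monomials take distinct values at the primes, so a Lagrange interpolation argument applies.\<close>

lemma generic_direction:
  assumes "f \<noteq> 0"
  shows "\<exists>z m. treg (shift z f) m"
proof -
  obtain p :: "'a \<Rightarrow> nat" where "weights p" using ex_weights by blast
  then interpret weights p .
  obtain a0 where a0: "mps_coeff f a0 \<noteq> 0" using assms by (metis mps_eqI mps_coeff_zero)
  define k where "k = mdeg a0"
  define A where "A = {a :: 'a \<Rightarrow> nat. mdeg a = k}"
  have "A \<subseteq> {a. mdeg a \<le> k}" by (auto simp: A_def)
  then have A: "finite A" "a0 \<in> A"
    using finite_subset finite_mdeg_le by (blast, simp add: A_def k_def)
  \<comment> \<open>In direction \<open>z s\<close> the monomial \<open>a\<close> takes the value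
    \<open>wt a ^ s\<close>. The sums for varying \<open>s\<close> are therefore moments, which
    combine to sums with any polynomial in \<open>wt a\<close>.\<close>
  define z :: "nat \<Rightarrow> 'a \<Rightarrow> complex" where "z = (\<lambda>s i. of_nat (p i) ^ s)"
  have cmon: "cmon (z s) a = of_nat (wt a) ^ s" for s a
  proof -
    have "cmon (z s) a = (\<Prod>i\<in>UNIV. (of_nat (p i) ^ a i) ^ s)"
      unfolding cmon_def z_def by (simp only: power_mult[symmetric] mult.commute)
    then show ?thesis by (simp add: wt_def prod_power_distrib)
  qed
  have "\<exists>s. (\<Sum>a\<in>A. mps_coeff f a * cmon (z s) a) \<noteq> 0"
  proof (rule ccontr)
    assume "\<not> ?thesis"
    then have 0: "(\<Sum>a\<in>A. mps_coeff f a * of_nat (wt a) ^ s) = 0" for s by (simp add: cmon)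
    \<comment> \<open>Vanishes at the weights of all indices in \<open>A\<close> except
      \<open>a0\<close>; injectivity of \<open>wt\<close> keeps its value at \<open>wt a0\<close>
      nonzero.\<close>
    define q :: "complex poly" where "q = (\<Prod>b\<in>A - {a0}. [:- of_nat (wt b), 1:])"
    have "(\<Sum>a\<in>A. mps_coeff f a * poly q (of_nat (wt a))) =
        (\<Sum>s\<le>degree q. coeff q s * (\<Sum>a\<in>A. mps_coeff f a * of_nat (wt a) ^ s))"
      unfolding poly_altdef sum_distrib_left by (subst sum.swap) (simp add: mult_ac)
    also have "\<dots> = 0" by (simp add: 0)
    finally have "(\<Sum>a\<in>A. mps_coeff f a * poly q (of_nat (wt a))) = 0" .
    moreover have "(\<Sum>a\<in>A. mps_coeff f a * poly q (of_nat (wt a))) =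
        (\<Sum>a\<in>{a0}. mps_coeff f a * poly q (of_nat (wt a)))"
      using A by (intro sum.mono_neutral_right) (auto simp: q_def poly_prod prod_zero_iff)
    moreover have "poly q (of_nat (wt a0)) \<noteq> 0"
      using A wt_inj by (auto simp: q_def poly_prod)
    ultimately show False using a0 by simp
  qed
  then obtain s where "fps_nth (tail (shift (z s) f)) k \<noteq> 0" unfolding tail_shift A_def by blast
  then have "tail (shift (z s) f) \<noteq> 0" by (metis fps_zero_nth)
  then show ?thesis using treg_subdegree by blast
qed

lemma convergent_subst_shift:
  fixes f :: "'n::finite mps"
  assumes "convergent_mps f"
  shows "convergent_mps (shift z f)"
proof -
  obtain r where r: "r > 0" "\<And>\<rho>. (\<And>i. 0 < \<rho> i \<and> \<rho> i < r) \<Longrightarrow> \<exists>M. majorized \<rho> f M"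
    using convergent_majorized[OF assms] by blast
  define C where "C = Max (range (\<lambda>i. norm (z i)))"
  have C: "norm (z i) \<le> C" for i unfolding C_def by (rule Max_ge) auto
  then have C0: "C \<ge> 0" using norm_ge_zero order_trans by blast
  \<comment> \<open>This radius keeps the majorants \<open>M i\<close> of the shifted variables at
    or below \<open>r / 2\<close>, inside the domain where \<open>f\<close> is majorized.\<close>
  define e where "e = r / 2 / (1 + C)"
  have e: "e > 0" using r C0 by (simp add: e_def)
  have "1 + C \<noteq> 0" using C0 by linarith
  then have eC: "e * (1 + C) = r / 2" unfolding e_def by (rule nonzero_eq_divide_eq[THEN iffD1]) simp
  define \<rho> where "\<rho> = (\<lambda>_ :: 'n option. e)"
  define M where "M = (\<lambda>i. e + norm (z i) * e)"
  have \<rho>: "\<rho> i > 0" for i by (simp add: \<rho>_def e)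
  have "0 < M i \<and> M i < r" for i
  proof
    show "0 < M i" using e by (simp add: M_def add_pos_nonneg)
    have "M i \<le> e * (1 + C)" using C[of i] e by (simp add: M_def distrib_left)
    then show "M i < r" using eC r by simp
  qed
  then obtain K where K: "majorized M f K" using r(2) by blast
  have "majorized \<rho> (shift_vars z i) (M i)" for i
  proof -
    have "majorized \<rho> (mps_var (Some i)) e"
      using majorized_scale_mono[of \<rho> 1 "unit_idx (Some i)", OF \<rho>] by (simp add: mps_var_mono \<rho>_def)
    moreover have "majorized \<rho> (mps_scale (z i) tvar) (norm (z i) * e)"
      using majorized_scale_mono[of \<rho> "z i" "unit_idx None", OF \<rho>] by (simp add: mps_var_mono \<rho>_def)
    ultimately show ?thesis unfolding shift_vars_def M_def by (rule majorized_add) (rule \<rho>)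
  qed
  then have "majorized \<rho> (shift z f) K"
    by (rule majorized_subst[OF _ shift_vars_ordge \<rho> K])
  then show ?thesis using \<rho> by (rule majorized_convergent)
qed

lemma rho0_shift [simp]: "rho0 (shift z f) = f"
  unfolding rho0_def
  by (rule subst_eq_if_var[OF shift_vars_ordge rho0_ordge])
    (simp add: shift_vars_def subst_add subst_scale subst_var[OF rho0_ordge])

text \<open>The chain rule for \<open>f (x + z t)\<close>, by \<open>vanishing_principle\<close>
  with the multipliers \<open>shift_vars z i\<close> in place of the variables.\<close>

lemma pd_shift: "pd None (shift z f) = shift z (vf (\<lambda>i. mps_scale (z i) 1) f)"
proof -
  define w where "w = (\<lambda>i. mps_scale (z i) (1 :: 'a mps))"
  define d where "d = (\<lambda>f. pd None (shift z f) - shift z (vf w f))"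
  have add: "d (f + g) = d f + d g" for f g by (simp add: d_def subst_add pd_add vf_add)
  have sc: "d (mps_scale y 1) = 0" for y
    by (simp add: d_def subst_scale shift_simps pd_scale vf_scale vf_one)
  have p: "pd None (shift_vars z i) = mps_scale (z i) 1" for i
    by (simp add: shift_vars_def pd_add pd_scale pd_var)
  have v: "d (mps_var i * g) = shift_vars z i * d g" for i g
    by (simp add: d_def shift_simps pd_mult vf_mult p subst_add w_def subst_scale algebra_simps)
  have "d f = 0"
  proof (rule vanishing_principle[of d "shift_vars z"])
    fix f
    have "d f = (\<Sum>i\<in>UNIV. shift_vars z i * d (part_mps i f))"
      by (subst mps_decompose[of f]) (simp add: add sc v module_hom_sumD(1)[of d, OF add])
    then show "\<exists>g. d f = (\<Sum>i\<in>UNIV. shift_vars z i * d (g i))" by (intro exI[of _ "\<lambda>i. part_mps i f"])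
  qed (rule shift_vars_ordge)
  then show ?thesis by (simp add: d_def w_def)
qed

definition evalp :: "'n::finite cps poly \<Rightarrow> 'n option mps" where
  "evalp p = poly (map_poly (\<lambda>a. iota (to_formal a)) p) tvar"

lemma evalp_pCons [simp]: "evalp (pCons a p) = iota (to_formal a) + tvar * evalp p"
  by (simp add: evalp_def map_poly_pCons)

lemma evalp_0 [simp]: "evalp 0 = 0"
  by (simp add: evalp_def)

lemma evalp_add: "evalp (p + q) = evalp p + evalp q"
proof (induction p q rule: poly_induct2)
  case (pCons a p b q)
  then show ?case by (simp add: iota_add algebra_simps)
qed simp

lemma evalp_smult: "evalp (smult a p) = iota (to_formal a) * evalp p"
  by (induction p) (simp_all add: iota_mult algebra_simps)

lemma evalp_mult: "evalp (p * q) = evalp p * evalp q"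
  by (induction p) (simp_all add: evalp_add evalp_smult algebra_simps)

lemma evalp_sum: "evalp (sum h I) = (\<Sum>i\<in>I. evalp (h i))"
  by (rule module_hom_sumD(1)) (rule evalp_add)

lemma evalp_monom: "evalp (monom a k) = iota (to_formal a) * tvar ^ k"
  by (induction k) (simp_all add: monom_0 monom_Suc mult_ac)

lemma pd_iota [simp]: "pd None (iota a) = 0"
  by (rule mps_eqI) (simp add: mps_coeff_pd mps_coeff_iota unit_idx_def plus_fun_apply)

lemma pd_evalp: "pd None (evalp p) = evalp (pderiv p)"
  by (induction p) (simp_all add: pd_add pd_mult pd_var pderiv_pCons evalp_add algebra_simps)

lemma rho0_evalp: "rho0 (evalp p) = to_formal (coeff p 0)"
  by (cases p) (simp add: rho0_add)

text \<open>Divide \<open>t ^ m\<close> by \<open>F\<close>, with remainder \<open>r\<close>. On the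
  \<open>t\<close>-axis \<open>q * F = t ^ m - r\<close> is divisible by \<open>t ^ m\<close>, while
  \<open>r\<close> has degree below \<open>m\<close>. Hence \<open>r\<close> vanishes there, so the
  lower coefficients of \<open>p\<close> vanish at the origin, and comparison at
  \<open>t ^ m\<close> makes \<open>q\<close> a unit.\<close>

lemma weierstrass_preparation:
  fixes F :: "'n::finite option mps"
  assumes F: "treg F m" and conv: "convergent_mps F"
  obtains q p where "q dvd 1" "evalp p = q * F" "lead_coeff p = 1" "degree p = m"
    "\<And>k. k < m \<Longrightarrow> mps_coeff (to_formal (coeff p k)) 0 = 0"
proof -
  have convt: "convergent_mps (tvar ^ m :: 'n option mps)"
    unfolding tvar_power by (rule convergent_finite) (simp add: mps_coeff_mono)
  obtain q where q: "tdeg_lt m (tvar ^ m - q * F)" using weierstrass_division[OF F] .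
  have qconv: "convergent_mps q" by (rule weierstrass_division_convergent[OF F q conv convt])
  define r where "r = tvar ^ m - q * F"
  have r: "tdeg_lt m r" "convergent_mps r"
    using q convergent_mps_minus[OF convt convergent_mps_mult[OF qconv conv]] by (simp_all add: r_def)
  have "\<exists>s. to_formal s = slice k r" for k
    by (metis obtain_cps convergent_slice r(2))
  then obtain s where s: "\<And>k. to_formal (s k) = slice k r" by metis
  define p where "p = monom 1 m - (\<Sum>k<m. monom (s k) k)"
  have cp: "coeff p k = (if k = m then 1 else if k < m then - s k else 0)" for k
  proof -
    have "coeff (\<Sum>j<m. monom (s j) j) k = (\<Sum>j<m. if j = k then s k else 0)"
      unfolding coeff_sum by (rule sum.cong) auto
    also have "\<dots> = (if k < m then s k else 0)" by (subst sum.delta) auto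
    finally show ?thesis by (simp add: p_def)
  qed
  have deg: "degree p = m"
    by (rule antisym) (auto intro!: degree_le le_degree simp: cp)
  have "evalp p + evalp (\<Sum>k<m. monom (s k) k) = evalp (monom 1 m)"
    unfolding evalp_add[symmetric] by (simp add: p_def)
  moreover have "evalp (\<Sum>k<m. monom (s k) k) = r"
    using tdeg_lt_expand[OF r(1)] by (simp add: evalp_sum evalp_monom s)
  ultimately have "evalp p + r = tvar ^ m" by (simp add: evalp_monom)
  then have ev: "evalp p = q * F" by (simp add: r_def algebra_simps)
  have qF: "tail (q * F) = fps_X ^ m - tail r"
    using tail_add[of "q * F" r] by (simp add: r_def tail_power tail_tvar)
  have low: "fps_nth (tail (q * F)) k = (if k = m then mps_coeff q 0 * mps_coeff F (opt 0 m) else 0)" if "k \<le> m" for k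
  proof -
    have "fps_nth (tail (q * F)) k = (\<Sum>i=0..k. mps_coeff q (opt 0 i) * mps_coeff F (opt 0 (k - i)))"
      by (simp add: tail_mult fps_mult_nth)
    also have "\<dots> = (\<Sum>i=0..k. if i = 0 then (if k = m then mps_coeff q 0 * mps_coeff F (opt 0 m) else 0) else 0)"
      using F that by (intro sum.cong) (auto simp: treg_def)
    also have "\<dots> = (if k = m then mps_coeff q 0 * mps_coeff F (opt 0 m) else 0)" by (subst sum.delta) auto
    finally show ?thesis .
  qed
  have rm: "mps_coeff r (opt 0 m) = 0" using r(1) by (simp add: tdeg_lt_def)
  have "mps_coeff q 0 * mps_coeff F (opt 0 m) = 1"
    using low[of m] unfolding qF by (simp add: rm fps_X_power_nth)
  then have "q dvd 1" unfolding mps_dvd_1_iff by auto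
  moreover have "mps_coeff r (opt 0 k) = 0" if "k < m" for k
    using low[of k] that unfolding qF by (simp add: fps_X_power_nth)
  then have "mps_coeff (to_formal (coeff p k)) 0 = 0" if "k < m" for k
    using that by (simp add: cp s mps_coeff_slice)
  ultimately show ?thesis using ev deg by (intro that[of q p]) (auto simp: cp)
qed

text \<open>
  For a squarefree convergent series the Weierstrass polynomial \<open>p\<close> of a generic shift has no
  square factor, since setting \<open>t = 0\<close> would produce a square factor of \<open>f\<close>; hence the ideal of
  \<open>p\<close> and its derivative contains a nonzero constant \<open>d\<close>.
\<close>

lemma squarefree_discriminant:
  fixes f :: "'n::finite cps"
  assumes f: "squarefree f"
  obtains z m d \<alpha> \<beta> where "treg (shift z (to_formal f)) m" "d \<noteq> 0"
    "iota d = \<alpha> * shift z (to_formal f) + \<beta> * shift z (vf (\<lambda>i. mps_scale (z i) 1) (to_formal f))"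
proof -
  have f0: "f \<noteq> 0" using f by auto
  then obtain z m where m: "treg (shift z (to_formal f)) m"
    using generic_direction[of "to_formal f"] by auto
  define F where "F = shift z (to_formal f)"
  have F: "treg F m" "convergent_mps F"
    unfolding F_def by (rule m, rule convergent_subst_shift[OF convergent_to_formal])
  obtain q p where q: "q dvd 1" and ev: "evalp p = q * F" and p: "lead_coeff p = 1" "degree p = m"
    and low: "\<And>k. k < m \<Longrightarrow> mps_coeff (to_formal (coeff p k)) 0 = 0"
    using weierstrass_preparation[OF F] by blast
  obtain q' where q': "1 = q * q'" using q by blast
  from square_factor_or_discriminant[OF completely_integrally_closed_cps p(1)]
  show ?thesis
  proof
    assume "\<exists>g. lead_coeff g = 1 \<and> degree g > 0 \<and> g ^ 2 dvd p"
    then obtain g h where g: "lead_coeff g = 1" "degree g > 0" and gh: "p = g ^ 2 * h" by blast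
    \<comment> \<open>Setting \<open>t = 0\<close> turns the square factor of \<open>p\<close> into
      the square of \<open>coeff g 0\<close> dividing \<open>f\<close>, so \<open>coeff g 0\<close>
      must be a unit.\<close>
    have "to_formal (coeff p 0) = rho0 q * to_formal f"
      using rho0_evalp[of p] by (simp add: ev F_def)
    then have "rho0 q' * to_formal (coeff p 0) = rho0 (q * q') * to_formal f"
      by (simp add: mult_ac)
    also have "\<dots> = to_formal f" by (simp flip: q')
    finally have "to_formal f = rho0 q' * to_formal (coeff p 0)" ..
    also have "coeff p 0 = coeff g 0 ^ 2 * coeff h 0"
      by (simp add: gh power2_eq_square coeff_mult)
    finally have "to_formal (coeff g 0 ^ 2) dvd to_formal f" by simp
    then have "coeff g 0 dvd 1"
      using f unfolding to_formal_dvd_iff squarefree_def by blast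
    then have "to_formal (coeff g 0) dvd to_formal 1" unfolding to_formal_dvd_iff .
    then have nz: "mps_coeff (to_formal (coeff g 0)) 0 \<noteq> 0" by (simp add: mps_dvd_1_iff)
    \<comment> \<open>Taking constant coefficients turns \<open>p\<close> into the pure power of
      degree \<open>m\<close>. The image of \<open>g\<close> divides it and has positive degree, so
      its only root is \<open>0\<close>; then \<open>coeff g 0\<close> vanishes at the origin and is
      no unit.\<close>
    define cst where "cst = (\<lambda>p :: 'n cps poly. map_poly (\<lambda>a. mps_coeff (to_formal a) 0) p)"
    have cst_coeff: "coeff (cst p) k = mps_coeff (to_formal (coeff p k)) 0" for p k
      by (simp add: cst_def coeff_map_poly)
    have cst_mult: "cst (u * v) = cst u * cst v" for u v
      by (rule poly_eqI) (simp add: cst_coeff coeff_mult)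
    have "cst p = monom 1 m"
    proof (rule poly_eqI)
      fix k
      show "coeff (cst p) k = coeff (monom 1 m) k"
        using low[of k] p by (cases k m rule: linorder_cases) (auto simp: cst_coeff mps_coeff_one coeff_eq_0)
    qed
    moreover have "cst p = cst g * (cst g * cst h)"
      by (simp add: gh power2_eq_square cst_mult mult.assoc)
    ultimately have dvd: "monom 1 m = cst g * (cst g * cst h)" by simp
    have "coeff (cst g) (degree g) = 1" using g by (simp add: cst_coeff mps_coeff_one)
    then have "degree (cst g) \<noteq> 0" using g(2) le_degree[of "cst g" "degree g"] by simp
    then have "\<not> constant (poly (cst g))" by (simp add: constant_degree)
    then obtain x where x: "poly (cst g) x = 0" using fundamental_theorem_of_algebra by blast
    have "x ^ m = 0" using arg_cong[OF dvd, of "\<lambda>r. poly r x"] x by (simp add: poly_monom)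
    then have "x = 0" by simp
    then have "coeff (cst g) 0 = 0" using x by (simp add: poly_0_coeff_0)
    with nz show ?thesis by (simp add: cst_coeff)
  next
    assume "\<exists>d a b. d \<noteq> 0 \<and> [:d:] = a * p + b * pderiv p"
    then obtain d a b where d: "d \<noteq> 0" and ab: "[:d:] = a * p + b * pderiv p" by blast
    have "iota (to_formal d) = evalp [:d:]" by simp
    also have "\<dots> = evalp a * (q * F) + evalp b * pd None (q * F)"
      by (simp only: ab evalp_add evalp_mult ev pd_evalp[symmetric])
    also have "\<dots> = (evalp a * q + evalp b * pd None q) * F + (evalp b * q) * pd None F"
      by (simp add: pd_mult algebra_simps)
    finally show ?thesis
      using that[OF m, of "to_formal d"] d by (simp add: F_def pd_shift)
  qed
qed

text \<open>Let \<open>r\<close> be the remainder of the shifted \<open>h\<close>. Multiplying by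
  \<open>iota d\<close> makes it a multiple of the shifted \<open>f\<close>, but does not raise its
  \<open>t\<close>-degree, since \<open>iota d\<close> is free of \<open>t\<close>. Uniqueness of
  Weierstrass division gives \<open>r = 0\<close>, and \<open>t = 0\<close> recovers
  \<open>f dvd h\<close>.\<close>

lemma dvd_of_dvd_mult_derivative:
  fixes f g h :: "'n::finite mps"
  assumes F: "treg (shift z f) m" and d: "d \<noteq> 0" "iota d = \<alpha> * shift z f + \<beta> * shift z g"
    and dvd: "f dvd h * g"
  shows "f dvd h"
proof -
  obtain s where s: "h * g = f * s" using dvd by blast
  obtain q where q: "tdeg_lt m (shift z h - q * shift z f)" using weierstrass_division[OF F] .
  define r where "r = shift z h - q * shift z f"
  have "shift z h * shift z g = shift z f * shift z s"
    using arg_cong[OF s, of "shift z"] by (simp add: shift_simps)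
  then have "shift z h * iota d = (\<alpha> * shift z h + \<beta> * shift z s) * shift z f"
    by (simp add: d algebra_simps)
  then have "r * iota d = (\<alpha> * shift z h + \<beta> * shift z s - q * iota d) * shift z f"
    by (simp add: r_def algebra_simps)
  moreover have "tdeg_lt m (r * iota d)" using q by (simp add: r_def tdeg_lt_mult_iota)
  ultimately have "\<alpha> * shift z h + \<beta> * shift z s - q * iota d = 0"
    using weierstrass_division_unique[OF F] by metis
  then have "r * iota d = 0"
    using \<open>r * iota d = _\<close> by simp
  then have "r = 0" using d(1) by simp
  then have "rho0 (shift z h) = rho0 (q * shift z f)" by (simp add: r_def)
  then show ?thesis by simp
qed

text \<open>Each term of the expansion contains \<open>x ^ m\<close> or \<open>y ^ n\<close>; the
  induction splits off one factor at a time.\<close>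

lemma power_sum_ideal:
  fixes x y :: "'a::comm_ring_1"
  shows "\<exists>u v. (a * x + b * y) ^ (m + n) = x ^ m * u + y ^ n * v"
proof (induction "m + n" arbitrary: m n)
  case (Suc k)
  let ?z = "a * x + b * y"
  show ?case
  proof (cases m)
    case 0
    then have "?z ^ (m + n) = x ^ m * ?z ^ n + y ^ n * 0" by simp
    then show ?thesis by blast
  next
    case m: (Suc m')
    show ?thesis
    proof (cases n)
      case 0
      then have "?z ^ (m + n) = x ^ m * 0 + y ^ n * ?z ^ m" by simp
      then show ?thesis by blast
    next
      case n: (Suc n')
      obtain u v where 1: "?z ^ (m' + n) = x ^ m' * u + y ^ n * v" using Suc.hyps(1)[of m' n] Suc.hyps(2) m by auto
      obtain u' v' where 2: "?z ^ (m + n') = x ^ m * u' + y ^ n' * v'" using Suc.hyps(1)[of m n'] Suc.hyps(2) n by auto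
      have e: "m + n = Suc (m' + n)" "m' + n = m + n'" using m n by auto
      have "?z ^ (m + n) = a * x * ?z ^ (m' + n) + b * y * ?z ^ (m + n')"
        unfolding e by (simp add: algebra_simps)
      also have "\<dots> = x ^ m * (a * u + b * y * u') + y ^ n * (a * x * v + b * v')"
        unfolding 1 2 by (simp add: m n algebra_simps)
      finally show ?thesis by blast
    qed
  qed
qed (auto intro: exI[of _ 0] exI[of _ 1])

text \<open>The shift of \<open>h\<close> divides a power of \<open>iota d\<close>, which is free of
  \<open>t\<close>. If it were regular of positive order \<open>l\<close>, that power would be a
  multiple of \<open>t\<close>-degree below \<open>l\<close> and would vanish. So the order is
  \<open>0\<close>, which means that \<open>h\<close> is nonzero at the origin.\<close>

lemma unit_of_dvd_powers:
  fixes f g h :: "'n::finite mps"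
  assumes F: "treg (shift z f) m" and d: "d \<noteq> 0" "iota d = \<alpha> * shift z f + \<beta> * shift z g"
    and dvd: "h dvd f ^ N" "h dvd g ^ N"
  shows "h dvd 1"
proof -
  obtain s where s: "f ^ N = h * s" using dvd by blast
  obtain s' where s': "g ^ N = h * s'" using dvd by blast
  obtain u v where uv: "iota d ^ (N + N) = shift z f ^ N * u + shift z g ^ N * v"
    using power_sum_ideal[of \<alpha> "shift z f" \<beta> "shift z g" N N] by (auto simp: d)
  have fN: "shift z f ^ N = shift z h * shift z s" using arg_cong[OF s, of "shift z"] by (simp add: shift_simps)
  have gN: "shift z g ^ N = shift z h * shift z s'" using arg_cong[OF s', of "shift z"] by (simp add: shift_simps)
  have dN: "iota (d ^ (N + N)) = (shift z s * u + shift z s' * v) * shift z h"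
    unfolding iota_power uv fN gN by (simp add: algebra_simps)
  have "fps_nth (tail (shift z f)) m \<noteq> 0" using F by (simp add: treg_def)
  then have "tail (shift z f) \<noteq> 0" by (metis fps_zero_nth)
  then have "tail (shift z f) ^ N \<noteq> 0" by simp
  \<comment> \<open>Regularity passes to divisors: on the \<open>t\<close>-axis the shift of
    \<open>h\<close> divides a nonzero power of the shift of \<open>f\<close>.\<close>
  then have "tail (shift z h) \<noteq> 0" using fN by (metis tail_power tail_mult mult_zero_left)
  then obtain l where l: "treg (shift z h) l" using treg_subdegree by blast
  have "l = 0"
  proof (rule ccontr)
    assume "l \<noteq> 0"
    then have "tdeg_lt l ((shift z s * u + shift z s' * v) * shift z h)"
      unfolding dN[symmetric] by (simp add: tdeg_lt_def mps_coeff_iota)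
    then have "shift z s * u + shift z s' * v = 0" by (rule weierstrass_division_unique[OF l])
    then have "iota (d ^ (N + N)) = 0" using dN by simp
    then show False using d(1) by simp
  qed
  then have "mps_coeff (shift z h) 0 \<noteq> 0" using l by (simp add: treg_def)
  then show ?thesis by (simp add: mps_dvd_1_iff shift_simps)
qed

section \<open>Determinants over integral domains\<close>

lemma det_hom:
  fixes h :: "'a::comm_ring_1 \<Rightarrow> 'b::comm_ring_1" and A :: "'a^'n::finite^'n"
  assumes add: "\<And>x y. h (x + y) = h x + h y" and mult: "\<And>x y. h (x * y) = h x * h y" and one: "h 1 = 1"
  shows "h (det A) = det (\<chi> i j. h (A $ i $ j))"
proof -
  have zero: "h 0 = 0" using module_hom_sumD(2)[of h, OF add] .
  have neg: "h (- x) = - h x" for x using add[of x "- x"] zero by (simp add: eq_neg_iff_add_eq_0 add.commute)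
  have pr: "h (prod g I) = (\<Prod>i\<in>I. h (g i))" for g and I :: "'n set"
    by (induction I rule: infinite_finite_induct) (auto simp: mult one)
  have sg: "h (of_int (sign p) * x) = of_int (sign p) * h x" for p :: "'n \<Rightarrow> 'n" and x
    by (simp add: sign_def neg)
  show ?thesis
    unfolding det_def module_hom_sumD(1)[of h, OF add] sg pr by simp
qed

lemma det_to_fract:
  fixes A :: "'a::idom^'n::finite^'n"
  shows "to_fract (det A) = det (\<chi> i j. to_fract (A $ i $ j))"
  by (rule det_hom) auto

lemma cramer_idom:
  fixes A :: "'a::idom^'n::finite^'n"
  shows "det (\<chi> i j. if j = k then (\<Sum>l\<in>UNIV. A $ i $ l * x l) else A $ i $ j) = x k * det A"
proof -
  let ?A = "\<chi> i j. to_fract (A $ i $ j)" and ?x = "\<chi> l. to_fract (x l)"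
  have s: "to_fract (\<Sum>l\<in>UNIV. g l) = (\<Sum>l\<in>UNIV. to_fract (g l))" for g :: "'n \<Rightarrow> 'a"
    by (rule module_hom_sumD(1)) simp
  have "to_fract (det (\<chi> i j. if j = k then (\<Sum>l\<in>UNIV. A $ i $ l * x l) else A $ i $ j)) =
      det (\<chi> i j. if j = k then (?A *v ?x) $ i else ?A $ i $ j)"
    unfolding det_to_fract
    by (rule arg_cong[where f = det]) (auto simp: vec_eq_iff matrix_vector_mult_def s)
  also have "\<dots> = ?x $ k * det ?A" by (rule cramer_lemma)
  also have "\<dots> = to_fract (x k * det A)" by (simp add: det_to_fract)
  finally show ?thesis by (simp only: to_fract_eq_iff)
qed

text \<open>Cramer's rule gives the coefficients over the fraction field; the hypothesis on
  determinants says that they are the elements \<open>w k\<close> of the ring.\<close>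

lemma row_combination_idom:
  fixes A :: "'a::idom^'n::finite^'n"
  assumes nz: "det A \<noteq> 0"
    and w: "\<And>k. det (\<chi> i j. if i = k then v j else A $ i $ j) = w k * det A"
  shows "v j = (\<Sum>i\<in>UNIV. w i * A $ i $ j)"
proof -
  define A' where "A' = (\<chi> i j. to_fract (A $ i $ j))"
  define v' where "v' = (\<chi> j. to_fract (v j))"
  have detA': "det A' = to_fract (det A)" by (simp add: A'_def det_to_fract)
  then have "invertible A'" using nz by (simp add: invertible_det_nz)
  then obtain B where B: "B ** A' = mat 1" by (auto simp: invertible_def)
  define y where "y = v' v* B"
  have y: "y v* A' = v'" unfolding y_def vector_matrix_mul_assoc B by simp
  have sum: "sum (\<lambda>i. y $ i *s row i A') UNIV = v'"
    unfolding y[symmetric] by (simp add: vec_eq_iff vector_matrix_mult_def row_def mult.commute)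
  have yk: "y $ k = to_fract (w k)" for k
  proof -
    have "y $ k * det A' = det (\<chi> i. if i = k then v' else row i A')"
      using cramer_lemma_transpose[of k y A'] unfolding sum by simp
    also have "(\<chi> i. if i = k then v' else row i A') = (\<chi> i j. to_fract ((\<chi> i j. if i = k then v j else A $ i $ j) $ i $ j))"
      by (auto simp: vec_eq_iff v'_def A'_def row_def)
    also have "det \<dots> = to_fract (w k * det A)" unfolding det_to_fract[symmetric] w ..
    also have "\<dots> = to_fract (w k) * det A'" by (simp add: detA')
    finally show ?thesis using nz by (simp add: detA')
  qed
  have s: "to_fract (\<Sum>l\<in>UNIV. g l) = (\<Sum>l\<in>UNIV. to_fract (g l))" for g :: "'n \<Rightarrow> 'a"
    by (rule module_hom_sumD(1)) simp
  have "to_fract (v j) = sum (\<lambda>i. y $ i *s row i A') UNIV $ j" unfolding sum by (simp add: v'_def)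
  also have "\<dots> = to_fract (\<Sum>i\<in>UNIV. w i * A $ i $ j)"
    by (simp add: row_def yk A'_def s)
  finally show ?thesis by (simp only: to_fract_eq_iff)
qed

text \<open>A permutation other than the identity moves at least two points, hence meets an
  off-diagonal entry in a row other than \<open>j0\<close>.\<close>

lemma det_diagonal_except_row:
  fixes A :: "'a::comm_ring_1^'n::finite^'n"
  assumes "\<And>i k. i \<noteq> k \<Longrightarrow> i \<noteq> j0 \<Longrightarrow> A $ i $ k = 0"
  shows "det A = (\<Prod>i\<in>UNIV. A $ i $ i)"
proof -
  have "det A = (\<Sum>p\<in>{p. p permutes UNIV}. of_int (sign p) * (\<Prod>i\<in>UNIV. A $ i $ p i))"
    by (simp add: det_def)
  also have "\<dots> = (\<Sum>p\<in>{id}. of_int (sign p) * (\<Prod>i\<in>UNIV. A $ i $ p i))"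
  proof (rule sum.mono_neutral_right)
    show "\<forall>p\<in>{p. p permutes UNIV} - {id}. of_int (sign p) * (\<Prod>i\<in>UNIV. A $ i $ p i) = 0"
    proof
      fix p :: "'n \<Rightarrow> 'n" assume p: "p \<in> {p. p permutes UNIV} - {id}"
      then have inj: "inj p" and "p \<noteq> id" by (auto simp: permutes_inj)
      then obtain k where k: "p k \<noteq> k" by (auto simp: fun_eq_iff)
      have "\<exists>i. i \<noteq> j0 \<and> p i \<noteq> i"
        using k inj by (cases "k = j0") (metis injD)+
      then obtain i where "A $ i $ p i = 0" using assms by metis
      then have "(\<Prod>i\<in>UNIV. A $ i $ p i) = 0" by (intro prod_zero) auto
      then show "of_int (sign p) * (\<Prod>i\<in>UNIV. A $ i $ p i) = 0" by simp
    qed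
  qed (auto simp: permutes_id)
  finally show ?thesis by simp
qed

section \<open>Saito's criterion\<close>

text \<open>By Cramer's rule \<open>det A * pd k f\<close> is the determinant with column
  \<open>k\<close> replaced by the values of the rows on \<open>f\<close>, all multiples of
  \<open>f\<close>. Combining the \<open>k\<close> with weights \<open>z k\<close> makes
  \<open>f\<close> divide \<open>det A\<close> times the derivative along \<open>z\<close>, which
  can be cancelled.\<close>

lemma dvd_det_of_log_rows:
  fixes f :: "'n::finite mps" and A :: "'n mps^'n^'n"
  assumes F: "treg (shift z f) m" and d: "d \<noteq> 0"
    "iota d = \<alpha> * shift z f + \<beta> * shift z (vf (\<lambda>i. mps_scale (z i) 1) f)"
    and rows: "\<And>i. f dvd vf (\<lambda>j. A $ i $ j) f"
  shows "f dvd det A"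
proof -
  obtain g where g: "\<And>i. vf (\<lambda>j. A $ i $ j) f = f * g i" using rows unfolding dvd_def by metis
  have "f dvd det A * pd k f" for k
  proof -
    have "det A * pd k f = det (\<chi> i j. if j = k then (\<Sum>l\<in>UNIV. A $ i $ l * pd l f) else A $ i $ j)"
      by (simp add: cramer_idom mult.commute)
    also have "(\<chi> i j. if j = k then (\<Sum>l\<in>UNIV. A $ i $ l * pd l f) else A $ i $ j) =
        transpose (\<chi> j. if j = k then f *s (\<chi> i. g i) else (\<chi> i. A $ i $ j))"
      using g by (auto simp: vec_eq_iff transpose_def vf_def)
    also have "det \<dots> = f * det (\<chi> j. if j = k then (\<chi> i. g i) else (\<chi> i. A $ i $ j))"
      by (simp add: det_transpose det_row_mul)
    finally show ?thesis by simp
  qed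
  then have "f dvd mps_scale (z k) 1 * (det A * pd k f)" for k by (rule dvd_mult)
  then have "f dvd (\<Sum>k\<in>UNIV. mps_scale (z k) 1 * (det A * pd k f))" by (intro dvd_sum)
  also have "(\<Sum>k\<in>UNIV. mps_scale (z k) 1 * (det A * pd k f)) = det A * vf (\<lambda>i. mps_scale (z i) 1) f"
    by (simp add: vf_def sum_distrib_left mult_ac)
  finally show ?thesis by (rule dvd_of_dvd_mult_derivative[OF F d])
qed

lemma log_der_cps_iff: "\<delta> \<in> log_der cps_scale f \<longleftrightarrow> (\<exists>a. \<delta> = vf_cps a \<and> f dvd vf_cps a f)"
  unfolding log_der_def using derivation_cps_eq derivation_vf_cps by (metis (mono_tags, lifting) mem_Collect_eq)

lemma log_der_mps_iff: "\<delta> \<in> log_der mps_scale f \<longleftrightarrow> (\<exists>a. \<delta> = vf a \<and> f dvd vf a f)"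
  unfolding log_der_def using derivation_eq_vf derivation_vf by (metis (mono_tags, lifting) mem_Collect_eq)

lemma vf_eq_iff: "vf a = vf b \<longleftrightarrow> a = b"
  by (metis ext vf_var)

lemma sum_fun_apply: "(\<Sum>i\<in>I. h i) x = (\<Sum>i\<in>I. h i x)"
  for h :: "'i \<Rightarrow> 'a \<Rightarrow> 'b::comm_monoid_add"
  by (induction I rule: infinite_finite_induct) (auto simp: zero_fun_apply plus_fun_apply)

lemma sum_der_scale_vf_cps:
  "(\<Sum>i\<in>I. der_scale (w i) (vf_cps (a i))) = vf_cps (\<lambda>j. \<Sum>i\<in>I. w i * a i j)"
  by (rule ext) (simp add: sum_fun_apply der_scale_def vf_cps_def sum_distrib_left sum_distrib_right mult.assoc sum.swap[of _ I])

lemma sum_der_scale_vf: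
  "(\<Sum>i\<in>I. der_scale (w i) (vf (a i))) = vf (\<lambda>j. \<Sum>i\<in>I. w i * a i j)"
  by (rule ext) (simp add: sum_fun_apply der_scale_def vf_def sum_distrib_left sum_distrib_right mult.assoc sum.swap[of _ I])

text \<open>The derivations \<open>e k\<close>, which are \<open>f\<close> times the partial
  derivatives, lie in the span of a finite part \<open>B0\<close> of the basis. For any
  \<open>b\<close> the multiple \<open>f * b\<close> is a combination of them, so an element
  \<open>b\<close> outside \<open>B0\<close> would satisfy a nontrivial relation.\<close>

lemma finite_der_basis:
  fixes f :: "'n::finite cps"
  assumes f: "f \<noteq> 0" and B: "der_basis B (log_der cps_scale f)"
  shows "finite B"
proof -
  interpret D: Modules.module "der_scale :: 'n cps \<Rightarrow> _" by (rule module_der)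
  have indep: "\<not> D.dependent B" and span: "D.span B = log_der cps_scale f" using B by (auto simp: der_basis_def)
  define e where "e k = vf_cps (\<lambda>j. if j = k then f else 0)" for k
  have ek: "e k g = f * pd_cps k g" for k g
    by (simp add: e_def vf_cps_def if_distrib[of "\<lambda>x. x * _"] cong: if_cong)
  have "e k \<in> D.span B" for k
    unfolding span log_der_cps_iff by (intro exI[of _ "\<lambda>j. if j = k then f else 0"]) (simp add: ek flip: e_def)
  then have "\<exists>t. finite t \<and> t \<subseteq> B \<and> e k \<in> D.span t" for k
  proof -
    from \<open>e k \<in> D.span B\<close> obtain t r where t: "finite t" "t \<subseteq> B" "e k = (\<Sum>a\<in>t. der_scale (r a) a)"
      unfolding D.span_explicit mem_Collect_eq by (elim exE conjE)
    have "(\<Sum>a\<in>t. der_scale (r a) a) \<in> D.span t" by (intro D.span_sum D.span_scale D.span_base)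
    then show ?thesis using t by metis
  qed
  then obtain t where t: "\<And>k. finite (t k) \<and> t k \<subseteq> B \<and> e k \<in> D.span (t k)" by metis
  define B0 where "B0 = (\<Union>k. t k)"
  have B0: "finite B0" "B0 \<subseteq> B" using t by (auto simp: B0_def)
  have e0: "e k \<in> D.span B0" for k
    using t D.span_mono[of "t k" B0] by (auto simp: B0_def)
  have "B \<subseteq> B0"
  proof
    fix b assume b: "b \<in> B"
    show "b \<in> B0"
    proof (rule ccontr)
      assume nb: "b \<notin> B0"
      have "b \<in> log_der cps_scale f" using b span D.span_base by blast
      then obtain a where a: "b = vf_cps a" unfolding log_der_cps_iff by blast
      have "der_scale f b = (\<Sum>k\<in>UNIV. der_scale (a k) (e k))"
        by (rule ext) (simp add: sum_fun_apply der_scale_def ek a vf_cps_def sum_distrib_left mult_ac)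
      also have "\<dots> \<in> D.span B0" by (intro D.span_sum D.span_scale e0)
      finally obtain r where r: "der_scale f b = (\<Sum>v\<in>B0. der_scale (r v) v)"
        unfolding D.span_finite[OF B0(1)] by blast
      define u where "u v = (if v = b then f else - r v)" for v
      have "(\<Sum>v\<in>insert b B0. der_scale (u v) v) = der_scale (u b) b + (\<Sum>v\<in>B0. der_scale (u v) v)"
        using nb B0 by simp
      also have "(\<Sum>v\<in>B0. der_scale (u v) v) = (\<Sum>v\<in>B0. - der_scale (r v) v)"
        using nb by (intro sum.cong) (auto simp: u_def)
      also have "der_scale (u b) b + \<dots> = 0" using r by (simp add: u_def sum_negf)
      finally have "D.dependent B"
        unfolding D.dependent_explicit using B0 b f
        by (intro exI[of _ "insert b B0"] conjI exI[of _ u] bexI[of _ b]) (auto simp: u_def)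
      with indep show False by simp
    qed
  qed
  then show ?thesis using B0 finite_subset by blast
qed

text \<open>The coefficient vectors form a basis over the fraction field: relations lose their
  denominators, and the derivations \<open>f\<close> times a partial derivative, divided by
  \<open>f\<close>, give the unit vectors.\<close>

lemma card_der_basis:
  fixes f :: "'n::finite cps"
  assumes f: "f \<noteq> 0" and B: "der_basis B (log_der cps_scale f)"
  shows "card B = CARD('n)"
proof -
  interpret D: Modules.module "der_scale :: 'n cps \<Rightarrow> _" by (rule module_der)
  have indep: "\<not> D.dependent B" and span: "D.span B = log_der cps_scale f" using B by (auto simp: der_basis_def)
  have fin: "finite B" by (rule finite_der_basis[OF assms])
  have der: "b = vf_cps (\<lambda>j. b (cps_var j))" if "b \<in> B" for b
  proof -
    have "b \<in> log_der cps_scale f" using that span D.span_base by blast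
    then obtain a where "b = vf_cps a" unfolding log_der_cps_iff by blast
    then show ?thesis by simp
  qed
  define \<phi> where "\<phi> b = (\<chi> j. to_fract (b (cps_var j)))" for b :: "'n cps \<Rightarrow> 'n cps"
  have inj: "inj_on \<phi> B"
  proof (rule inj_onI)
    fix b b' assume b: "b \<in> B" "b' \<in> B" and eq: "\<phi> b = \<phi> b'"
    have "b (cps_var j) = b' (cps_var j)" for j
      using arg_cong[OF eq, of "\<lambda>v. v $ j"] by (simp add: \<phi>_def)
    then have "(\<lambda>j. b (cps_var j)) = (\<lambda>j. b' (cps_var j))" by simp
    then show "b = b'" using der[OF b(1)] der[OF b(2)] by metis
  qed
  have s: "to_fract (sum g I) = (\<Sum>l\<in>I. to_fract (g l))" for g :: "'i \<Rightarrow> 'n cps" and I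
    by (rule module_hom_sumD(1)) simp
  have "vec.independent (\<phi> ` B)"
  proof
    assume "vec.dependent (\<phi> ` B)"
    then obtain u where u: "\<exists>v\<in>\<phi> ` B. u v \<noteq> 0" "(\<Sum>v\<in>\<phi> ` B. u v *s v) = 0"
      using fin by (auto simp: vec.dependent_finite)
    have "finite (u ` \<phi> ` B)" using fin by simp
    from common_denominator[OF this] obtain e where e0: "e \<noteq> 0"
      and e: "\<forall>x\<in>u ` \<phi> ` B. to_fract e * x \<in> range to_fract" by (elim exE conjE)
    have "\<forall>b\<in>B. \<exists>r. to_fract e * u (\<phi> b) = to_fract r" using e by blast
    then obtain r where r: "\<And>b. b \<in> B \<Longrightarrow> to_fract e * u (\<phi> b) = to_fract (r b)" by metis
    have "(\<Sum>b\<in>B. u (\<phi> b) *s \<phi> b) = 0" using u(2) by (simp add: sum.reindex[OF inj])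
    then have 0: "(\<Sum>b\<in>B. u (\<phi> b) * to_fract (b (cps_var j))) = 0" for j
      by (auto simp: vec_eq_iff \<phi>_def)
    have "(\<Sum>b\<in>B. r b * b (cps_var j)) = 0" for j
    proof -
      have "to_fract (\<Sum>b\<in>B. r b * b (cps_var j)) = (\<Sum>b\<in>B. to_fract e * (u (\<phi> b) * to_fract (b (cps_var j))))"
        unfolding s by (rule sum.cong) (auto simp: r[symmetric])
      also have "\<dots> = 0" unfolding sum_distrib_left[symmetric] 0 by simp
      finally show ?thesis by (simp only: to_fract_eq_0_iff)
    qed
    then have "vf_cps (\<lambda>j. \<Sum>b\<in>B. r b * b (cps_var j)) = vf_cps (\<lambda>j. 0)" by simp
    then have "(\<Sum>b\<in>B. der_scale (r b) (vf_cps (\<lambda>j. b (cps_var j)))) = 0"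
      unfolding sum_der_scale_vf_cps by (simp add: vf_cps_def fun_eq_iff zero_fun_apply)
    then have "(\<Sum>b\<in>B. der_scale (r b) b) = 0" using der by (metis (no_types, lifting) sum.cong)
    moreover obtain b where b: "b \<in> B" "u (\<phi> b) \<noteq> 0" using u(1) by blast
    then have "to_fract (r b) \<noteq> 0" using r[OF b(1)] e0 by (metis mult_eq_0_iff to_fract_eq_0_iff)
    ultimately have "D.dependent B" using fin b(1) by (auto simp: D.dependent_finite)
    with indep show False by simp
  qed
  moreover have "vec.span (\<phi> ` B) = UNIV"
  proof -
    have ax: "axis k 1 \<in> vec.span (\<phi> ` B)" for k
    proof -
      define e where "e = vf_cps (\<lambda>j. if j = k then f else 0)"
      have "e f = f * pd_cps k f"
        by (simp add: e_def vf_cps_def if_distrib[of "\<lambda>x. x * _"] cong: if_cong)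
      then have "e \<in> D.span B" unfolding span log_der_cps_iff e_def by auto
      then obtain r where "e = (\<Sum>b\<in>B. der_scale (r b) b)" unfolding D.span_finite[OF fin] by blast
      then have "e (cps_var j) = (\<Sum>b\<in>B. r b * b (cps_var j))" for j
        by (simp add: sum_fun_apply der_scale_def)
      then have fe: "(if j = k then f else 0) = (\<Sum>b\<in>B. r b * b (cps_var j))" for j
        by (simp add: e_def)
      then have fr: "to_fract (if j = k then f else 0) = (\<Sum>b\<in>B. to_fract (r b) * to_fract (b (cps_var j)))" for j
        using arg_cong[OF fe[of j], of to_fract] by (simp only: s to_fract_mult)
      have "axis k 1 = inverse (to_fract f) *s (\<Sum>b\<in>B. to_fract (r b) *s \<phi> b)"
      proof (simp only: vec_eq_iff, rule allI)
        fix j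
        show "axis k 1 $ j = (inverse (to_fract f) *s (\<Sum>b\<in>B. to_fract (r b) *s \<phi> b)) $ j"
          using f by (auto simp: \<phi>_def axis_def fr[symmetric])
      qed
      also have "\<dots> \<in> vec.span (\<phi> ` B)"
        by (intro vec.span_scale vec.span_sum vec.span_base) auto
      finally show ?thesis .
    qed
    have "v \<in> vec.span (\<phi> ` B)" for v
    proof -
      have "v = (\<Sum>k\<in>UNIV. v $ k *s axis k 1)" by (simp add: basis_expansion)
      also have "\<dots> \<in> vec.span (\<phi> ` B)" by (intro vec.span_sum vec.span_scale ax)
      finally show ?thesis .
    qed
    then show ?thesis by blast
  qed
  ultimately have "card (\<phi> ` B) = vec.dim (UNIV :: ('n cps fract ^ 'n) set)"
    by (intro vec.basis_card_eq_dim) auto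
  then show ?thesis by (simp only: card_image[OF inj] vec_dim_card)
qed

lemma max_ideal_cps: "g \<in> max_ideal (cps_var :: 'n::finite \<Rightarrow> _) \<Longrightarrow> mps_coeff (to_formal g) 0 = 0"
proof -
  interpret R: Modules.module "(*) :: 'n cps \<Rightarrow> _" by (rule module_ring)
  have "R.span (range cps_var) \<subseteq> {g :: 'n cps. mps_coeff (to_formal g) 0 = 0}"
    by (rule R.span_minimal) (auto simp: R.subspace_def)
  then show "g \<in> max_ideal (cps_var :: 'n::finite \<Rightarrow> _) \<Longrightarrow> mps_coeff (to_formal g) 0 = 0"
    unfolding max_ideal_def by blast
qed

text \<open>With \<open>det A = f * h\<close>, it must be shown that \<open>h\<close> is a unit.
  Since \<open>det A\<close> divides the determinant of any matrix with logarithmic rows, two test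
  matrices suffice: one yields that \<open>h\<close> divides a power of \<open>f\<close>, the other
  that \<open>h\<close> divides a power of the derivative \<open>g\<close> along
  \<open>z\<close>.\<close>

theorem saito_formal:
  fixes f :: "'n::finite cps"
  assumes free: "free_germ f" and sing: "\<forall>\<delta>\<in>log_der cps_scale f. singular_der cps_var \<delta>"
  obtains A :: "'n mps^'n^'n" where
    "\<And>i. to_formal f dvd vf (\<lambda>j. A $ i $ j) (to_formal f)"
    "\<And>i j. A $ i $ j \<in> ordge 1"
    "\<exists>u. u dvd 1 \<and> to_formal f = u * det A" "det A \<noteq> 0"
    "\<And>v. to_formal f dvd vf v (to_formal f) \<Longrightarrow> \<exists>w. \<forall>j. v j = (\<Sum>i\<in>UNIV. w i * A $ i $ j)"
proof -
  let ?f = "to_formal f"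
  have sq: "squarefree f" using free by (simp add: free_germ_def)
  have f0: "f \<noteq> 0" using sq by auto
  obtain B where B: "der_basis B (log_der cps_scale f)" using free by (auto simp: free_germ_def)
  interpret D: Modules.module "der_scale :: 'n cps \<Rightarrow> _" by (rule module_der)
  have span: "D.span B = log_der cps_scale f" using B by (auto simp: der_basis_def)
  have fin: "finite B" by (rule finite_der_basis[OF f0 B])
  obtain \<delta> where bij: "bij_betw \<delta> (UNIV :: 'n set) B"
    using finite_same_card_bij[of "UNIV :: 'n set" B] fin card_der_basis[OF f0 B] by auto
  define A0 :: "'n cps^'n^'n" where "A0 = (\<chi> i j. \<delta> i (cps_var j))"
  have \<delta>: "\<delta> i \<in> log_der cps_scale f" for i
    using bij span D.span_base by (auto simp: bij_betw_def)
  have gen: "\<exists>w. \<forall>j. a j = (\<Sum>i\<in>UNIV. w i * A0 $ i $ j)" if "f dvd vf_cps a f" for a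
  proof -
    have "vf_cps a \<in> D.span B" unfolding span log_der_cps_iff using that by blast
    then obtain r where r: "vf_cps a = (\<Sum>b\<in>B. der_scale (r b) b)" unfolding D.span_finite[OF fin] by blast
    have "a j = (\<Sum>i\<in>UNIV. r (\<delta> i) * A0 $ i $ j)" for j
    proof -
      have "a j = vf_cps a (cps_var j)" by simp
      also have "\<dots> = (\<Sum>b\<in>B. r b * b (cps_var j))"
        unfolding r by (simp add: sum_fun_apply der_scale_def)
      also have "\<dots> = (\<Sum>i\<in>UNIV. r (\<delta> i) * A0 $ i $ j)"
        by (simp add: A0_def sum.reindex_bij_betw[OF bij, symmetric])
      finally show ?thesis .
    qed
    then show ?thesis by (intro exI[of _ "\<lambda>i. r (\<delta> i)"]) blast
  qed
  have genM: "det A0 dvd det M" if M: "\<And>i. f dvd vf_cps (\<lambda>j. M $ i $ j) f" for M :: "'n cps^'n^'n"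
  proof -
    have "\<forall>i. \<exists>w. \<forall>j. M $ i $ j = (\<Sum>k\<in>UNIV. w k * A0 $ k $ j)" using gen[OF M] by blast
    then obtain w where "\<And>i j. M $ i $ j = (\<Sum>k\<in>UNIV. w i k * A0 $ k $ j)" by metis
    then have "M = (\<chi> i k. w i k) ** A0" by (simp add: vec_eq_iff matrix_matrix_mult_def)
    then show ?thesis by (simp add: det_mul)
  qed
  \<comment> \<open>For a unit every derivation would be logarithmic, including the sum of all
    partial derivatives, which is not singular.\<close>
  have nonunit: "\<not> f dvd 1"
  proof
    assume "f dvd 1"
    then have "f dvd g" for g by (meson dvd_trans one_dvd)
    then have "vf_cps (\<lambda>_. 1) \<in> log_der cps_scale f" unfolding log_der_cps_iff by blast
    with sing have "singular_der cps_var (vf_cps (\<lambda>_ :: 'n. 1))" by blast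
    then have "vf_cps (\<lambda>_ :: 'n. 1) (cps_var i) \<in> max_ideal cps_var" for i
      unfolding singular_der_def by blast
    from max_ideal_cps[OF this] show False by (simp add: mps_coeff_one)
  qed
  define A :: "'n mps^'n^'n" where "A = (\<chi> i j. to_formal (A0 $ i $ j))"
  have detA: "det A = to_formal (det A0)"
    unfolding A_def by (rule det_hom[symmetric]) auto
  have rows: "?f dvd vf (\<lambda>j. A $ i $ j) ?f" for i
  proof -
    obtain a where a: "\<delta> i = vf_cps a" "f dvd vf_cps a f" using \<delta>[of i] unfolding log_der_cps_iff by blast
    have "to_formal f dvd to_formal (vf_cps a f)" using a(2) by (simp only: to_formal_dvd_iff)
    then show ?thesis by (simp add: A_def A0_def a(1) to_formal_vf_cps)
  qed
  have ord: "A $ i $ j \<in> ordge 1" for i j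
  proof -
    have "\<delta> i (cps_var j) \<in> max_ideal cps_var" using sing \<delta> by (auto simp: singular_der_def)
    from max_ideal_cps[OF this] show ?thesis unfolding ordge_1_iff by (simp add: A_def A0_def)
  qed
  obtain z m d \<alpha> \<beta> where F: "treg (shift z ?f) m" and d: "d \<noteq> 0"
    "iota d = \<alpha> * shift z ?f + \<beta> * shift z (vf (\<lambda>i. mps_scale (z i) 1) ?f)"
    using squarefree_discriminant[OF sq] by blast
  obtain h where h: "det A = ?f * h" using dvd_det_of_log_rows[OF F d rows] by blast
  \<comment> \<open>If \<open>z\<close> were zero the derivative along \<open>z\<close> would
    vanish, and cancelling it would make \<open>f\<close> divide \<open>1\<close>.\<close>
  obtain j0 where j0: "z j0 \<noteq> 0"
  proof -
    have "\<exists>j. z j \<noteq> 0"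
    proof (rule ccontr)
      assume "\<not> ?thesis"
      then have "vf (\<lambda>i. mps_scale (z i) 1) ?f = 0" by (simp add: vf_def)
      then have "?f dvd 1" using dvd_of_dvd_mult_derivative[OF F d, of 1] by simp
      then have "to_formal f dvd to_formal 1" by simp
      with nonunit show False by (simp only: to_formal_dvd_iff)
    qed
    then show ?thesis using that by blast
  qed
  define c where "c = (\<lambda>i. cps_scale (z i) 1 :: 'n cps)"
  define g where "g = vf_cps c f"
  have to_g: "to_formal g = vf (\<lambda>i. mps_scale (z i) 1) ?f"
    by (simp add: g_def to_formal_vf_cps c_def)
  define n where "n = CARD('n)"
  define N where "N = CARD('n) - 1"
  have nN: "n = Suc N" unfolding n_def N_def using zero_less_card_finite[where 'a = 'n] by simp
  have f0': "?f \<noteq> 0" using f0 by simp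
  have "h dvd ?f ^ N"
  proof -
    \<comment> \<open>The rows are \<open>f\<close> times the partial derivatives; cancelling one
      factor \<open>f\<close> from the determinant leaves the exponent \<open>N\<close>, one less
      than the number of variables.\<close>
    define M :: "'n cps^'n^'n" where "M = (\<chi> i j. if i = j then f else 0)"
    have "det A0 dvd det M"
    proof (rule genM)
      fix i
      have "vf_cps (\<lambda>j. M $ i $ j) f = (\<Sum>j\<in>UNIV. if i = j then f * pd_cps j f else 0)"
        unfolding vf_cps_def by (rule sum.cong) (auto simp: M_def)
      then show "f dvd vf_cps (\<lambda>j. M $ i $ j) f" by simp
    qed
    also have "det M = f ^ n" by (subst det_diagonal) (auto simp: M_def n_def)
    finally have "to_formal (det A0) dvd to_formal (f ^ n)" by (simp only: to_formal_dvd_iff)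
    then have "?f * h dvd ?f * ?f ^ N" by (simp add: detA[symmetric] h nN)
    then show ?thesis by (simp only: dvd_mult_cancel_left f0' simp_thms)
  qed
  moreover have "h dvd vf (\<lambda>i. mps_scale (z i) 1) ?f ^ N"
  proof -
    \<comment> \<open>Row \<open>j0\<close> of \<open>T ** U\<close> is \<open>f\<close> times the
      direction \<open>c\<close>. Any other row \<open>i\<close> is \<open>g\<close> times the
      \<open>i\<close>-th partial derivative minus \<open>pd_cps i f\<close> times that direction,
      which annihilates \<open>f\<close>. The factors \<open>T\<close> and \<open>U\<close> are
      diagonal up to column \<open>j0\<close> and row \<open>j0\<close>, so their determinants can
      be read off.\<close>
    define T :: "'n cps^'n^'n" where
      "T = (\<chi> i k. if i = j0 then (if k = j0 then f else 0) else if k = i then g else if k = j0 then - pd_cps i f else 0)"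
    define U :: "'n cps^'n^'n" where "U = (\<chi> i k. if i = j0 then c k else if k = i then 1 else 0)"
    have TU: "(T ** U) $ i $ j = (if i = j0 then f * c j else (if i = j then g else 0) - pd_cps i f * c j)" for i j
    proof -
      have "(T ** U) $ i $ j = (\<Sum>k\<in>UNIV. T $ i $ k * U $ k $ j)" by (simp add: matrix_matrix_mult_def)
      also have "\<dots> = (\<Sum>k\<in>{i, j0}. T $ i $ k * U $ k $ j)"
        by (rule sum.mono_neutral_right) (auto simp: T_def)
      also have "\<dots> = (if i = j0 then f * c j else (if i = j then g else 0) - pd_cps i f * c j)"
        by (cases "i = j0") (auto simp: T_def U_def)
      finally show ?thesis .
    qed
    have "det A0 dvd det (T ** U)"
    proof (rule genM)
      fix i
      show "f dvd vf_cps (\<lambda>j. (T ** U) $ i $ j) f"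
      proof (cases "i = j0")
        case True
        then have "vf_cps (\<lambda>j. (T ** U) $ i $ j) f = f * g"
          by (simp add: vf_cps_def TU g_def sum_distrib_left mult.assoc)
        then show ?thesis by simp
      next
        case False
        have "vf_cps (\<lambda>j. (T ** U) $ i $ j) f = (\<Sum>j\<in>UNIV. (if i = j then g * pd_cps j f else 0) - pd_cps i f * (c j * pd_cps j f))"
          unfolding vf_cps_def using False by (intro sum.cong) (auto simp: TU algebra_simps)
        also have "\<dots> = 0"
          unfolding sum_subtractf sum_distrib_left[symmetric] by (simp add: g_def vf_cps_def mult.commute)
        finally show ?thesis by simp
      qed
    qed
    also have "det (T ** U) = (f * g ^ N) * c j0"
    proof -
      have "det T = det (transpose T)" by (simp add: det_transpose)
      also have "\<dots> = (\<Prod>i\<in>UNIV. transpose T $ i $ i)"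
        by (rule det_diagonal_except_row[of j0]) (auto simp: T_def transpose_def)
      also have "\<dots> = (\<Prod>i\<in>UNIV. if i = j0 then f else g)"
        by (rule prod.cong) (auto simp: T_def transpose_def)
      also have "\<dots> = f * (\<Prod>i\<in>UNIV - {j0}. if i = j0 then f else g)"
        by (subst prod.remove[of _ j0]) auto
      also have "(\<Prod>i\<in>UNIV - {j0}. if i = j0 then f else g) = (\<Prod>i\<in>UNIV - {j0}. g)"
        by (rule prod.cong) auto
      also have "\<dots> = g ^ N" by (simp add: N_def card_Diff_singleton)
      finally have T: "det T = f * g ^ N" .
      have "det U = (\<Prod>i\<in>UNIV. U $ i $ i)"
        by (rule det_diagonal_except_row[of j0]) (auto simp: U_def)
      also have "\<dots> = (\<Prod>i\<in>UNIV. if i = j0 then c j0 else 1)"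
        by (rule prod.cong) (auto simp: U_def)
      also have "\<dots> = c j0" by simp
      finally show ?thesis by (simp add: det_mul T)
    qed
    finally have "to_formal (det A0) dvd to_formal ((f * g ^ N) * c j0)" by (simp only: to_formal_dvd_iff)
    then have "?f * h dvd ?f * (to_formal g ^ N * mps_scale (z j0) 1)"
      by (simp add: detA[symmetric] h c_def mult.assoc)
    then have "h dvd to_formal g ^ N * mps_scale (z j0) 1"
      by (simp only: dvd_mult_cancel_left f0' simp_thms)
    then have "h dvd to_formal g ^ N * mps_scale (z j0) 1 * mps_scale (inverse (z j0)) 1" by (rule dvd_mult2)
    also have "\<dots> = to_formal g ^ N" using j0 by (simp add: mult.assoc mps_scale_mult)
    finally show ?thesis by (simp add: to_g)
  qed
  ultimately have hu: "h dvd 1" by (rule unit_of_dvd_powers[OF F d])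
  then obtain u where u: "1 = h * u" by blast
  then have "?f = u * det A" by (simp add: h mult_ac flip: u)
  moreover have "u dvd 1" using u by (metis dvd_triv_right)
  ultimately have unit: "\<exists>u. u dvd 1 \<and> ?f = u * det A" by blast
  have nz: "det A \<noteq> 0" using unit f0' by auto
  have "\<exists>w. \<forall>j. v j = (\<Sum>i\<in>UNIV. w i * A $ i $ j)" if v: "?f dvd vf v ?f" for v
  proof -
    \<comment> \<open>After replacing row \<open>k\<close> by \<open>v\<close> all rows are still
      logarithmic, so the determinant is a multiple of \<open>f\<close> and hence of
      \<open>det A\<close>; the quotients are Cramer's coefficients.\<close>
    have "\<exists>w. det (\<chi> i j. if i = k then v j else A $ i $ j) = w * det A" for k
    proof -
      have "?f dvd det (\<chi> i j. if i = k then v j else A $ i $ j)"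
      proof (rule dvd_det_of_log_rows[OF F d])
        fix i
        show "?f dvd vf (\<lambda>j. (\<chi> i j. if i = k then v j else A $ i $ j) $ i $ j) ?f"
          using v rows by (cases "i = k") auto
      qed
      moreover have "det A dvd ?f" using unit by auto
      ultimately have "det A dvd det (\<chi> i j. if i = k then v j else A $ i $ j)" by (rule dvd_trans[rotated])
      then obtain w where "det (\<chi> i j. if i = k then v j else A $ i $ j) = det A * w" by (elim dvdE)
      then show ?thesis by (intro exI[of _ w]) (simp only: mult.commute)
    qed
    then have "\<forall>k. \<exists>w. det (\<chi> i j. if i = k then v j else A $ i $ j) = w * det A" by (rule allI)
    from choice[OF this] obtain w where "\<forall>k. det (\<chi> i j. if i = k then v j else A $ i $ j) = w k * det A" ..
    then have "v j = (\<Sum>i\<in>UNIV. w i * A $ i $ j)" for j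
      by (intro row_combination_idom[OF nz]) (rule spec)
    then show ?thesis by (intro exI[of _ w]) (rule allI)
  qed
  then show ?thesis using that rows ord unit nz by blast
qed

section \<open>Jordan decomposition of filtered operators\<close>

definition act :: "('n::finite mps \<Rightarrow> 'n mps) \<Rightarrow> complex poly \<Rightarrow> 'n mps \<Rightarrow> 'n mps" where
  "act T p h = (\<Sum>i\<le>degree p. mps_scale (coeff p i) ((T ^^ i) h))"

lemma topspace_mps [simp]: "topspace (mps_topology :: 'n::finite mps topology) = UNIV"
  using openin_subset[of "mps_topology" "UNIV :: 'n mps set"] by (auto simp: openin_adic_topology)

lemma closed_approx:
  fixes H :: "'n::finite mps set"
  assumes "closedin mps_topology H" "\<And>k. \<exists>s\<in>H. g - s \<in> ordge k"
  shows "g \<in> H"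
proof (rule ccontr)
  assume g: "g \<notin> H"
  have "openin mps_topology (UNIV - H)" using assms(1) by (simp add: closedin_def)
  then obtain k where k: "\<And>h. h - g \<in> ordge k \<Longrightarrow> h \<notin> H"
    using g unfolding openin_adic_topology ideal_power_mps by blast
  obtain s where s: "s \<in> H" "g - s \<in> ordge k" using assms(2) by blast
  have "- (g - s) \<in> ordge k" using s(2) by (rule ordge_uminus)
  with k s(1) show False by simp
qed

text \<open>Such operators act on the finite-dimensional quotients by \<open>ordge k\<close>; the
  decomposition is computed there and glued along \<open>k\<close>. The locale is used again for the
  semisimple part \<open>ss\<close>.\<close>

locale filtered_op =
  fixes T :: "'n::finite mps \<Rightarrow> 'n mps"
  assumes T_add: "T (f + g) = T f + T g"
    and T_scale: "T (mps_scale z f) = mps_scale z (T f)"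
    and T_ordge: "f \<in> ordge k \<Longrightarrow> T f \<in> ordge k"
begin

lemma T_zero [simp]: "T 0 = 0"
  using T_scale[of 0 0] by simp

lemma T_diff: "T (f - g) = T f - T g"
  using T_add[of "f - g" g] by (simp add: algebra_simps)

lemma T_sum: "T (sum h I) = (\<Sum>i\<in>I. T (h i))"
  by (rule module_hom_sumD) (rule T_add)

lemma act_0 [simp]: "act T 0 h = 0"
  by (simp add: act_def)

lemma act_pCons: "act T (pCons a p) h = mps_scale a h + T (act T p h)"
proof (cases "p = 0")
  case True
  then show ?thesis by (cases "a = 0") (auto simp: act_def)
next
  case False
  have "act T (pCons a p) h = (\<Sum>i\<le>Suc (degree p). mps_scale (coeff (pCons a p) i) ((T ^^ i) h))"
    using False by (simp add: act_def)
  also have "\<dots> = mps_scale a h + (\<Sum>i\<le>degree p. mps_scale (coeff p i) (T ((T ^^ i) h)))"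
    by (subst sum.atMost_Suc_shift) simp
  also have "(\<Sum>i\<le>degree p. mps_scale (coeff p i) (T ((T ^^ i) h))) = T (act T p h)"
    by (simp add: act_def T_sum T_scale)
  finally show ?thesis .
qed

lemma act_1 [simp]: "act T 1 h = h"
  by (simp add: act_def)

lemma act_add: "act T (p + q) h = act T p h + act T q h"
proof (induction p q rule: poly_induct2)
  case (pCons a p b q)
  then show ?case by (simp add: act_pCons T_add mps_scale_add)
qed simp

lemma act_smult: "act T (smult a p) h = mps_scale a (act T p h)"
  by (induction p) (simp_all add: act_pCons T_scale mps_scale_add)

lemma act_diff: "act T (p - q) h = act T p h - act T q h"
  using act_add[of "p - q" q h] by (simp add: algebra_simps)

lemma act_sum: "act T (sum p I) h = (\<Sum>i\<in>I. act T (p i) h)"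
  by (rule module_hom_sumD) (rule act_add)

lemma act_mult: "act T (p * q) h = act T p (act T q h)"
  by (induction p) (simp_all add: act_pCons act_add act_smult)

lemma act_plus: "act T p (g + h) = act T p g + act T p h"
  by (induction p) (simp_all add: act_pCons T_add mps_scale_add)

lemma act_scale: "act T p (mps_scale z h) = mps_scale z (act T p h)"
  by (induction p) (simp_all add: act_pCons T_scale mps_scale_add mult.commute)

lemma act_minus: "act T p (g - h) = act T p g - act T p h"
  using act_plus[of p "g - h" h] by (simp add: algebra_simps)

lemma act_sum': "act T p (sum h I) = (\<Sum>i\<in>I. act T p (h i))"
  by (rule module_hom_sumD) (rule act_plus)

lemma act_commute: "act T p (T h) = T (act T p h)"
  by (induction p) (simp_all add: act_pCons T_add T_scale)

lemma act_ordge: "h \<in> ordge k \<Longrightarrow> act T p h \<in> ordge k"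
  by (induction p) (simp_all add: act_pCons ordge_add ordge_scale T_ordge)

lemma act_eigen:
  assumes "T h = mps_scale l h"
  shows "act T p h = mps_scale (poly p l) h"
  by (induction p) (simp_all add: act_pCons T_scale assms mps_scale_add mult.commute)

lemma act_subspace:
  assumes "0 \<in> H" "\<And>g h. g \<in> H \<Longrightarrow> h \<in> H \<Longrightarrow> g + h \<in> H" "\<And>z h. h \<in> H \<Longrightarrow> mps_scale z h \<in> H"
    "\<And>h. h \<in> H \<Longrightarrow> T h \<in> H" "h \<in> H"
  shows "act T p h \<in> H"
  by (induction p) (simp_all add: act_pCons assms)

text \<open>The polynomials acting as zero modulo order \<open>k\<close>. Calculations modulo this
  ideal take the place of calculations with endomorphisms of the quotient.\<close>

definition Ann :: "nat \<Rightarrow> complex poly set" where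
  "Ann k = {p. \<forall>h. act T p h \<in> ordge k}"

lemma AnnD: "p \<in> Ann k \<Longrightarrow> act T p h \<in> ordge k"
  by (simp add: Ann_def)

lemma Ann_add: "p \<in> Ann k \<Longrightarrow> q \<in> Ann k \<Longrightarrow> p + q \<in> Ann k"
  and Ann_diff: "p \<in> Ann k \<Longrightarrow> q \<in> Ann k \<Longrightarrow> p - q \<in> Ann k"
  and Ann_0: "0 \<in> Ann k"
  by (simp_all add: Ann_def act_add act_diff ordge_add ordge_diff)

lemma Ann_sum: "(\<And>i. i \<in> I \<Longrightarrow> p i \<in> Ann k) \<Longrightarrow> sum p I \<in> Ann k"
  by (induction I rule: infinite_finite_induct) (auto intro: Ann_add Ann_0)

lemma Ann_mult: "p \<in> Ann k \<Longrightarrow> q * p \<in> Ann k"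
  by (simp add: Ann_def act_mult act_ordge)

lemma Ann_dvd: "p \<in> Ann k \<Longrightarrow> p dvd q \<Longrightarrow> q \<in> Ann k"
  using Ann_mult by (metis dvdE mult.commute)

lemma Ann_antimono: "j \<le> k \<Longrightarrow> p \<in> Ann k \<Longrightarrow> p \<in> Ann j"
  by (auto simp: Ann_def intro: ordge_antimono)

text \<open>The iterates of \<open>s\<close>, truncated below degree \<open>k\<close>, lie in the
  span of finitely many monomials, so sufficiently many of them are linearly dependent.\<close>

lemma annihilator_single: "\<exists>p. p \<noteq> 0 \<and> act T p s \<in> ordge k"
proof -
  interpret V: vector_space "mps_scale :: complex \<Rightarrow> 'n mps \<Rightarrow> 'n mps"
    by unfold_locales (auto intro!: mps_eqI simp: algebra_simps)
  define I where "I = {a :: 'n \<Rightarrow> nat. mdeg a < k}"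
  have I: "finite I" unfolding I_def by (rule finite_subset[OF _ finite_mdeg_le[of k]]) auto
  define tr where "tr f = (\<Sum>a\<in>I. mps_scale (mps_coeff f a) (mono_mps a))" for f :: "'n mps"
  have tr_coeff: "mps_coeff (tr f) c = (if mdeg c < k then mps_coeff f c else 0)" for f c
  proof -
    have "mps_coeff (tr f) c = (\<Sum>a\<in>I. if a = c then mps_coeff f c else 0)"
      unfolding tr_def mps_coeff_sum by (rule sum.cong) (auto simp: mps_coeff_mono)
    then show ?thesis using I by (simp add: I_def)
  qed
  have tr_ordge: "f \<in> ordge k" if "tr f = 0" for f
  proof -
    have "mps_coeff (tr f) c = 0" for c using that by simp
    then have z: "(if mdeg c < k then mps_coeff f c else 0) = 0" for c unfolding tr_coeff .
    show ?thesis
      unfolding ordge_def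
    proof (intro CollectI allI impI)
      fix c :: "'n \<Rightarrow> nat" assume "mdeg c < k"
      then show "mps_coeff f c = 0" using z[of c] by simp
    qed
  qed
  have tr_lin: "tr (mps_scale z f) = mps_scale z (tr f)" "tr (f + g) = tr f + tr g" for z f g
    by (auto intro!: mps_eqI simp: tr_coeff)
  have tr_sum: "tr (sum h A) = (\<Sum>i\<in>A. tr (h i))" for h and A :: "nat set"
    by (rule module_hom_sumD) (rule tr_lin)
  have tr_span: "tr f \<in> V.span (mono_mps ` I)" for f
    unfolding tr_def by (intro V.span_sum V.span_scale V.span_base) auto
  define N where "N = card (mono_mps ` I :: 'n mps set)"
  define v where "v i = tr ((T ^^ i) s)" for i
  have "\<exists>c. (\<exists>i\<le>N. c i \<noteq> 0) \<and> (\<Sum>i\<le>N. mps_scale (c i) (v i)) = 0"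
  proof (cases "inj_on v {..N}")
    case False
    then obtain i j where ij: "i \<le> N" "j \<le> N" "i \<noteq> j" "v i = v j" by (auto simp: inj_on_def)
    define c where "c l = (if l = i then 1 else if l = j then - 1 else 0 :: complex)" for l
    have "(\<Sum>l\<le>N. mps_scale (c l) (v l)) = (\<Sum>l\<in>{i, j}. mps_scale (c l) (v l))"
      using ij by (intro sum.mono_neutral_right) (auto simp: c_def)
    also have "\<dots> = 0" using ij by (auto simp: c_def intro!: mps_eqI)
    finally show ?thesis using ij by (intro exI[of _ c]) (auto simp: c_def)
  next
    case True
    have "V.dependent (v ` {..N})"
    proof (rule ccontr)
      assume "\<not> V.dependent (v ` {..N})"
      moreover have "v ` {..N} \<subseteq> V.span (mono_mps ` I)" using tr_span by (auto simp: v_def)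
      ultimately have "card (v ` {..N}) \<le> card (mono_mps ` I :: 'n mps set)"
        using V.independent_span_bound[of "mono_mps ` I" "v ` {..N}"] I by simp
      then have "card (v ` {..N}) \<le> N" unfolding N_def .
      then show False using card_image[OF True] by simp
    qed
    then obtain u where u: "\<exists>x\<in>v ` {..N}. u x \<noteq> 0" "(\<Sum>x\<in>v ` {..N}. mps_scale (u x) x) = 0"
      by (auto simp: V.dependent_finite)
    then show ?thesis
      by (intro exI[of _ "\<lambda>i. u (v i)"]) (auto simp: sum.reindex[OF True])
  qed
  then obtain c i0 where c: "i0 \<le> N" "c i0 \<noteq> 0" "(\<Sum>i\<le>N. mps_scale (c i) (v i)) = 0" by blast
  define p where "p = (\<Sum>i\<le>N. monom (c i) i)"
  have cp: "coeff p i = (if i \<le> N then c i else 0)" for i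
    by (simp add: p_def coeff_sum)
  have m: "act T (monom z i) s = mps_scale z ((T ^^ i) s)" for z i
    by (induction i) (simp_all add: monom_0 monom_Suc act_pCons T_scale)
  have "tr (act T p s) = (\<Sum>i\<le>N. mps_scale (c i) (v i))"
    by (simp add: p_def act_sum m tr_sum tr_lin v_def)
  then have "act T p s \<in> ordge k" using c by (intro tr_ordge) simp
  moreover have "p \<noteq> 0" using c cp[of i0] by auto
  ultimately show ?thesis by blast
qed

text \<open>Polynomials in \<open>T\<close> commute, so the product of annihilators for the finitely
  many monomials below degree \<open>k\<close> annihilates them all.\<close>

lemma annihilator_ex: "\<exists>p. p \<noteq> 0 \<and> p \<in> Ann k"
proof -
  have fin: "\<exists>p. p \<noteq> 0 \<and> (\<forall>s\<in>S. act T p s \<in> ordge k)" if "finite S" for S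
    using that
  proof (induction S rule: finite_induct)
    case empty
    show ?case by (intro exI[of _ 1]) auto
  next
    case (insert x S)
    then obtain p where p: "p \<noteq> 0" "\<forall>s\<in>S. act T p s \<in> ordge k" by blast
    obtain q where q: "q \<noteq> 0" "act T q x \<in> ordge k" using annihilator_single by blast
    have "act T (p * q) s \<in> ordge k" if "s \<in> insert x S" for s
    proof (cases "s = x")
      case True
      then show ?thesis using q by (simp add: act_mult act_ordge)
    next
      case False
      then show ?thesis using p that by (simp add: act_mult act_ordge mult.commute[of p])
    qed
    then show ?case using p q by (intro exI[of _ "p * q"]) auto
  qed
  define I where "I = {a :: 'n \<Rightarrow> nat. mdeg a < k}"
  have I: "finite I" unfolding I_def by (rule finite_subset[OF _ finite_mdeg_le[of k]]) auto
  obtain p where p: "p \<noteq> 0" "\<forall>s\<in>mono_mps ` I. act T p s \<in> ordge k" using fin[of "mono_mps ` I"] I by blast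
  have "act T p h \<in> ordge k" for h
  proof -
    define g where "g = (\<Sum>a\<in>I. mps_scale (mps_coeff h a) (mono_mps a))"
    have "mps_coeff g c = (if mdeg c < k then mps_coeff h c else 0)" for c
    proof -
      have "mps_coeff g c = (\<Sum>a\<in>I. if a = c then mps_coeff h c else 0)"
        unfolding g_def mps_coeff_sum by (rule sum.cong) (auto simp: mps_coeff_mono)
      then show ?thesis using I by (simp add: I_def)
    qed
    then have "h - g \<in> ordge k" by (simp add: ordge_def)
    then have "act T p (h - g) \<in> ordge k" by (rule act_ordge)
    moreover have "act T p g \<in> ordge k"
      unfolding g_def act_sum' act_scale using p by (intro ordge_sum ordge_scale) auto
    ultimately have "act T p (h - g) + act T p g \<in> ordge k" by (rule ordge_add)
    then show ?thesis by (simp add: act_minus)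
  qed
  then show ?thesis using p by (auto simp: Ann_def)
qed

text \<open>Any nonzero annihilator serves; it is neither minimal nor compatible for different
  \<open>k\<close>. Consequently \<open>evs k\<close> may contain numbers that are not eigenvalues;
  their projections are zero modulo order \<open>k\<close>.\<close>

definition chi :: "nat \<Rightarrow> complex poly" where
  "chi k = (SOME p. p \<noteq> 0 \<and> p \<in> Ann k)"

lemma chi: "chi k \<noteq> 0" "chi k \<in> Ann k"
  using someI_ex[OF annihilator_ex[of k]] by (auto simp: chi_def)

definition evs :: "nat \<Rightarrow> complex set" where
  "evs k = {l. poly (chi k) l = 0}"

lemma finite_evs [simp]: "finite (evs k)"
  unfolding evs_def using poly_roots_finite[OF chi(1)] by simp

text \<open>
  Modulo order \<open>k\<close>, a polynomial \<open>e\<close> with the following property acts as the projection to the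
  generalized eigenspace of \<open>l\<close>.
\<close>

definition eproj :: "nat \<Rightarrow> complex \<Rightarrow> complex poly \<Rightarrow> bool" where
  "eproj k l e \<longleftrightarrow> (\<exists>N>0. [:-l, 1:] ^ N * e \<in> Ann k \<and> [:-l, 1:] ^ N dvd 1 - e)"

lemma eproj_antimono: "j \<le> k \<Longrightarrow> eproj k l e \<Longrightarrow> eproj j l e"
  unfolding eproj_def using Ann_antimono by blast

lemma eproj_ex: "\<exists>e. eproj k l e"
proof -
  obtain q where q: "chi k = [:-l, 1:] ^ order l (chi k) * q" "\<not> [:-l, 1:] dvd q"
    using order_decomp[OF chi(1)] by blast
  define n where "n = order l (chi k)"
  define y where "y = smult (inverse (poly q l)) q"
  have "poly q l \<noteq> 0" using q(2) by (simp add: poly_eq_0_iff_dvd)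
  then have "poly (1 - y) l = 0" by (simp add: y_def)
  then have d: "[:-l, 1:] dvd 1 - y" by (simp only: poly_eq_0_iff_dvd)
  \<comment> \<open>An explicit solution of the two congruences: \<open>y\<close> is a multiple of
    \<open>q\<close> with value 1 at \<open>l\<close>, so \<open>y\<close> divides \<open>e\<close>
    while a power of \<open>X - l\<close> divides \<open>1 - e\<close>. The successor keeps the
    exponent positive when \<open>l\<close> is no root of \<open>chi k\<close>.\<close>
  define e where "e = 1 - (1 - y) ^ Suc n"
  have "y dvd e"
  proof -
    have "1 - y - 1 dvd (1 - y) ^ Suc n - 1 ^ Suc n"
      unfolding power_diff_sumr2[of "1 - y" "Suc n" 1] by simp
    then have "- y dvd - e" by (simp add: e_def)
    then show ?thesis by simp
  qed
  moreover have "q dvd y" by (simp add: y_def dvd_smult)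
  ultimately have "q dvd e" by (rule dvd_trans[rotated])
  then have "[:-l, 1:] ^ n * q dvd [:-l, 1:] ^ Suc n * e"
    by (intro mult_dvd_mono le_imp_power_dvd) auto
  moreover have "chi k = [:-l, 1:] ^ n * q" unfolding n_def by (rule q(1))
  ultimately have "chi k dvd [:-l, 1:] ^ Suc n * e" by (rule ssubst[rotated])
  then have "[:-l, 1:] ^ Suc n * e \<in> Ann k" by (rule Ann_dvd[OF chi(2)])
  moreover have "[:-l, 1:] ^ Suc n dvd 1 - e"
    unfolding e_def using dvd_power_same[OF d, of "Suc n"] by simp
  ultimately show ?thesis unfolding eproj_def by blast
qed

lemma power_mod_Ann:
  assumes "p * (1 - p) \<in> Ann k"
  shows "p ^ Suc j - p \<in> Ann k"
proof (induction j)
  case (Suc j)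
  have "p ^ Suc (Suc j) - p = p * (p ^ Suc j - p) - p * (1 - p)" by (simp add: algebra_simps)
  then show ?case using Ann_diff[OF Ann_mult[OF Suc] assms] by simp
qed (simp add: Ann_0)

lemma eproj_idem:
  assumes "eproj k l e"
  shows "e * (1 - e) \<in> Ann k"
proof -
  obtain N c where "[:-l, 1:] ^ N * e \<in> Ann k" "1 - e = [:-l, 1:] ^ N * c"
    using assms by (auto simp: eproj_def dvd_def)
  then show ?thesis using Ann_mult[of "[:-l, 1:] ^ N * e" k c] by (simp add: mult_ac)
qed

text \<open>Modulo \<open>Ann\<close>, \<open>1 - e\<close> is an idempotent divisible by \<open>X - l\<close>, hence by all powers of \<open>X - l\<close>.\<close>

lemma eproj_absorb:
  assumes "eproj k l e" "[:-l, 1:] ^ m * p \<in> Ann k"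
  shows "p * (1 - e) \<in> Ann k"
proof -
  obtain N c where N: "N > 0" "1 - e = [:-l, 1:] ^ N * c" using assms by (auto simp: eproj_def dvd_def)
  have "[:-l, 1:] ^ m dvd ([:-l, 1:] ^ N) ^ Suc m"
    unfolding power_mult[symmetric] using N(1) by (intro le_imp_power_dvd) (cases N, auto)
  then have "[:-l, 1:] ^ m dvd (1 - e) ^ Suc m"
    unfolding N(2) power_mult_distrib by (rule dvd_mult2)
  then have "[:-l, 1:] ^ m * p dvd (1 - e) ^ Suc m * p" by (rule mult_dvd_mono) simp
  then have 1: "(1 - e) ^ Suc m * p \<in> Ann k" by (rule Ann_dvd[OF assms(2)])
  have "(1 - e) * (1 - (1 - e)) \<in> Ann k" using eproj_idem[OF assms(1)] by (simp add: mult.commute)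
  from power_mod_Ann[OF this, of m] have "p * ((1 - e) ^ Suc m - (1 - e)) \<in> Ann k" by (rule Ann_mult)
  from Ann_diff[OF 1 this] show ?thesis by (simp add: algebra_simps)
qed

text \<open>Each absorbs the other, so both are congruent to \<open>e * e'\<close>. This makes the
  choices for different \<open>k\<close> fit together.\<close>

lemma eproj_unique:
  assumes "eproj k l e" "eproj k l e'"
  shows "e - e' \<in> Ann k"
proof -
  have "e * (1 - e') \<in> Ann k" "e' * (1 - e) \<in> Ann k"
    using assms eproj_absorb unfolding eproj_def by blast+
  from Ann_diff[OF this] show ?thesis by (simp add: algebra_simps)
qed

text \<open>Powers of \<open>X - l\<close> and \<open>X - l'\<close> generate the unit ideal, and
  each of them kills one of the factors.\<close>

lemma eproj_orth:
  assumes "eproj k l e" "eproj k l' e'" "l \<noteq> l'"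
  shows "e * e' \<in> Ann k"
proof -
  obtain N where N: "[:-l, 1:] ^ N * e \<in> Ann k" using assms by (auto simp: eproj_def)
  obtain M where M: "[:-l', 1:] ^ M * e' \<in> Ann k" using assms by (auto simp: eproj_def)
  define z where "z = inverse (l' - l)"
  have "[:z:] * [:-l, 1:] + [:-z:] * [:-l', 1:] = [:z * (l' - l):]" by (simp add: algebra_simps)
  also have "\<dots> = 1" using assms(3) by (simp add: z_def one_pCons)
  finally have one: "[:z:] * [:-l, 1:] + [:-z:] * [:-l', 1:] = 1" .
  obtain u v where "([:z:] * [:-l, 1:] + [:-z:] * [:-l', 1:]) ^ (N + M) = [:-l, 1:] ^ N * u + [:-l', 1:] ^ M * v"
    using power_sum_ideal by blast
  then have "1 = [:-l, 1:] ^ N * u + [:-l', 1:] ^ M * v" unfolding one by simp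
  then have "e * e' = ([:-l, 1:] ^ N * u + [:-l', 1:] ^ M * v) * (e * e')" by (metis mult_1)
  also have "\<dots> = (u * e') * ([:-l, 1:] ^ N * e) + (v * e) * ([:-l', 1:] ^ M * e')"
    by (simp only: algebra_simps)
  also have "\<dots> \<in> Ann k" by (intro Ann_add Ann_mult N M)
  finally show ?thesis .
qed

text \<open>By orthogonality the product \<open>Q\<close> of all \<open>1 - e l\<close> is congruent
  to one minus the sum and idempotent. It is divisible by \<open>X - l\<close> for every root
  \<open>l\<close> of \<open>chi k\<close>, so a power of \<open>Q\<close> is a multiple of
  \<open>chi k\<close>; idempotency then puts \<open>Q\<close> itself into
  \<open>Ann k\<close>.\<close>

lemma eproj_partition:
  assumes e: "\<And>l. eproj k l (e l)"
  shows "1 - (\<Sum>l\<in>evs k. e l) \<in> Ann k"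
proof -
  define Q where "Q = (\<Prod>l\<in>evs k. 1 - e l)"
  have prod: "(\<Prod>l\<in>F. 1 - e l) - (1 - (\<Sum>l\<in>F. e l)) \<in> Ann k" if "finite F" for F
    using that
  proof (induction F rule: finite_induct)
    case (insert x F)
    have "(\<Prod>l\<in>insert x F. 1 - e l) - (1 - (\<Sum>l\<in>insert x F. e l)) =
      (1 - e x) * ((\<Prod>l\<in>F. 1 - e l) - (1 - (\<Sum>l\<in>F. e l))) + (\<Sum>l\<in>F. e x * e l)"
      using insert.hyps by (simp add: algebra_simps sum_distrib_left)
    moreover have "(\<Sum>l\<in>F. e x * e l) \<in> Ann k"
      using insert.hyps by (intro Ann_sum eproj_orth[OF e e]) auto
    ultimately show ?case using Ann_add[OF Ann_mult[OF insert.IH]] by metis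
  qed (simp add: Ann_0)
  have idem: "Q * (1 - Q) \<in> Ann k"
  proof -
    have "e l * Q \<in> Ann k" if l: "l \<in> evs k" for l
    proof -
      have "Q = (1 - e l) * (\<Prod>m\<in>evs k - {l}. 1 - e m)"
        unfolding Q_def by (rule prod.remove) (auto simp: l)
      then have "e l * Q = (\<Prod>m\<in>evs k - {l}. 1 - e m) * (e l * (1 - e l))" by (simp only: mult_ac)
      then show ?thesis by (simp only: Ann_mult[OF eproj_idem[OF e]])
    qed
    then have 1: "(\<Sum>l\<in>evs k. e l * Q) \<in> Ann k" by (rule Ann_sum)
    have "Q * (1 - Q) = (\<Sum>l\<in>evs k. e l * Q) - Q * (Q - (1 - (\<Sum>l\<in>evs k. e l)))"
      by (simp add: algebra_simps sum_distrib_left sum_distrib_right)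
    then show ?thesis
      using Ann_diff[OF 1 Ann_mult[OF prod[OF finite_evs]]] by (simp only: Q_def)
  qed
  have dvdQ: "[:-l, 1:] dvd Q" if l: "l \<in> evs k" for l
  proof -
    obtain N where N: "N > 0" "[:-l, 1:] ^ N dvd 1 - e l" using e[of l] by (auto simp: eproj_def)
    have "[:-l, 1:] ^ 1 dvd [:-l, 1:] ^ N" using N(1) by (intro le_imp_power_dvd) auto
    then have "[:-l, 1:] dvd 1 - e l" using N(2) dvd_trans by (metis power_one_right)
    also have "1 - e l dvd Q" unfolding Q_def using l by (intro dvd_prodI) auto
    finally show ?thesis .
  qed
  obtain R where R: "chi k = smult (lead_coeff (chi k)) (\<Prod>x\<in>#R. [:-x, 1:])"
    using alg_closed_imp_factorization[OF chi(1)[of k]] by blast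
  have "x \<in> evs k" if "x \<in># R" for x
  proof -
    have "poly (\<Prod>x\<in>#R. [:-x, 1:]) x = 0" using that by (auto simp: poly_prod_mset prod_mset_zero_iff)
    then show ?thesis unfolding evs_def by (subst R) simp
  qed
  then have "(\<Prod>x\<in>#R. [:-x, 1:]) dvd Q ^ size R"
  proof (induction R)
    case (add x R)
    have "[:-x, 1:] * (\<Prod>x\<in>#R. [:-x, 1:]) dvd Q * Q ^ size R"
      using add by (intro mult_dvd_mono dvdQ) auto
    then show ?case by (simp only: image_mset_add_mset prod_mset.add_mset size_add_mset power_Suc)
  qed simp
  then have "(\<Prod>x\<in>#R. [:-x, 1:]) dvd Q ^ Suc (size R)" by (simp add: dvd_mult)
  then have "chi k dvd Q ^ Suc (size R)"
    using chi(1)[of k] by (subst R) (simp add: smult_dvd_iff)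
  then have "Q ^ Suc (size R) \<in> Ann k" by (rule Ann_dvd[OF chi(2)])
  from Ann_diff[OF this power_mod_Ann[OF idem, of "size R"]] have "Q \<in> Ann k" by simp
  from Ann_diff[OF this prod[OF finite_evs, of k, folded Q_def]] show ?thesis by simp
qed

section \<open>Projections to generalized eigenspaces as limits\<close>

definition ep :: "nat \<Rightarrow> complex \<Rightarrow> complex poly" where
  "ep k l = (SOME e. eproj k l e)"

lemma ep: "eproj k l (ep k l)"
  unfolding ep_def using someI_ex[OF eproj_ex] .

text \<open>The coefficient at \<open>c\<close> is visible modulo order \<open>Suc (mdeg c)\<close>
  but not modulo \<open>mdeg c\<close>. By \<open>eproj_unique\<close> any higher order gives the
  same coefficient, so this is the limit of the projections in the quotients.\<close>

definition proj :: "complex \<Rightarrow> 'n mps \<Rightarrow> 'n mps" where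
  "proj l h = Abs_mps (\<lambda>c. mps_coeff (act T (ep (Suc (mdeg c)) l) h) c)"

lemma proj_approx:
  assumes "eproj k l e"
  shows "proj l h - act T e h \<in> ordge k"
  unfolding ordge_def
proof (intro CollectI allI impI)
  fix c :: "'n \<Rightarrow> nat" assume c: "mdeg c < k"
  have "eproj (Suc (mdeg c)) l e" using c by (intro eproj_antimono[OF _ assms]) simp
  from AnnD[OF eproj_unique[OF ep this], of h]
  have "act T (ep (Suc (mdeg c)) l) h - act T e h \<in> ordge (Suc (mdeg c))" by (simp add: act_diff)
  then show "mps_coeff (proj l h - act T e h) c = 0"
    by (simp add: ordge_def proj_def Abs_mps_inverse)
qed

lemma proj_ep: "proj l h - act T (ep k l) h \<in> ordge k"
  by (rule proj_approx[OF ep])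

lemma proj_add: "proj l (g + h) = proj l g + proj l h"
  and proj_scale: "proj l (mps_scale z h) = mps_scale z (proj l h)"
  by (auto intro!: mps_eqI simp: proj_def Abs_mps_inverse act_plus act_scale)

lemma proj_diff: "proj l (g - h) = proj l g - proj l h"
  using proj_add[of l "g - h" h] by (simp add: algebra_simps)

lemma proj_zero [simp]: "proj l 0 = 0"
  using proj_scale[of l 0 0] by simp

lemma proj_sum: "proj l (sum h I) = (\<Sum>i\<in>I. proj l (h i))"
  by (rule module_hom_sumD) (rule proj_add)

lemma proj_ordge: "h \<in> ordge k \<Longrightarrow> proj l h \<in> ordge k"
  using ordge_add[OF proj_ep[of l h k] act_ordge[of h k "ep k l"]] by simp

lemma proj_T: "proj l (T h) = T (proj l h)"
proof (rule ordge_eqI)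
  fix k
  have "T (proj l h - act T (ep k l) h) \<in> ordge k" by (intro T_ordge proj_ep)
  then have "T (proj l h) - act T (ep k l) (T h) \<in> ordge k" by (simp add: T_diff act_commute)
  from ordge_diff[OF proj_ep[of l "T h" k] this] show "proj l (T h) - T (proj l h) \<in> ordge k" by simp
qed

text \<open>If \<open>l\<close> is no root of \<open>chi k\<close>, a scalar multiple of
  \<open>chi k\<close> with value 1 at \<open>l\<close> is itself an admissible projection, and it
  acts as zero modulo order \<open>k\<close>.\<close>

lemma proj_outside:
  assumes "l \<notin> evs k"
  shows "proj l h \<in> ordge k"
proof -
  define e where "e = smult (inverse (poly (chi k) l)) (chi k)"
  have nz: "poly (chi k) l \<noteq> 0" using assms by (simp add: evs_def)
  have "chi k dvd e" by (simp add: e_def dvd_smult)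
  then have e: "e \<in> Ann k" by (rule Ann_dvd[OF chi(2)])
  have "poly (1 - e) l = 0" using nz by (simp add: e_def)
  then have "[:-l, 1:] ^ 1 dvd 1 - e" by (simp only: poly_eq_0_iff_dvd power_one_right)
  then have "eproj k l e" unfolding eproj_def using Ann_mult[OF e] zero_less_one by blast
  from ordge_add[OF proj_approx[OF this, of h] AnnD[OF e, of h]] show ?thesis by simp
qed

lemma proj_proj: "proj l (proj m h) = (if l = m then proj l h else 0)"
proof (rule ordge_eqI)
  fix k
  have "proj l (proj m h - act T (ep k m) h) \<in> ordge k" by (intro proj_ordge proj_ep)
  from ordge_add[OF this proj_ep[of l "act T (ep k m) h" k]]
  have 1: "proj l (proj m h) - act T (ep k l * ep k m) h \<in> ordge k" by (simp add: proj_diff act_mult)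
  show "proj l (proj m h) - (if l = m then proj l h else 0) \<in> ordge k"
  proof (cases "l = m")
    case True
    have "act T (ep k l * (1 - ep k l)) h \<in> ordge k" by (rule AnnD[OF eproj_idem[OF ep]])
    then have "act T (ep k l) h - act T (ep k l * ep k l) h \<in> ordge k" by (simp add: algebra_simps act_diff)
    from ordge_diff[OF ordge_diff[OF 1[unfolded True[symmetric]] this] proj_ep[of l h k]] True
    show ?thesis by (simp add: algebra_simps)
  next
    case False
    have "act T (ep k l * ep k m) h \<in> ordge k" by (rule AnnD[OF eproj_orth[OF ep ep False]])
    from ordge_add[OF 1 this] False show ?thesis by simp
  qed
qed

lemma proj_partition: "h - (\<Sum>l\<in>evs k. proj l h) \<in> ordge k"
proof -
  have "h - (\<Sum>l\<in>evs k. act T (ep k l) h) \<in> ordge k"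
    using AnnD[OF eproj_partition[of k "ep k", OF ep], of h] by (simp add: act_diff act_sum)
  moreover have "(\<Sum>l\<in>evs k. proj l h - act T (ep k l) h) \<in> ordge k" by (intro ordge_sum proj_ep)
  ultimately show ?thesis using ordge_diff by (fastforce simp: sum_subtractf)
qed

lemma proj_all_zero: "(\<And>l. proj l h = 0) \<Longrightarrow> h = 0"
proof (rule ordge_0I)
  fix k assume "\<And>l. proj l h = 0"
  then show "h \<in> ordge k" using proj_partition[of h k] by simp
qed

text \<open>Describes generalized eigenvectors by nilpotency of \<open>T - l\<close> modulo each
  order, the form to which the Leibniz rule applies.\<close>

lemma proj_fixed_iff:
  "proj l h = h \<longleftrightarrow> (\<forall>k. \<exists>m. act T ([:-l, 1:] ^ m) h \<in> ordge k)"
proof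
  assume h: "proj l h = h"
  show "\<forall>k. \<exists>m. act T ([:-l, 1:] ^ m) h \<in> ordge k"
  proof
    fix k
    obtain N where N: "[:-l, 1:] ^ N * ep k l \<in> Ann k" using ep[of k l] by (auto simp: eproj_def)
    have "act T ([:-l, 1:] ^ N) (h - act T (ep k l) h) \<in> ordge k"
      using proj_ep[of l h k] unfolding h by (rule act_ordge)
    from ordge_add[OF this AnnD[OF N, of h]] have "act T ([:-l, 1:] ^ N) h \<in> ordge k"
      by (simp add: act_minus act_mult)
    then show "\<exists>m. act T ([:-l, 1:] ^ m) h \<in> ordge k" by blast
  qed
next
  assume *: "\<forall>k. \<exists>m. act T ([:-l, 1:] ^ m) h \<in> ordge k"
  show "proj l h = h"
  proof (rule ordge_eqI)
    fix k
    obtain m where m: "act T ([:-l, 1:] ^ m) h \<in> ordge k" using * by blast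
    obtain N c where N: "N > 0" "1 - ep k l = [:-l, 1:] ^ N * c" using ep[of k l] by (auto simp: eproj_def dvd_def)
    have "[:-l, 1:] ^ m dvd ([:-l, 1:] ^ N) ^ Suc m"
      unfolding power_mult[symmetric] using N(1) by (intro le_imp_power_dvd) (cases N, auto)
    then have "[:-l, 1:] ^ m dvd (1 - ep k l) ^ Suc m"
      unfolding N(2) power_mult_distrib by (rule dvd_mult2)
    then obtain q where q: "(1 - ep k l) ^ Suc m = q * [:-l, 1:] ^ m" by (metis dvdE mult.commute)
    have 1: "act T ((1 - ep k l) ^ Suc m) h \<in> ordge k" unfolding q act_mult using m by (rule act_ordge)
    have "(1 - ep k l) * (1 - (1 - ep k l)) \<in> Ann k" using eproj_idem[OF ep[of k l]] by (simp add: mult.commute)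
    from AnnD[OF power_mod_Ann[OF this, of m], of h]
    have "act T ((1 - ep k l) ^ Suc m) h - (h - act T (ep k l) h) \<in> ordge k" by (simp only: act_diff act_1)
    from ordge_diff[OF this 1] have "- (h - act T (ep k l) h) \<in> ordge k" by simp
    from ordge_add[OF this proj_ep[of l h k]] show "proj l h - h \<in> ordge k" by simp
  qed
qed

text \<open>Sums of families that vanish modulo order \<open>k\<close> outside of the finite set \<open>evs k\<close>.\<close>

definition esum :: "(complex \<Rightarrow> 'n mps) \<Rightarrow> 'n mps" where
  "esum a = Abs_mps (\<lambda>c. \<Sum>l\<in>evs (Suc (mdeg c)). mps_coeff (a l) c)"

lemma esum_approx:
  assumes a: "\<And>k l. l \<notin> evs k \<Longrightarrow> a l \<in> ordge k" and F: "finite F" "evs k \<subseteq> F"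
  shows "esum a - (\<Sum>l\<in>F. a l) \<in> ordge k"
  unfolding ordge_def
proof (intro CollectI allI impI)
  fix c :: "'n \<Rightarrow> nat" assume c: "mdeg c < k"
  let ?E = "evs (Suc (mdeg c))"
  have out: "mps_coeff (a l) c = 0" if "l \<notin> ?E \<or> l \<notin> F" for l
    using that a[of l "Suc (mdeg c)"] a[of l k] c F(2) by (auto simp: ordge_def)
  have "(\<Sum>l\<in>?E. mps_coeff (a l) c) = (\<Sum>l\<in>?E \<inter> F. mps_coeff (a l) c)"
    by (rule sum.mono_neutral_right) (auto simp: out)
  also have "\<dots> = (\<Sum>l\<in>F. mps_coeff (a l) c)"
    by (rule sum.mono_neutral_left) (use F(1) out in blast)+
  finally show "mps_coeff (esum a - (\<Sum>l\<in>F. a l)) c = 0"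
    by (simp add: esum_def Abs_mps_inverse)
qed

text \<open>Summability is automatic: a vector fixed by \<open>proj l\<close> has order at least
  \<open>k\<close> whenever \<open>l\<close> is outside \<open>evs k\<close>.\<close>

lemma proj_esum:
  assumes a: "\<And>l. proj l (a l) = a l"
  shows "proj m (esum a) = a m"
proof (rule ordge_eqI)
  fix k
  have a': "a l \<in> ordge k" if "l \<notin> evs k" for k l using proj_outside[OF that, of "a l"] a by simp
  define F where "F = insert m (evs k)"
  have "proj m (esum a - (\<Sum>l\<in>F. a l)) \<in> ordge k"
    by (intro proj_ordge esum_approx[OF a']) (auto simp: F_def)
  moreover have "proj m (\<Sum>l\<in>F. a l) = a m"
  proof -
    have "proj m (a l) = (if l = m then a m else 0)" for l
    proof (cases "l = m")
      case False
      have "proj m (a l) = proj m (proj l (a l))" by (simp only: a)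
      also have "\<dots> = 0" unfolding proj_proj using False by simp
      finally show ?thesis using False by simp
    qed (simp add: a)
    then show ?thesis by (simp add: proj_sum F_def)
  qed
  ultimately show "proj m (esum a) - a m \<in> ordge k" by (simp add: proj_diff)
qed

section \<open>The semisimple part\<close>

definition ss :: "'n mps \<Rightarrow> 'n mps" where
  "ss h = esum (\<lambda>l. mps_scale l (proj l h))"

lemma ss_approx: "ss h - (\<Sum>l\<in>evs k. mps_scale l (proj l h)) \<in> ordge k"
  unfolding ss_def by (rule esum_approx) (auto intro: ordge_scale proj_outside)

lemma ss_add: "ss (g + h) = ss g + ss h"
  and ss_scale: "ss (mps_scale z h) = mps_scale z (ss h)"
  by (auto intro!: mps_eqI simp: ss_def esum_def Abs_mps_inverse proj_add proj_scale algebra_simps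
      sum.distrib sum_distrib_left)

lemma ss_ordge: "h \<in> ordge k \<Longrightarrow> ss h \<in> ordge k"
proof -
  assume h: "h \<in> ordge k"
  have "(\<Sum>l\<in>evs k. mps_scale l (proj l h)) \<in> ordge k" by (intro ordge_sum ordge_scale proj_ordge h)
  from ordge_add[OF ss_approx[of h k] this] show ?thesis by simp
qed

lemma proj_ss: "proj l (ss h) = mps_scale l (proj l h)"
  unfolding ss_def by (rule proj_esum) (simp add: proj_scale proj_proj)

lemma ss_eigen:
  assumes "proj l h = h"
  shows "ss h = mps_scale l h"
proof -
  have "proj m (ss h - mps_scale l h) = 0" for m
  proof -
    have "proj m h = (if m = l then h else 0)" using proj_proj[of m l h] assms by auto
    then show ?thesis by (simp add: proj_diff proj_ss proj_scale)
  qed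
  then have "ss h - mps_scale l h = 0" by (rule proj_all_zero)
  then show ?thesis by simp
qed

lemma ss_filtered: "filtered_op ss"
  by unfold_locales (auto simp: ss_add ss_scale intro: ss_ordge)

text \<open>Used to show that \<open>ss\<close> preserves the ideal of a series \<open>f\<close>
  when \<open>T\<close> does.\<close>

lemma ss_approx_act:
  obtains p where "ss h - act T p h \<in> ordge k"
proof -
  define p where "p = (\<Sum>l\<in>evs k. smult l (ep k l))"
  have "(\<Sum>l\<in>evs k. mps_scale l (proj l h - act T (ep k l) h)) \<in> ordge k"
    by (intro ordge_sum ordge_scale proj_ep)
  from ordge_add[OF ss_approx[of h k] this] have "ss h - act T p h \<in> ordge k"
    by (simp add: p_def act_sum act_smult mps_scale_add sum_subtractf)
  then show ?thesis by (rule that)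
qed

text \<open>Since \<open>ss\<close> is the scalar \<open>m\<close> on the image of
  \<open>proj m\<close>, the Lagrange polynomial that is 1 at \<open>l\<close> and 0 at the rest of
  \<open>evs k\<close> produces the projection. Closed subspaces stable under \<open>ss\<close> are
  therefore stable under all projections.\<close>

lemma proj_approx_act_ss:
  obtains p where "proj l h - act ss p h \<in> ordge k"
proof (cases "l \<in> evs k")
  case False
  then have "proj l h - act ss 0 h \<in> ordge k" using proj_outside by (simp add: act_def)
  then show ?thesis by (rule that)
next
  case True
  interpret S: filtered_op ss by (rule ss_filtered)
  define p where "p = (\<Prod>m\<in>evs k - {l}. smult (inverse (l - m)) [:-m, 1:])"
  have "poly p m = (if m = l then 1 else 0)" if "m \<in> evs k" for m
  proof (cases "m = l")
    case True
    have "poly (smult (inverse (l - i)) [:-i, 1:]) l = 1" if "i \<in> evs k - {l}" for i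
    proof -
      have "poly (smult (inverse (l - i)) [:-i, 1:]) l = inverse (l - i) * (l - i)"
        by (simp add: algebra_simps)
      also have "\<dots> = 1" using that by (intro left_inverse) auto
      finally show ?thesis .
    qed
    then have "poly p l = 1" unfolding p_def poly_prod by (intro prod.neutral) blast
    then show ?thesis using True by simp
  next
    case False
    then have "(\<Prod>i\<in>evs k - {l}. poly (smult (inverse (l - i)) [:-i, 1:]) m) = 0"
      using that by (intro prod_zero) auto
    then show ?thesis using False by (simp add: p_def poly_prod)
  qed
  then have "(\<Sum>m\<in>evs k. mps_scale (poly p m) (proj m h)) = (\<Sum>m\<in>evs k. if m = l then proj l h else 0)"
    by (intro sum.cong) auto
  moreover have "act ss p (proj m h) = mps_scale (poly p m) (proj m h)" for m
    by (intro S.act_eigen ss_eigen) (simp add: proj_proj)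
  ultimately have "(\<Sum>m\<in>evs k. act ss p (proj m h)) = proj l h"
    using True by simp
  moreover have "act ss p (h - (\<Sum>m\<in>evs k. proj m h)) \<in> ordge k"
    by (intro S.act_ordge proj_partition)
  ultimately have "act ss p h - proj l h \<in> ordge k" by (simp add: S.act_minus S.act_sum')
  then have "proj l h - act ss p h \<in> ordge k" using ordge_uminus by fastforce
  then show ?thesis by (rule that)
qed

text \<open>\<open>W l\<close> is the part of \<open>H\<close> in one generalized eigenspace, where
  \<open>ss\<close> is a scalar, so any linear projection \<open>P l\<close> onto it is compatible
  with \<open>ss\<close>. \<open>K\<close> consists of the series whose components are all killed by
  the \<open>P l\<close>. The \<open>H\<close>-part of a series is reassembled by
  \<open>esum\<close> and lies in \<open>H\<close> because \<open>H\<close> is closed.\<close>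

theorem ss_complement:
  fixes H :: "'n mps set"
  assumes H: "module.subspace mps_scale H" "closedin mps_topology H" "ss ` H \<subseteq> H"
  shows "\<exists>K. module.subspace mps_scale K \<and> ss ` K \<subseteq> K \<and>
            H \<inter> K = {0} \<and> {h + k | h k. h \<in> H \<and> k \<in> K} = UNIV"
proof -
  interpret S: filtered_op ss by (rule ss_filtered)
  interpret V: vector_space "mps_scale :: complex \<Rightarrow> 'n mps \<Rightarrow> 'n mps"
    by unfold_locales (auto intro!: mps_eqI simp: algebra_simps)
  interpret VV: vector_space_pair "mps_scale :: complex \<Rightarrow> 'n mps \<Rightarrow> 'n mps" "mps_scale :: complex \<Rightarrow> 'n mps \<Rightarrow> 'n mps"
    by unfold_locales
  note Hsub = H(1)[unfolded V.subspace_def]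
  have projH: "proj l h \<in> H" if h: "h \<in> H" for l h
  proof (rule closed_approx[OF H(2)])
    fix k
    obtain p where p: "proj l h - act ss p h \<in> ordge k" using proj_approx_act_ss .
    have "act ss p h \<in> H" using Hsub H(3) h by (intro S.act_subspace) auto
    with p show "\<exists>s\<in>H. proj l h - s \<in> ordge k" by blast
  qed
  define W where "W l = {h \<in> H. proj l h = h}" for l
  have "\<exists>P. P ` UNIV \<subseteq> W l \<and> Vector_Spaces.linear mps_scale mps_scale P \<and> (\<forall>v\<in>W l. P (id v) = v)" for l
  proof (rule VV.linear_exists_left_inverse_on)
    show "V.subspace (W l)"
      using Hsub by (auto simp: V.subspace_def W_def proj_add proj_scale)
    show "Vector_Spaces.linear mps_scale mps_scale (id :: 'n mps \<Rightarrow> _)" by (rule V.linear_id)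
  qed auto
  then obtain P where P: "\<And>l v. P l v \<in> W l" "\<And>l. Vector_Spaces.linear mps_scale mps_scale (P l)"
    "\<And>l v. v \<in> W l \<Longrightarrow> P l v = v"
    by (metis id_apply rangeI subset_eq)
  have Padd: "P l (u + v) = P l u + P l v" and Pscale: "P l (mps_scale z u) = mps_scale z (P l u)" for l u v z
    using P(2)[of l] by (simp_all add: Vector_Spaces.linear_iff)
  have P0: "P l 0 = 0" for l using Pscale[of l 0 0] by simp
  have Pdiff: "P l (u - v) = P l u - P l v" for l u v using Padd[of l "u - v" v] by (simp add: algebra_simps)
  define K where "K = {h. \<forall>l. P l (proj l h) = 0}"
  have "V.subspace K"
    by (auto simp: V.subspace_def K_def proj_add proj_scale Padd Pscale P0)
  moreover have "ss ` K \<subseteq> K"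
    by (auto simp: K_def proj_ss Pscale)
  moreover have "H \<inter> K = {0}"
  proof -
    have "h = 0" if h: "h \<in> H" "h \<in> K" for h
    proof (rule proj_all_zero)
      fix l
      have "proj l h \<in> W l" using projH[OF h(1)] by (simp add: W_def proj_proj)
      then have "P l (proj l h) = proj l h" by (rule P(3))
      then show "proj l h = 0" using h(2) by (simp add: K_def)
    qed
    moreover have "0 \<in> H" "0 \<in> K" using Hsub by (auto simp: K_def P0)
    ultimately show ?thesis by blast
  qed
  moreover have "{h + k | h k. h \<in> H \<and> k \<in> K} = UNIV"
  proof -
    have "\<exists>h k. g = h + k \<and> h \<in> H \<and> k \<in> K" for g
    proof -
      define a where "a l = P l (proj l g)" for l
      have a: "a l \<in> H" "proj l (a l) = a l" for l using P(1)[of l "proj l g"] by (auto simp: a_def W_def)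
      have a': "a l \<in> ordge k" if "l \<notin> evs k" for k l using proj_outside[OF that, of "a l"] a by simp
      have "esum a \<in> H"
      proof (rule closed_approx[OF H(2)])
        fix k
        have "(\<Sum>l\<in>evs k. a l) \<in> H" using a(1) by (intro V.subspace_sum[OF H(1)]) auto
        moreover have "esum a - (\<Sum>l\<in>evs k. a l) \<in> ordge k" by (rule esum_approx[OF a']) auto
        ultimately show "\<exists>s\<in>H. esum a - s \<in> ordge k" by blast
      qed
      moreover have "g - esum a \<in> K"
      proof -
        have "P l (proj l (g - esum a)) = 0" for l
        proof -
          have "P l (a l) = a l" using a by (intro P(3)) (simp add: W_def)
          then show ?thesis by (simp add: proj_diff proj_esum[of a, OF a(2)] Pdiff) (simp add: a_def)
        qed
        then show ?thesis by (simp add: K_def)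
      qed
      ultimately show ?thesis by (intro exI[of _ "esum a"] exI[of _ "g - esum a"]) simp
    qed
    then show ?thesis by blast
  qed
  ultimately show ?thesis by blast
qed

section \<open>The topologically nilpotent part\<close>

definition np :: "'n mps \<Rightarrow> 'n mps" where
  "np h = T h - ss h"

lemma np_add: "np (g + h) = np g + np h"
  and np_scale: "np (mps_scale z h) = mps_scale z (np h)"
  by (simp_all add: np_def T_add ss_add T_scale ss_scale mps_scale_add)

lemma np_ordge: "h \<in> ordge k \<Longrightarrow> np h \<in> ordge k"
  by (simp add: np_def ordge_diff T_ordge ss_ordge)

text \<open>On the generalized eigenspace of \<open>l\<close> the operator \<open>ss\<close> is the
  scalar \<open>l\<close>, so \<open>np\<close> is \<open>T - l\<close> there.\<close>

lemma np_power_eigen: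
  assumes "proj l h = h"
  shows "(np ^^ m) h = act T ([:-l, 1:] ^ m) h \<and> proj l ((np ^^ m) h) = (np ^^ m) h"
proof (induction m)
  case (Suc m)
  let ?g = "(np ^^ m) h"
  have g: "proj l ?g = ?g" "?g = act T ([:-l, 1:] ^ m) h" using Suc by auto
  have n0: "np ?g = T ?g - mps_scale l ?g" using ss_eigen[OF g(1)] np_def[of ?g] by simp
  also have "\<dots> = act T [:-l, 1:] ?g"
    by (auto intro!: mps_eqI simp: act_pCons)
  finally have n: "np ?g = act T [:-l, 1:] ?g" .
  then have "np ?g = act T ([:-l, 1:] ^ Suc m) h" unfolding power_Suc act_mult g(2)[symmetric] .
  moreover have "proj l (np ?g) = np ?g"
    by (simp only: n0 proj_diff proj_T proj_scale g(1))
  ultimately show ?case by simp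
qed (simp add: assms)

text \<open>Modulo order \<open>k\<close> a series is a finite sum of generalized eigenvectors, each
  killed by a power of \<open>np\<close>; the largest exponent serves all of them.\<close>

lemma np_nilpotent: "\<exists>M. \<forall>m\<ge>M. (np ^^ m) h \<in> ordge k"
proof -
  have pw: "(np ^^ m) (g + h) = (np ^^ m) g + (np ^^ m) h" for m g h by (induction m) (auto simp: np_add)
  have pw0: "(np ^^ m) g \<in> ordge k" if "g \<in> ordge k" for m g using that by (induction m) (auto simp: np_ordge)
  have pws: "(np ^^ m) (sum g I) = (\<Sum>i\<in>I. (np ^^ m) (g i))" for m g and I :: "complex set"
    by (rule module_hom_sumD) (rule pw)
  have "\<exists>M. \<forall>m\<ge>M. (np ^^ m) (proj l h) \<in> ordge k" for l
  proof -
    have p: "proj l (proj l h) = proj l h" by (simp add: proj_proj)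
    obtain M where M: "act T ([:-l, 1:] ^ M) (proj l h) \<in> ordge k" using p proj_fixed_iff by blast
    then have 1: "(np ^^ M) (proj l h) \<in> ordge k" using np_power_eigen[OF p, of M] by simp
    have "(np ^^ m) (proj l h) \<in> ordge k" if "m \<ge> M" for m
    proof -
      have "(np ^^ m) (proj l h) = (np ^^ (m - M)) ((np ^^ M) (proj l h))"
        using that by (simp flip: funpow_add comp_apply[of "np ^^ (m - M)" "np ^^ M"])
      then show ?thesis using pw0[OF 1] by simp
    qed
    then show ?thesis by blast
  qed
  then obtain M where M: "\<And>l m. m \<ge> M l \<Longrightarrow> (np ^^ m) (proj l h) \<in> ordge k" by metis
  have "(np ^^ m) h \<in> ordge k" if m: "m \<ge> Max (insert 0 (M ` evs k))" for m
  proof -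
    have "(np ^^ m) (\<Sum>l\<in>evs k. proj l h) \<in> ordge k"
      unfolding pws using m by (intro ordge_sum M) (auto simp: Max_ge_iff)
    moreover have "(np ^^ m) (h - (\<Sum>l\<in>evs k. proj l h)) \<in> ordge k" by (intro pw0 proj_partition)
    ultimately have "(np ^^ m) ((h - (\<Sum>l\<in>evs k. proj l h)) + (\<Sum>l\<in>evs k. proj l h)) \<in> ordge k"
      unfolding pw by (intro ordge_add)
    then show ?thesis by simp
  qed
  then show ?thesis by blast
qed

end

section \<open>Semisimple and nilpotent parts of a derivation\<close>

locale singular_derivation =
  fixes T :: "'n::finite mps \<Rightarrow> 'n mps"
  assumes der: "derivation mps_scale T" and sing: "singular_der mps_var T"
begin

sublocale filtered_op T
proof
  fix f g z k
  show "T (f + g) = T f + T g" "T (mps_scale z f) = mps_scale z (T f)"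
    using der by (auto simp: derivation_mps_iff)
  assume "f \<in> ordge k"
  then show "T f \<in> ordge k"
    using sing by (subst derivation_eq_vf[OF der]) (auto intro!: vf_ordge simp: singular_der_def max_ideal_mps)
qed

lemma T_mult: "T (g * h) = g * T h + h * T g"
  using der by (auto simp: derivation_mps_iff)

text \<open>\<open>T - (l + m)\<close> acts on a product as \<open>T - l\<close> on the first factor
  plus \<open>T - m\<close> on the second, so each application uses up one unit of \<open>a\<close>
  or of \<open>b\<close>.\<close>

lemma generalized_leibniz:
  assumes "act T ([:-l, 1:] ^ a) g \<in> ordge k" "act T ([:-m, 1:] ^ b) h \<in> ordge k"
  shows "act T ([:-(l + m), 1:] ^ (a + b)) (g * h) \<in> ordge k"
  using assms
proof (induction "a + b" arbitrary: a b g h)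
  case 0
  then have "g \<in> ordge k" by simp
  then show ?case using 0 by (simp add: ordge_mult_left)
next
  case (Suc n)
  show ?case
  proof (cases "a = 0 \<or> b = 0")
    case True
    then have "g * h \<in> ordge k" using Suc.prems by (auto intro: ordge_mult_left ordge_mult_right)
    then show ?thesis by (rule act_ordge)
  next
    case False
    then obtain a' b' where ab: "a = Suc a'" "b = Suc b'" by (metis not0_implies_Suc)
    have lin: "act T [:-z, 1:] f = T f - mps_scale z f" for z f
      by (auto intro!: mps_eqI simp: act_pCons)
    have step: "act T [:-(l + m), 1:] (g * h) = act T [:-l, 1:] g * h + g * act T [:-m, 1:] h"
      unfolding lin T_mult by (simp add: mps_scale_add mps_scale_mult mps_mult_scale algebra_simps)
    have sw: "act T (p ^ Suc i) f = act T (p ^ i) (act T p f)" for p i f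
      by (simp add: mult.commute[of p] flip: act_mult)
    have "act T ([:-(l + m), 1:] ^ (a' + b)) (act T [:-l, 1:] g * h) \<in> ordge k"
      using Suc.prems Suc.hyps(2) by (intro Suc.hyps(1)) (simp_all add: ab sw[symmetric] del: power_Suc)
    moreover have "act T ([:-(l + m), 1:] ^ (a + b')) (g * act T [:-m, 1:] h) \<in> ordge k"
      using Suc.prems Suc.hyps(2) by (intro Suc.hyps(1)) (simp_all add: ab sw[symmetric] del: power_Suc)
    ultimately have "act T ([:-(l + m), 1:] ^ (a' + b)) (act T [:-(l + m), 1:] (g * h)) \<in> ordge k"
      unfolding step act_plus by (intro ordge_add) (simp_all add: ab)
    then show ?thesis by (simp add: ab sw del: power_Suc)
  qed
qed

lemma proj_mult:
  assumes "proj l g = g" "proj m h = h"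
  shows "proj (l + m) (g * h) = g * h"
proof -
  have "\<forall>k. \<exists>a. act T ([:-(l + m), 1:] ^ a) (g * h) \<in> ordge k"
  proof
    fix k
    obtain a b where "act T ([:-l, 1:] ^ a) g \<in> ordge k" "act T ([:-m, 1:] ^ b) h \<in> ordge k"
      using assms proj_fixed_iff by blast
    from generalized_leibniz[OF this] show "\<exists>a. act T ([:-(l + m), 1:] ^ a) (g * h) \<in> ordge k" by blast
  qed
  then show ?thesis by (rule proj_fixed_iff[THEN iffD2])
qed

text \<open>For generalized eigenvectors the eigenvalues add under multiplication, which is the
  Leibniz rule. Modulo order \<open>k\<close> both arguments are finite sums \<open>G\<close> and
  \<open>H\<close> of such vectors, and \<open>ss\<close> respects the filtration.\<close>

lemma ss_mult: "ss (g * h) = g * ss h + h * ss g"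
proof (rule ordge_eqI)
  fix k
  define G where "G = (\<Sum>l\<in>evs k. proj l g)"
  define H where "H = (\<Sum>l\<in>evs k. proj l h)"
  have G: "g - G \<in> ordge k" and H: "h - H \<in> ordge k" unfolding G_def H_def by (rule proj_partition)+
  interpret S: filtered_op ss by (rule ss_filtered)
  have sG: "ss G = (\<Sum>l\<in>evs k. mps_scale l (proj l g))" and sH: "ss H = (\<Sum>l\<in>evs k. mps_scale l (proj l h))"
    unfolding G_def H_def S.T_sum by (intro sum.cong refl ss_eigen, simp add: proj_proj)+
  have "ss (G * H) = (\<Sum>l\<in>evs k. \<Sum>m\<in>evs k. ss (proj l g * proj m h))"
    unfolding G_def H_def sum_product S.T_sum ..
  also have "\<dots> = (\<Sum>l\<in>evs k. \<Sum>m\<in>evs k. mps_scale (l + m) (proj l g * proj m h))"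
    by (intro sum.cong refl ss_eigen proj_mult) (auto simp: proj_proj)
  also have "\<dots> = (\<Sum>l\<in>evs k. \<Sum>m\<in>evs k. mps_scale l (proj l g) * proj m h) +
      (\<Sum>l\<in>evs k. \<Sum>m\<in>evs k. proj l g * mps_scale m (proj m h))"
    by (simp add: mps_scale_add mps_scale_mult mps_mult_scale sum.distrib)
  also have "\<dots> = ss G * H + G * ss H"
    unfolding sG sH unfolding G_def H_def sum_product ..
  finally have GH: "ss (G * H) = G * ss H + H * ss G" by (simp add: mult.commute)
  have "g * h - G * H = (g - G) * h + G * (h - H)" by (simp add: algebra_simps)
  then have "g * h - G * H \<in> ordge k"
    using ordge_add[OF ordge_mult_left[OF G] ordge_mult_right[OF H]] by simp
  then have 1: "ss (g * h) - ss (G * H) \<in> ordge k" using ss_ordge S.T_diff by metis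
  have "g * ss h - G * ss H = (g - G) * ss h + G * ss (h - H)" by (simp add: S.T_diff algebra_simps)
  then have 2: "g * ss h - G * ss H \<in> ordge k"
    using ordge_add[OF ordge_mult_left[OF G] ordge_mult_right[OF ss_ordge[OF H]]] by simp
  have "h * ss g - H * ss G = (h - H) * ss g + H * ss (g - G)" by (simp add: S.T_diff algebra_simps)
  then have 3: "h * ss g - H * ss G \<in> ordge k"
    using ordge_add[OF ordge_mult_left[OF H] ordge_mult_right[OF ss_ordge[OF G]]] by simp
  have E: "ss (g * h) - (g * ss h + h * ss g) = (ss (g * h) - ss (G * H)) - (g * ss h - G * ss H) - (h * ss g - H * ss G)"
    by (simp add: GH)
  show "ss (g * h) - (g * ss h + h * ss g) \<in> ordge k"
    unfolding E by (intro ordge_diff 1 2 3)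
qed

lemma derivation_ss: "derivation mps_scale ss"
  by (simp add: derivation_mps_iff ss_add ss_scale ss_mult)

lemma derivation_np: "derivation mps_scale np"
  by (simp add: derivation_mps_iff np_add np_scale) (simp add: np_def T_mult ss_mult algebra_simps)

lemma semisimple_ss: "semisimple_der ss"
  unfolding semisimple_der_def
proof (intro conjI allI impI)
  show "derivation mps_scale ss" by (rule derivation_ss)
  show "singular_der mps_var ss"
    unfolding singular_der_def max_ideal_mps by (intro allI ss_ordge mps_var_ordge)
  fix H :: "'n mps set"
  assume H: "module.subspace mps_scale H \<and> closedin mps_topology H \<and> ss ` H \<subseteq> H"
  show "\<exists>K. module.subspace mps_scale K \<and> ss ` K \<subseteq> K \<and>
    H \<inter> K = {0} \<and> {h + k |h k. h \<in> H \<and> k \<in> K} = UNIV"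
    using H by (elim conjE) (rule ss_complement)
qed

lemma top_nilpotent_np: "top_nilpotent_der np"
  unfolding top_nilpotent_der_def
proof (intro conjI allI)
  show "derivation mps_scale np" by (rule derivation_np)
  show "singular_der mps_var np"
    unfolding singular_der_def max_ideal_mps by (intro allI np_ordge mps_var_ordge)
  fix h
  show "limitin mps_topology (\<lambda>m. (np ^^ m) h) 0 sequentially"
    unfolding limitin_def topspace_mps
  proof (intro conjI allI impI)
    fix U :: "'n mps set" assume U: "openin mps_topology U \<and> 0 \<in> U"
    then obtain k where k: "\<And>h. h - 0 \<in> ordge k \<Longrightarrow> h \<in> U"
      unfolding openin_adic_topology ideal_power_mps by blast
    obtain M where "\<forall>m\<ge>M. (np ^^ m) h \<in> ordge k" using np_nilpotent by blast
    then show "\<forall>\<^sub>F m in sequentially. (np ^^ m) h \<in> U"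
      using k by (auto simp: eventually_sequentially)
  qed simp
qed

lemma dvd_ss:
  assumes "f dvd T f"
  shows "f dvd ss f"
proof -
  obtain p :: "'n \<Rightarrow> nat" where "weights p" using ex_weights by blast
  then interpret weights p .
  show ?thesis
  proof (rule dvd_if_approx)
    fix k
    obtain q where q: "ss f - act T q f \<in> ordge k" using ss_approx_act .
    have "f dvd T h" if d: "f dvd h" for h
    proof -
      obtain s where "h = f * s" using d by blast
      then show ?thesis using assms by (simp add: T_mult)
    qed
    moreover have "f dvd mps_scale z h" if "f dvd h" for z h
      using dvd_mult[OF that, of "mps_scale z 1"] by (simp add: mps_scale_mult)
    ultimately have "act T q f \<in> {h. f dvd h}" by (intro act_subspace) auto
    then have "f dvd act T q f" by simp
    then obtain s where "act T q f = s * f" unfolding dvd_def by (auto simp: mult.commute)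
    with q show "\<exists>s. ss f - s * f \<in> ordge k" by (intro exI[of _ s]) simp
  qed
qed

lemma dvd_np: "f dvd T f \<Longrightarrow> f dvd np f"
  using dvd_ss by (simp add: np_def)

lemma ss_plus_np: "T h = ss h + np h"
  by (simp add: np_def)

end

section \<open>Choosing the new basis\<close>

lemma row_combination_unit:
  fixes W :: "'a::idom^'n::finite^'n"
  assumes "det W dvd 1"
  obtains y where "\<And>j. v j = (\<Sum>i\<in>UNIV. y i * W $ i $ j)"
proof -
  obtain u where u: "1 = det W * u" using assms by blast
  have nz: "det W \<noteq> 0" using u by auto
  define y where "y k = u * det (\<chi> i j. if i = k then v j else W $ i $ j)" for k
  have "det (\<chi> i j. if i = k then v j else W $ i $ j) = y k * det W" for k
  proof -
    have "y k * det W = det W * u * det (\<chi> i j. if i = k then v j else W $ i $ j)"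
      by (simp add: y_def mult_ac)
    then show ?thesis by (simp flip: u)
  qed
  from row_combination_idom[OF nz this] show ?thesis by (intro that)
qed

lemma independent_rows:
  fixes M :: "'a::idom^'n::finite^'n"
  assumes "det M \<noteq> 0" "\<And>j. (\<Sum>i\<in>UNIV. u i * M $ i $ j) = 0"
  shows "u k = 0"
proof -
  let ?N = "\<chi> i j. if j = k then (\<Sum>l\<in>UNIV. transpose M $ i $ l * u l) else transpose M $ i $ j"
  have "u k * det (transpose M) = det ?N" by (rule cramer_idom[symmetric])
  also have "\<dots> = det (transpose ?N)" by (simp only: det_transpose)
  also have "transpose ?N = (\<chi> i. if i = k then 0 else row i M)"
    using assms(2) by (auto simp: vec_eq_iff transpose_def row_def mult.commute)
  also have "det \<dots> = 0" by (rule det_row_0)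
  finally show ?thesis using assms(1) by (simp add: det_transpose)
qed

text \<open>Invertibility of \<open>W\<close> over the ring lets the rows of \<open>W ** A\<close>
  generate those of \<open>A\<close>; independence follows from the nonzero determinant.\<close>

lemma der_basis_of_unit_matrix:
  fixes A W :: "'n::finite mps^'n^'n"
  assumes A: "det A \<noteq> 0" "\<And>i. f dvd vf (\<lambda>j. A $ i $ j) f"
    "\<And>v. f dvd vf v f \<Longrightarrow> \<exists>w. \<forall>j. v j = (\<Sum>i\<in>UNIV. w i * A $ i $ j)"
    and W: "det W dvd 1"
    and \<delta>: "\<And>i. \<delta> i = vf (\<lambda>j. (W ** A) $ i $ j)"
  shows "inj \<delta>" "der_basis (range \<delta>) (log_der mps_scale f)"
proof -
  interpret D: Modules.module "der_scale :: 'n mps \<Rightarrow> _" by (rule module_der)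
  define M where "M = W ** A"
  have "det W \<noteq> 0" using W by auto
  then have M: "det M \<noteq> 0" using A(1) by (simp add: M_def det_mul)
  show inj: "inj \<delta>"
  proof (rule injI, rule ccontr)
    fix i j assume "\<delta> i = \<delta> j" and ij: "i \<noteq> j"
    then have "(\<lambda>l. M $ i $ l) = (\<lambda>l. M $ j $ l)" by (simp add: \<delta> vf_eq_iff M_def)
    then have "row i M = row j M" by (simp add: row_def fun_eq_iff)
    then have "det M = 0" by (rule det_identical_rows[OF ij])
    with M show False by simp
  qed
  have sum: "(\<Sum>b\<in>range \<delta>. der_scale (u b) b) = vf (\<lambda>j. \<Sum>i\<in>UNIV. u (\<delta> i) * M $ i $ j)" for u
  proof -
    have "(\<Sum>b\<in>range \<delta>. der_scale (u b) b) = (\<Sum>i\<in>UNIV. der_scale (u (\<delta> i)) (\<delta> i))"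
      by (simp add: sum.reindex[OF inj])
    also have "\<dots> = (\<Sum>i\<in>UNIV. der_scale (u (\<delta> i)) (vf (\<lambda>j. M $ i $ j)))"
      by (intro sum.cong refl arg_cong[where f = "der_scale _"]) (simp add: \<delta> M_def)
    also have "\<dots> = vf (\<lambda>j. \<Sum>i\<in>UNIV. u (\<delta> i) * M $ i $ j)" by (rule sum_der_scale_vf)
    finally show ?thesis .
  qed
  have "\<not> D.dependent (range \<delta>)"
  proof
    assume "D.dependent (range \<delta>)"
    moreover have "finite (range \<delta>)" by simp
    ultimately obtain u where u: "\<exists>v\<in>range \<delta>. u v \<noteq> 0" "(\<Sum>b\<in>range \<delta>. der_scale (u b) b) = 0"
      using D.dependent_finite by blast
    have "vf (\<lambda>j. \<Sum>i\<in>UNIV. u (\<delta> i) * M $ i $ j) (mps_var j) = 0" for j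
      using u(2) unfolding sum by (simp add: fun_eq_iff zero_fun_apply)
    then have "(\<Sum>i\<in>UNIV. u (\<delta> i) * M $ i $ j) = 0" for j by simp
    then have "u (\<delta> i) = 0" for i using independent_rows[OF M, of "\<lambda>i. u (\<delta> i)" i] by blast
    with u(1) show False by auto
  qed
  moreover have "D.span (range \<delta>) = log_der mps_scale f"
  proof
    have sub: "D.subspace (log_der mps_scale f)"
      unfolding D.subspace_def
    proof (intro conjI ballI allI)
      show "0 \<in> log_der mps_scale f"
        unfolding log_der_mps_iff by (intro exI[of _ "\<lambda>_. 0"]) (auto simp: vf_def fun_eq_iff zero_fun_apply)
      fix x y c assume "x \<in> log_der mps_scale f" "y \<in> log_der mps_scale f"
      then obtain a b where a: "x = vf a" "f dvd vf a f" and b: "y = vf b" "f dvd vf b f"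
        unfolding log_der_mps_iff by blast
      have "x + y = vf (\<lambda>j. a j + b j)" by (rule ext) (simp add: a b vf_def plus_fun_apply distrib_right sum.distrib)
      moreover from this have "vf (\<lambda>j. a j + b j) f = vf a f + vf b f" using a b by (simp add: plus_fun_apply fun_eq_iff)
      ultimately show "x + y \<in> log_der mps_scale f"
        unfolding log_der_mps_iff using a b by (intro exI[of _ "\<lambda>j. a j + b j"]) simp
      have cx: "vf (\<lambda>j. c * a j) g = c * vf a g" for g by (simp add: vf_def sum_distrib_left mult.assoc)
      then show "der_scale c x \<in> log_der mps_scale f"
        unfolding log_der_mps_iff using a by (intro exI[of _ "\<lambda>j. c * a j"]) (auto simp: der_scale_def)
    qed
    have "\<delta> i \<in> log_der mps_scale f" for i
    proof -
      have "vf (\<lambda>j. M $ i $ j) f = (\<Sum>k\<in>UNIV. W $ i $ k * vf (\<lambda>j. A $ k $ j) f)"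
        by (simp add: vf_def M_def matrix_matrix_mult_def sum_distrib_left sum_distrib_right mult.assoc)
          (rule sum.swap)
      also have "f dvd \<dots>" by (intro dvd_sum dvd_mult A)
      finally show ?thesis unfolding log_der_mps_iff \<delta> M_def by blast
    qed
    then show "D.span (range \<delta>) \<subseteq> log_der mps_scale f" by (intro D.span_minimal sub) auto
    show "log_der mps_scale f \<subseteq> D.span (range \<delta>)"
    proof
      fix d assume "d \<in> log_der mps_scale f"
      then obtain v where v: "d = vf v" "f dvd vf v f" unfolding log_der_mps_iff by blast
      obtain w where w: "\<And>j. v j = (\<Sum>k\<in>UNIV. w k * A $ k $ j)" using A(3)[OF v(2)] by blast
      obtain y where y: "\<And>k. w k = (\<Sum>i\<in>UNIV. y i * W $ i $ k)" using row_combination_unit[OF W] by blast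
      have "v j = (\<Sum>i\<in>UNIV. y i * M $ i $ j)" for j
      proof -
        have "v j = (\<Sum>k\<in>UNIV. \<Sum>i\<in>UNIV. y i * W $ i $ k * A $ k $ j)"
          unfolding w by (simp add: y sum_distrib_right)
        also have "\<dots> = (\<Sum>i\<in>UNIV. \<Sum>k\<in>UNIV. y i * W $ i $ k * A $ k $ j)" by (rule sum.swap)
        also have "\<dots> = (\<Sum>i\<in>UNIV. y i * M $ i $ j)"
          by (simp add: M_def matrix_matrix_mult_def sum_distrib_left mult.assoc)
        finally show ?thesis .
      qed
      then have "v = (\<lambda>j. \<Sum>i\<in>UNIV. y i * M $ i $ j)" by (rule ext)
      then have "d = (\<Sum>i\<in>UNIV. der_scale (y i) (vf (\<lambda>j. M $ i $ j)))"
        unfolding v(1) sum_der_scale_vf by simp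
      also have "\<dots> = (\<Sum>i\<in>UNIV. der_scale (y i) (\<delta> i))"
        by (intro sum.cong refl arg_cong[where f = "der_scale _"]) (simp add: \<delta> M_def)
      also have "\<dots> \<in> D.span (range \<delta>)" by (intro D.span_sum D.span_scale D.span_base) auto
      finally show "d \<in> D.span (range \<delta>)" .
    qed
  qed
  ultimately show "der_basis (range \<delta>) (log_der mps_scale f)" by (simp add: der_basis_def)
qed

text \<open>The determinant is additive in each row, so the choice is made one row at a time: a
  nonzero sum has a nonzero summand. The map \<open>h\<close> will be the constant coefficient,
  which is additive and nonzero exactly on units.\<close>

lemma ex_row_choice:
  fixes a :: "'n::finite \<Rightarrow> bool \<Rightarrow> 'a::comm_ring_1^'n"
  assumes h: "\<And>x y. h (x + y) = h x + (h y :: 'b::monoid_add)"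
    and nz: "h (det (\<chi> i. a i True + a i False)) \<noteq> 0"
  shows "\<exists>c. h (det (\<chi> i. a i (c i))) \<noteq> 0"
proof -
  have "\<exists>c. h (det (\<chi> i. if i \<in> F then a i (c i) else a i True + a i False)) \<noteq> 0" if "finite F" for F
    using that
  proof (induction F rule: finite_induct)
    case empty
    then show ?case using nz by simp
  next
    case (insert x F)
    then obtain c where c: "h (det (\<chi> i. if i \<in> F then a i (c i) else a i True + a i False)) \<noteq> 0" by blast
    define g where "g i = (if i \<in> F then a i (c i) else a i True + a i False)" for i
    have e: "(\<chi> i. if i = x then a i z else g i) =
        (\<chi> i. if i \<in> insert x F then a i ((c(x := z)) i) else a i True + a i False)" for z
      using insert.hyps(2) by (auto simp: vec_eq_iff g_def)
    have "(\<chi> i. g i) = (\<chi> i. if i = x then a i True + a i False else g i)"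
      using insert.hyps(2) by (auto simp: vec_eq_iff g_def)
    then have "det (\<chi> i. g i) = det (\<chi> i. if i = x then a i True else g i) + det (\<chi> i. if i = x then a i False else g i)"
      by (simp only: det_row_add)
    moreover have "h (det (\<chi> i. g i)) \<noteq> 0" using c unfolding g_def .
    ultimately have "h (det (\<chi> i. if i = x then a i True else g i)) \<noteq> 0 \<or> h (det (\<chi> i. if i = x then a i False else g i)) \<noteq> 0"
      using h by auto
    then show ?case unfolding e by blast
  qed
  from this[of UNIV] show ?thesis by simp
qed

theorem corollary3p4:
  fixes f :: "'n::finite cps"
  assumes "free_germ f"
    and "\<forall>\<delta>\<in>log_der cps_scale f. singular_der cps_var \<delta>"
  shows "\<exists>\<delta> :: 'n \<Rightarrow> 'n mps \<Rightarrow> 'n mps.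
           inj \<delta> \<and> der_basis (range \<delta>) (log_der mps_scale (to_formal f)) \<and>
           (\<forall>i. semisimple_der (\<delta> i) \<or> top_nilpotent_der (\<delta> i)) \<and>
           (\<exists>u. u dvd 1 \<and> to_formal f = u * det (saito_matrix mps_var \<delta>))"
proof (rule saito_formal[OF assms], goal_cases)
  case A: (1 A)
  let ?f = "to_formal f"
  define T where "T i = vf (\<lambda>j. A $ i $ j)" for i
  have T: "singular_derivation (T i)" for i
    by unfold_locales (auto simp: T_def derivation_vf singular_der_def max_ideal_mps A(2)[simplified])
  define E where "E i c = (if c then filtered_op.ss (T i) else filtered_op.np (T i))" for i c
  have der: "derivation mps_scale (E i c)" and log: "?f dvd E i c ?f"
    and kind: "semisimple_der (E i c) \<or> top_nilpotent_der (E i c)" for i c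
  proof -
    interpret singular_derivation "T i" by (rule T)
    have f: "?f dvd T i ?f" using A(1) by (simp add: T_def)
    show "derivation mps_scale (E i c)" by (simp add: E_def derivation_ss derivation_np)
    show "?f dvd E i c ?f" by (simp add: E_def dvd_ss[OF f] dvd_np[OF f])
    show "semisimple_der (E i c) \<or> top_nilpotent_der (E i c)"
      by (simp add: E_def semisimple_ss top_nilpotent_np)
  qed
  have sumE: "E i True h + E i False h = T i h" for i h
  proof -
    interpret singular_derivation "T i" by (rule T)
    show ?thesis by (simp add: E_def ss_plus_np)
  qed
  define r where "r i c j = E i c (mps_var j)" for i c j
  have r: "E i c = vf (r i c)" for i c
    unfolding r_def by (rule derivation_eq_vf[OF der])
  have "\<forall>i c. \<exists>w. \<forall>j. r i c j = (\<Sum>k\<in>UNIV. w k * A $ k $ j)"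
    using A(5) log unfolding r by blast
  then obtain w where w: "\<And>i c j. r i c j = (\<Sum>k\<in>UNIV. w i c k * A $ k $ j)" by metis
  define a where "a i c = (\<chi> k. w i c k)" for i c
  define W where "W = (\<chi> i. \<Sum>c\<in>UNIV. a i c)"
  have "W ** A = A"
  proof -
    have "(W ** A) $ i $ j = A $ i $ j" for i j
    proof -
      have "(W ** A) $ i $ j = r i True j + r i False j"
        by (simp add: W_def a_def UNIV_bool matrix_matrix_mult_def w distrib_right sum.distrib)
      also have "\<dots> = A $ i $ j" unfolding r_def sumE by (simp add: T_def)
      finally show ?thesis .
    qed
    then show ?thesis by (simp add: vec_eq_iff)
  qed
  \<comment> \<open>Multiplicativity of the determinant and cancellation of \<open>det A\<close>
    already give \<open>det W = 1\<close>, which is all that the choice of rows requires.\<close>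
  then have "det W * det A = 1 * det A" by (metis det_mul mult_1)
  then have "det W = 1" using A(4) by simp
  moreover have "W = (\<chi> i. a i True + a i False)"
    by (simp add: W_def UNIV_bool add.commute)
  ultimately have "mps_coeff (det (\<chi> i. a i True + a i False)) 0 \<noteq> 0"
    by (simp add: mps_coeff_one)
  then obtain c where c: "mps_coeff (det (\<chi> i. a i (c i))) 0 \<noteq> 0"
    using ex_row_choice[of "\<lambda>g. mps_coeff g 0" a] by auto
  define V where "V = (\<chi> i. a i (c i))"
  have V: "det V dvd 1" using c by (simp add: V_def mps_dvd_1_iff)
  define \<delta> where "\<delta> i = E i (c i)" for i
  have VA: "(V ** A) $ i $ j = r i (c i) j" for i j
    by (simp add: V_def a_def matrix_matrix_mult_def w)
  have \<delta>: "\<delta> i = vf (\<lambda>j. (V ** A) $ i $ j)" for i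
    unfolding \<delta>_def r VA ..
  have "saito_matrix mps_var \<delta> = V ** A"
    by (simp add: saito_matrix_def vec_eq_iff VA \<delta>_def r_def)
  then have dets: "det (saito_matrix mps_var \<delta>) = det V * det A" by (simp add: det_mul)
  obtain u where u: "u dvd 1" "?f = u * det A" using A(3) by blast
  obtain v where v: "1 = det V * v" using V by blast
  have "?f = (u * v) * det (saito_matrix mps_var \<delta>)"
  proof -
    have "(u * v) * (det V * det A) = (det V * v) * (u * det A)" by (simp only: mult_ac)
    then show ?thesis unfolding dets u(2)[symmetric] by (simp flip: v)
  qed
  moreover have "u * v dvd 1"
  proof -
    have "v dvd 1" unfolding v by (rule dvd_triv_right)
    from mult_dvd_mono[OF u(1) this] show ?thesis by simp
  qed
  moreover have "inj \<delta>" "der_basis (range \<delta>) (log_der mps_scale ?f)"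
    using der_basis_of_unit_matrix[OF A(4,1,5) V \<delta>] by blast+
  moreover have "semisimple_der (\<delta> i) \<or> top_nilpotent_der (\<delta> i)" for i
    unfolding \<delta>_def by (rule kind)
  ultimately show ?case by blast
qed

end
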